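(* Every scene $S=(G,P,Q,\delta)$ with $|P|\le 2$ has a valid coloring.
   Context: A scene $S=(G,P,Q,\delta)$ consists of: a triangle-free plane graph $G$ (a planar graph with a fixed embedding in the plane) and a possibly empty subset $P\subseteq V(G)$ such that the vertices of $P$ are consecutive on the boundary $K$ of the outer face of $G$; a possibly empty subset $Q\subseteq V(K)\setminus P$ that is an independent set in $G$; and a (not necessarily proper) map $\delta:P\to\{1,2\}$. A (not necessarily proper) coloring $\varphi:V(G)\to\{1,2\}$ is valid for $S$ if $\varphi$ restricted to $P$ equals $\delta$, $\varphi(q)=2$ for all $q\in Q$, and: (G1) $\varphi^{-1}(1)$ induces a forest with maximum degree at most three and $\varphi^{-1}(2)$ induces a forest; (G2) if $\delta(v)=1$ for some $v\in P$ and $uv\in E(G)$ with $u\in V(G)\setminus P$, then $\varphi(u)\ne 1$; (G3) if there is exactly one vertex $v\in P$ with $\delta(v)=1$, and $uv\in E(G)$ for some $u\in Q$, then for every $w\in N_K(v)\setminus\{u\}$ (where $N_K(v)$ is the set of neighbors of $v$ on $K$) there is no path in $G$ with ends $u$ and $w$ all of whose vertices receive the same color under $\varphi$; (G4) if $\varphi(v)=1$ for some $v\in V(K)\setminus P$, then $v$ has at most two neighbors in $\varphi^{-1}(1)$. *)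

theory Defs
  imports "HOL-Analysis.Analysis"
begin

definition plane_graph :: "complex set \<Rightarrow> complex set set \<Rightarrow> (complex set \<Rightarrow> real \<Rightarrow> complex) \<Rightarrow> bool" where
  "plane_graph V E curve \<longleftrightarrow>
     finite V \<and>
     (\<forall>e\<in>E. \<exists>u v. u \<in> V \<and> v \<in> V \<and> u \<noteq> v \<and> e = {u, v}) \<and>
     (\<forall>e\<in>E. arc (curve e) \<and> {pathstart (curve e), pathfinish (curve e)} = e) \<and>
     (\<forall>e\<in>E. path_image (curve e) \<inter> V = e) \<and>
     (\<forall>e\<in>E. \<forall>e'\<in>E. e \<noteq> e' \<longrightarrow> path_image (curve e) \<inter> path_image (curve e') \<subseteq> e \<inter> e')"

definition adj :: "complex set set \<Rightarrow> complex \<Rightarrow> complex \<Rightarrow> bool" where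
  "adj E u v \<longleftrightarrow> {u, v} \<in> E"

definition triangle_free :: "complex set \<Rightarrow> complex set set \<Rightarrow> bool" where
  "triangle_free V E \<longleftrightarrow>
     \<not> (\<exists>a\<in>V. \<exists>b\<in>V. \<exists>c\<in>V. adj E a b \<and> adj E b c \<and> adj E a c)"

definition drawing :: "complex set \<Rightarrow> complex set set \<Rightarrow> (complex set \<Rightarrow> real \<Rightarrow> complex) \<Rightarrow> complex set" where
  "drawing V E curve = V \<union> (\<Union>e\<in>E. path_image (curve e))"

definition outer_face :: "complex set \<Rightarrow> complex set set \<Rightarrow> (complex set \<Rightarrow> real \<Rightarrow> complex) \<Rightarrow> complex set" where
  "outer_face V E curve = outside (drawing V E curve)"

definition boundary_vertices :: "complex set \<Rightarrow> complex set set \<Rightarrow> (complex set \<Rightarrow> real \<Rightarrow> complex) \<Rightarrow> complex set" where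
  "boundary_vertices V E curve = {v \<in> V. v \<in> frontier (outer_face V E curve)}"

definition boundary_edges :: "complex set \<Rightarrow> complex set set \<Rightarrow> (complex set \<Rightarrow> real \<Rightarrow> complex) \<Rightarrow> complex set set" where
  "boundary_edges V E curve = {e \<in> E. path_image (curve e) \<subseteq> frontier (outer_face V E curve)}"

definition N_K :: "complex set \<Rightarrow> complex set set \<Rightarrow> (complex set \<Rightarrow> real \<Rightarrow> complex) \<Rightarrow> complex \<Rightarrow> complex set" where
  "N_K V E curve v = {u. {u, v} \<in> boundary_edges V E curve}"

text \<open>Vertices of P consecutive on K; since the theorem only concerns |P| \<le> 2,
  for two vertices this means they are joined by an edge of K.\<close>
definition consecutive_on_K :: "complex set \<Rightarrow> complex set set \<Rightarrow> (complex set \<Rightarrow> real \<Rightarrow> complex) \<Rightarrow> complex set \<Rightarrow> bool" where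
  "consecutive_on_K V E curve P \<longleftrightarrow>
     P \<subseteq> boundary_vertices V E curve \<and>
     (card P \<ge> 2 \<longrightarrow> card P = 2 \<and> P \<in> boundary_edges V E curve)"

definition scene :: "complex set \<Rightarrow> complex set set \<Rightarrow> (complex set \<Rightarrow> real \<Rightarrow> complex)
    \<Rightarrow> complex set \<Rightarrow> complex set \<Rightarrow> (complex \<Rightarrow> nat) \<Rightarrow> bool" where
  "scene V E curve P Q \<delta> \<longleftrightarrow>
     plane_graph V E curve \<and> triangle_free V E \<and>
     P \<subseteq> V \<and> consecutive_on_K V E curve P \<and>
     Q \<subseteq> boundary_vertices V E curve - P \<and>
     (\<forall>u\<in>Q. \<forall>v\<in>Q. \<not> adj E u v) \<and>
     (\<forall>v\<in>P. \<delta> v \<in> {1, 2})"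

definition has_cycle_in :: "complex set set \<Rightarrow> complex set \<Rightarrow> bool" where
  "has_cycle_in E A \<longleftrightarrow>
     (\<exists>cs. length cs \<ge> 3 \<and> distinct cs \<and> set cs \<subseteq> A \<and>
        (\<forall>i. Suc i < length cs \<longrightarrow> adj E (cs ! i) (cs ! Suc i)) \<and>
        adj E (last cs) (hd cs))"

definition induces_forest :: "complex set set \<Rightarrow> complex set \<Rightarrow> bool" where
  "induces_forest E A \<longleftrightarrow> \<not> has_cycle_in E A"

definition max_degree_le :: "complex set set \<Rightarrow> complex set \<Rightarrow> nat \<Rightarrow> bool" where
  "max_degree_le E A k \<longleftrightarrow> (\<forall>v\<in>A. card {u\<in>A. adj E u v} \<le> k)"

definition mono_path :: "complex set \<Rightarrow> complex set set \<Rightarrow> (complex \<Rightarrow> nat) \<Rightarrow> complex \<Rightarrow> complex \<Rightarrow> bool" where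
  "mono_path V E \<phi> u w \<longleftrightarrow>
     (\<exists>ps. ps \<noteq> [] \<and> hd ps = u \<and> last ps = w \<and> distinct ps \<and> set ps \<subseteq> V \<and>
        (\<forall>i. Suc i < length ps \<longrightarrow> adj E (ps ! i) (ps ! Suc i)) \<and>
        (\<forall>x\<in>set ps. \<phi> x = \<phi> u))"

definition valid_coloring :: "complex set \<Rightarrow> complex set set \<Rightarrow> (complex set \<Rightarrow> real \<Rightarrow> complex)
    \<Rightarrow> complex set \<Rightarrow> complex set \<Rightarrow> (complex \<Rightarrow> nat) \<Rightarrow> (complex \<Rightarrow> nat) \<Rightarrow> bool" where
  "valid_coloring V E curve P Q \<delta> \<phi> \<longleftrightarrow>
     (\<forall>v\<in>V. \<phi> v \<in> {1, 2}) \<and>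
     (\<forall>v\<in>P. \<phi> v = \<delta> v) \<and>
     (\<forall>q\<in>Q. \<phi> q = 2) \<and>
     \<comment> \<open>(G1)\<close>
     induces_forest E {v\<in>V. \<phi> v = 1} \<and> max_degree_le E {v\<in>V. \<phi> v = 1} 3 \<and>
     induces_forest E {v\<in>V. \<phi> v = 2} \<and>
     \<comment> \<open>(G2)\<close>
     (\<forall>v\<in>P. \<forall>u\<in>V - P. \<delta> v = 1 \<and> adj E u v \<longrightarrow> \<phi> u \<noteq> 1) \<and>
     \<comment> \<open>(G3)\<close>
     (\<forall>v\<in>P. \<forall>u\<in>Q. ({x\<in>P. \<delta> x = 1} = {v} \<and> adj E u v) \<longrightarrow>
        (\<forall>w\<in>N_K V E curve v - {u}. \<not> mono_path V E \<phi> u w)) \<and>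
     \<comment> \<open>(G4)\<close>
     (\<forall>v\<in>boundary_vertices V E curve - P. \<phi> v = 1 \<longrightarrow>
        card {u\<in>V. \<phi> u = 1 \<and> adj E u v} \<le> 2)"

end

theory Submission
  imports Defs
begin

text \<open>The argument is by induction on the number of vertices, over vertex sets \<open>W\<close> of the fixed drawing; a vertex
  is on the boundary of \<open>W\<close> if it is in the closure of the outer face of the subdrawing induced by \<open>W\<close>. We may
  assume that \<open>P\<close> consists of two adjacent vertices: an empty or a single precoloured vertex is completed by a
  boundary vertex of colour 2, and (G3) then follows from its version for the larger \<open>P\<close>. Components, cut vertices,
  chords of the outer cycle and certain paths of length two between boundary vertices split the scene into two
  smaller ones whose colourings glue, as does a path of length three that joins two consecutive boundary vertices
  and encloses a vertex; there the inside of the four-cycle is coloured for every prescribed pattern.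

  If none of these separations exists, take the first boundary vertex \<open>d\<close> after \<open>P\<close> that is neither in \<open>Q\<close> nor
  adjacent to a vertex of \<open>P\<close> of colour 1. Delete \<open>d\<close>, put its neighbours into \<open>Q\<close>, colour the rest by induction
  and give \<open>d\<close> colour 1. The new \<open>Q\<close> is independent except when the next boundary vertex is in the same
  position and is followed by a vertex of \<open>Q\<close>; then both vertices are deleted, and at most one of their neighbours
  is left out of \<open>Q\<close>. If there is no such vertex \<open>d\<close>, the outer cycle has length four or five and
  a vertex of \<open>P\<close> of colour 1 is deleted. For the pentagon with both precoloured vertices of colour 1 this leaves a
  scene in which \<open>Q\<close> is not independent, so the induction is carried out for a slightly more general kind of scene.\<close>


section \<open>Arcs in the plane\<close>

text \<open>The bounds 2 and 3 on neighbours of colour 1 serve each other: a vertex that a deletion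
  moves to the boundary has at most two such neighbours, so it can afford a third one, a deleted
  vertex that returns with colour 1, and still meet the bound for inner vertices. (G3) is what makes
  gluing possible: the second side of a separation must not join by colour 2 two vertices of the cut
  that are not joined within the cut, and for cut vertices coloured 2, 1, 2 along a path this is
  provided by (G3) for the middle vertex. Colour 1 needs no such care, since cut vertices of colour
  1 get no neighbour of colour 1 beyond the cut, in most cases by (G2). The deletion steps use of
  the plane only that a boundary vertex stays on the boundary when other vertices are deleted, and
  that deleting a boundary vertex exposes its neighbours. The Jordan curve theorem serves the
  separations: it gives the outer cycle and the behaviour of paths that cut the disc bounded by this
  cycle.\<close>

lemma jordan_two_arcs:
  fixes a b :: complex
  assumes "arc g" "pathstart g = a" "pathfinish g = b"
    and "arc h" "pathstart h = a" "pathfinish h = b"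
    and "path_image g \<inter> path_image h = {a, b}"
  defines "S \<equiv> path_image g \<union> path_image h"
  shows "open (inside S)" "connected (inside S)" "open (outside S)" "connected (outside S)"
    "frontier (inside S) = S" "frontier (outside S) = S" "inside S \<noteq> {}" "compact S"
proof -
  have "a \<noteq> b"
    using assms arc_distinct_ends by blast
  have sp: "simple_path (g +++ reversepath h)"
    by (rule simple_path_join_loop) (use assms in \<open>auto simp: arc_reversepath\<close>)
  have im: "path_image (g +++ reversepath h) = S"
    using assms by (simp add: path_image_join)
  have cl: "pathfinish (g +++ reversepath h) = pathstart (g +++ reversepath h)"
    using assms by simp
  show "open (inside S)" "connected (inside S)" "open (outside S)" "connected (outside S)"
    "frontier (inside S) = S" "frontier (outside S) = S" "inside S \<noteq> {}"
    using Jordan_inside_outside[OF sp cl] unfolding im by auto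
  show "compact S"
    using assms by (simp add: compact_Un compact_arc_image)
qed

lemma connected_inside_or_outside:
  fixes S :: "complex set"
  assumes "closed S" "connected U" "U \<inter> S = {}"
  shows "U \<subseteq> inside S \<or> U \<subseteq> outside S"
proof (rule ccontr)
  assume "\<not> ?thesis"
  then obtain x y where "x \<in> U" "x \<notin> inside S" "y \<in> U" "y \<notin> outside S" by blast
  moreover have "U \<subseteq> inside S \<union> outside S"
    using assms(3) by auto
  ultimately have "inside S \<inter> U \<noteq> {}" "outside S \<inter> U \<noteq> {}" by blast+
  then show False
    using connectedD[OF assms(2) open_inside[OF assms(1)] open_outside[OF assms(1)]] \<open>U \<subseteq> _\<close>
    by auto
qed

lemma connected_subset_outside:
  fixes S :: "complex set"
  assumes "closed S" "connected U" "U \<inter> S = {}" "x \<in> U" "x \<in> outside S"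
  shows "U \<subseteq> outside S"
  using connected_inside_or_outside[OF assms(1-3)] assms(4,5) inside_Int_outside by fastforce

lemma closed_inside_two_arcs:
  fixes a b :: complex
  assumes "arc g" "pathstart g = a" "pathfinish g = b"
    and "arc h" "pathstart h = a" "pathfinish h = b"
    and "path_image g \<inter> path_image h = {a, b}"
  defines "S \<equiv> path_image g \<union> path_image h"
  shows "closure (inside S) = S \<union> inside S" "closure (outside S) = S \<union> outside S"
  using jordan_two_arcs[OF assms(1-7)] unfolding S_def
  by (auto simp: closure_Un_frontier)

lemma split_inside_arcs:
  fixes a b :: complex
  assumes "arc g1" "pathstart g1 = a" "pathfinish g1 = b"
    and "arc g2" "pathstart g2 = a" "pathfinish g2 = b"
    and "arc g" "pathstart g = a" "pathfinish g = b"
    and "path_image g1 \<inter> path_image g2 = {a, b}"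
    and "path_image g1 \<inter> path_image g = {a, b}"
    and "path_image g2 \<inter> path_image g = {a, b}"
    and "path_image g \<inter> inside (path_image g1 \<union> path_image g2) \<noteq> {}"
  shows "inside (path_image g1 \<union> path_image g) \<inter> inside (path_image g2 \<union> path_image g) = {}"
    and "inside (path_image g1 \<union> path_image g) \<union> inside (path_image g2 \<union> path_image g) \<union>
           (path_image g - {a, b}) = inside (path_image g1 \<union> path_image g2)"
proof -
  have "a \<noteq> b"
    using assms arc_distinct_ends by blast
  show "inside (path_image g1 \<union> path_image g) \<inter> inside (path_image g2 \<union> path_image g) = {}"
    "inside (path_image g1 \<union> path_image g) \<union> inside (path_image g2 \<union> path_image g) \<union>
           (path_image g - {a, b}) = inside (path_image g1 \<union> path_image g2)"
    by (rule split_inside_simple_closed_curve[OF arc_imp_simple_path[OF assms(1)] assms(2,3)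
      arc_imp_simple_path[OF assms(4)] assms(5,6) arc_imp_simple_path[OF assms(7)] assms(8,9)
      \<open>a \<noteq> b\<close> assms(10-13)]; assumption)+
qed

text \<open>If each of three arcs lay outside the closed curve formed by the other two, a point inside
  one of these curves and a point far away would be separated by neither of the other two curves;
  by Janiszewski's theorem they would not be separated at all.\<close>
lemma ear_enlarges_closed_inside:
  fixes a b :: complex
  assumes g1: "arc g1" "pathstart g1 = a" "pathfinish g1 = b"
    and g2: "arc g2" "pathstart g2 = a" "pathfinish g2 = b"
    and g: "arc g" "pathstart g = a" "pathfinish g = b"
    and i12: "path_image g1 \<inter> path_image g2 = {a, b}"
    and i1: "path_image g1 \<inter> path_image g = {a, b}"
    and i2: "path_image g2 \<inter> path_image g = {a, b}"
    and out: "path_image g \<inter> outside (path_image g1 \<union> path_image g2) \<noteq> {}"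
  defines "A \<equiv> path_image g1" and "B \<equiv> path_image g2" and "R \<equiv> path_image g"
  shows "A \<union> B \<union> R \<union> inside (A \<union> B) \<subseteq> (A \<union> R) \<union> inside (A \<union> R) \<or>
         A \<union> B \<union> R \<union> inside (A \<union> B) \<subseteq> (B \<union> R) \<union> inside (B \<union> R)"
proof (cases "A \<inter> inside (B \<union> R) \<noteq> {} \<or> B \<inter> inside (A \<union> R) \<noteq> {}")
  case True
  then show ?thesis
  proof
    \<comment> \<open>An arc that enters the curve of the other two splits its inside, and one of
      the two parts is the inside of \<open>A \<union> B\<close>.\<close>
    assume "A \<inter> inside (B \<union> R) \<noteq> {}"
    then have "inside (B \<union> A) \<union> inside (R \<union> A) \<union> (A - {a, b}) = inside (B \<union> R)"
      using split_inside_arcs(2)[OF g2 g g1, folded A_def B_def R_def] i12 i1 i2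
      by (simp add: A_def B_def R_def Int_commute)
    moreover have "a \<in> R" "b \<in> R" using i1 R_def by auto
    ultimately show ?thesis by (auto simp: Un_commute)
  next
    assume "B \<inter> inside (A \<union> R) \<noteq> {}"
    then have "inside (A \<union> B) \<union> inside (R \<union> B) \<union> (B - {a, b}) = inside (A \<union> R)"
      using split_inside_arcs(2)[OF g1 g g2, folded A_def B_def R_def] i12 i1 i2
      by (simp add: A_def B_def R_def Int_commute)
    moreover have "a \<in> R" "b \<in> R" using i1 R_def by auto
    ultimately show ?thesis by (auto simp: Un_commute)
  qed
next
  case False
  have "a \<noteq> b"
    using g1 arc_distinct_ends by blast
  note jAB = jordan_two_arcs[OF g1 g2 i12, folded A_def B_def]
  note jAR = jordan_two_arcs[OF g1 g i1, folded A_def R_def]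
  note jBR = jordan_two_arcs[OF g2 g i2, folded B_def R_def]
  note cAB = closed_inside_two_arcs[OF g1 g2 i12, folded A_def B_def]
  note cAR = closed_inside_two_arcs[OF g1 g i1, folded A_def R_def]
  have clo: "closed (A \<union> B)" "closed (A \<union> R)" "closed (B \<union> R)"
    using jAB(8) jAR(8) jBR(8) compact_imp_closed by auto
  have conn: "connected (R - {a, b})" "connected (B - {a,b})" "B - {a, b} \<noteq> {}" "R - {a,b} \<noteq> {}"
    using connected_simple_path_endless[OF arc_imp_simple_path[OF g(1)]] nonempty_simple_path_endless[OF arc_imp_simple_path[OF g(1)]]
      connected_simple_path_endless[OF arc_imp_simple_path[OF g2(1)]] nonempty_simple_path_endless[OF arc_imp_simple_path[OF g2(1)]]
    unfolding R_def B_def g g2 by simp_all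
  have R_out: "R - {a, b} \<subseteq> outside (A \<union> B)"
  proof -
    obtain z where "z \<in> R" "z \<in> outside (A \<union> B)" using out A_def B_def R_def by auto
    moreover have "(R - {a, b}) \<inter> (A \<union> B) = {}" using i1 i2 A_def B_def R_def by auto
    moreover have "z \<notin> {a, b}" using i12 \<open>z \<in> outside _\<close> outside_no_overlap[of "A \<union> B"] A_def B_def by blast
    ultimately show ?thesis
      using connected_subset_outside[OF clo(1) conn(1)] by blast
  qed
  have B_out: "B - {a, b} \<subseteq> outside (A \<union> R)"
  proof -
    have "(B - {a, b}) \<inter> (A \<union> R) = {}" using i12 i2 A_def B_def R_def by auto
    then show ?thesis
      using connected_inside_or_outside[OF clo(2) conn(2)] False conn(3) by blast
  qed
  have *: "inside (B \<union> R) \<inter> (A \<union> B \<union> R) = {}"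
    using False inside_no_overlap[of "B \<union> R"] by blast
  \<comment> \<open>Otherwise the closure of this region, which contains \<open>R\<close>, would lie
    in the closed disc of \<open>A \<union> B\<close>, against \<open>R_out\<close>.\<close>
  have "inside (B \<union> R) \<subseteq> outside (A \<union> B)"
  proof (rule ccontr)
    assume "\<not> ?thesis"
    then have "inside (B \<union> R) \<subseteq> inside (A \<union> B)"
      using connected_inside_or_outside[OF clo(1) jBR(2)] * by blast
    then have "closure (inside (B \<union> R)) \<subseteq> closure (inside (A \<union> B))" by (rule closure_mono)
    moreover have "R \<subseteq> closure (inside (B \<union> R))" using jBR(5) by (auto simp: closure_Un_frontier)
    ultimately have "R - {a, b} \<subseteq> (A \<union> B) \<union> inside (A \<union> B)" using cAB by blast
    then show False using R_out conn(4) union_with_inside[of "A \<union> B"] by blast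
  qed
  moreover have "inside (B \<union> R) \<subseteq> outside (A \<union> R)"
  proof (rule ccontr)
    assume "\<not> ?thesis"
    then have "inside (B \<union> R) \<subseteq> inside (A \<union> R)"
      using connected_inside_or_outside[OF clo(2) jBR(2)] * by blast
    then have "closure (inside (B \<union> R)) \<subseteq> closure (inside (A \<union> R))" by (rule closure_mono)
    moreover have "B \<subseteq> closure (inside (B \<union> R))" using jBR(5) by (auto simp: closure_Un_frontier)
    ultimately have "B - {a, b} \<subseteq> (A \<union> R) \<union> inside (A \<union> R)" using cAR by blast
    then show False using B_out conn(3) union_with_inside[of "A \<union> R"] by blast
  qed
  moreover obtain p where p: "p \<in> inside (B \<union> R)" using jBR(7) by auto
  have "bounded (A \<union> B \<union> R)" using jAB(8) jBR(8) by (meson bounded_Un compact_imp_bounded)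
  then have "\<not> bounded (outside (A \<union> B \<union> R))" by (rule unbounded_outside)
  then obtain q where q: "q \<in> outside (A \<union> B \<union> R)" by fastforce
  then have "q \<in> outside (A \<union> B)" "q \<in> outside (A \<union> R)" "q \<in> outside (B \<union> R)"
    using outside_mono[of _ "A \<union> B \<union> R"] by blast+
  ultimately have "connected_component (outside (A \<union> B)) p q" "connected_component (outside (A \<union> R)) p q"
    using jAB(4) jAR(4) p by (auto simp: connected_iff_connected_component)
  moreover have "outside (A \<union> B) \<subseteq> - (A \<union> B)" "outside (A \<union> R) \<subseteq> - (A \<union> R)"
    by (auto simp: outside_def)
  ultimately have "connected_component (- (A \<union> B)) p q" "connected_component (- (A \<union> R)) p q"
    using connected_component_of_subset[of "outside (A \<union> B)" p q] connected_component_of_subset[of "outside (A \<union> R)" p q]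
    by simp_all
  \<comment> \<open>Janiszewski's theorem asks for a connected intersection of the two curves; here
    it is the common arc.\<close>
  moreover have "(A \<union> B) \<inter> (A \<union> R) = A"
    using i2 i12 A_def B_def R_def by auto
  then have "connected ((A \<union> B) \<inter> (A \<union> R))" using g1(1) connected_arc_image A_def by auto
  ultimately have "connected_component (- ((A \<union> B) \<union> (A \<union> R))) p q"
    using Janiszewski[OF jAB(8) clo(2)] by blast
  then have "connected_component (- (B \<union> R)) p q"
    by (rule connected_component_of_subset) auto
  then have "p \<in> outside (B \<union> R)"
    using \<open>q \<in> outside (B \<union> R)\<close> outside_same_component connected_component_sym by metis
  then show ?thesis using p inside_Int_outside by blast
qed

section \<open>Plane drawings\<close>

locale plane_drawing =
  fixes V :: "complex set" and E :: "complex set set" and curve :: "complex set \<Rightarrow> real \<Rightarrow> complex"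
  assumes plane: "plane_graph V E curve"
begin

abbreviation PI :: "complex set \<Rightarrow> complex set" where "PI e \<equiv> path_image (curve e)"

abbreviation oe :: "complex set \<Rightarrow> complex set" where "oe e \<equiv> PI e - e"

definition D :: "complex set \<Rightarrow> complex set" where
  "D W = W \<union> (\<Union>e\<in>{e \<in> E. e \<subseteq> W}. PI e)"

abbreviation Out :: "complex set \<Rightarrow> complex set" where "Out W \<equiv> outside (D W)"

text \<open>For \<open>W \<subseteq> V\<close> the closure of the outer face contains the same
  vertices of \<open>W\<close> as its frontier, because no vertex of \<open>W\<close> lies in the
  face itself; unlike the frontier, the closure is monotone in the face.\<close>

definition B :: "complex set \<Rightarrow> complex set" where
  "B W = W \<inter> closure (Out W)"

lemma finite_V: "finite V"
  using plane unfolding plane_graph_def by (elim conjE)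

lemma edgeE:
  assumes "e \<in> E" obtains u v where "u \<in> V" "v \<in> V" "u \<noteq> v" "e = {u, v}"
proof -
  have "\<forall>e\<in>E. \<exists>u v. u \<in> V \<and> v \<in> V \<and> u \<noteq> v \<and> e = {u, v}"
    using plane unfolding plane_graph_def by (elim conjE)
  then show ?thesis using assms that by metis
qed

lemma edge_subset: "e \<in> E \<Longrightarrow> e \<subseteq> V"
  by (erule edgeE) simp

lemma finite_E: "finite E"
  by (rule finite_subset[of E "Pow V"]) (auto simp: finite_V dest: edge_subset)

lemma arc_curve: "arc (curve e)"
  and curve_ends: "{pathstart (curve e), pathfinish (curve e)} = e"
  and PI_Int_V: "PI e \<inter> V = e"
  and PI_Int_PI: "e' \<in> E \<Longrightarrow> e \<noteq> e' \<Longrightarrow> PI e \<inter> PI e' \<subseteq> e \<inter> e'"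
  if "e \<in> E"
proof -
  have "\<forall>e\<in>E. arc (curve e) \<and> {pathstart (curve e), pathfinish (curve e)} = e"
    "\<forall>e\<in>E. PI e \<inter> V = e" "\<forall>e\<in>E. \<forall>e'\<in>E. e \<noteq> e' \<longrightarrow> PI e \<inter> PI e' \<subseteq> e \<inter> e'"
    using conjunct1[OF conjunct2[OF conjunct2[OF plane[unfolded plane_graph_def]]]]
      conjunct2[OF conjunct2[OF conjunct2[OF plane[unfolded plane_graph_def]]]] by simp_all
  then show "arc (curve e)" "{pathstart (curve e), pathfinish (curve e)} = e" "PI e \<inter> V = e"
    "e' \<in> E \<Longrightarrow> e \<noteq> e' \<Longrightarrow> PI e \<inter> PI e' \<subseteq> e \<inter> e'"
    using that by simp_all
qed

lemma adj_sym: "adj E u v \<longleftrightarrow> adj E v u"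
  by (simp add: adj_def insert_commute)

lemma adjD: "adj E u v \<Longrightarrow> u \<in> V" "adj E u v \<Longrightarrow> v \<in> V" "adj E u v \<Longrightarrow> u \<noteq> v"
  unfolding adj_def by (auto elim!: edgeE simp: doubleton_eq_iff)

lemma oriented_curve:
  assumes "adj E u v"
  obtains g where "arc g" "pathstart g = u" "pathfinish g = v" "path_image g = PI {u, v}"
proof -
  have e: "{u, v} \<in> E" using assms adj_def by auto
  consider "pathstart (curve {u,v}) = u" "pathfinish (curve {u,v}) = v"
    | "pathstart (curve {u,v}) = v" "pathfinish (curve {u,v}) = u"
    using curve_ends[OF e] by (auto simp: doubleton_eq_iff)
  then show ?thesis
  proof cases
    case 1
    then show ?thesis by (rule that[OF arc_curve[OF e]]) simp
  next
    case 2
    then show ?thesis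
      using arc_curve[OF e] by (intro that[of "reversepath (curve {u,v})"]) (simp_all add: arc_reversepath)
  qed
qed

lemma oe_props:
  assumes "e \<in> E"
  shows "connected (oe e)" "oe e \<noteq> {}" "closure (oe e) = PI e" "oe e \<inter> V = {}"
    "e' \<in> E \<Longrightarrow> e' \<noteq> e \<Longrightarrow> oe e \<inter> PI e' = {}" "e \<subseteq> PI e" "compact (PI e)"
proof -
  have sp: "simple_path (curve e)" using arc_curve[OF assms] arc_imp_simple_path by auto
  show c: "connected (oe e)" "oe e \<noteq> {}"
    using connected_simple_path_endless[OF sp] nonempty_simple_path_endless[OF sp] curve_ends[OF assms]
    by auto
  show sub: "e \<subseteq> PI e" "oe e \<inter> V = {}" using PI_Int_V[OF assms] by auto
  show "e' \<in> E \<Longrightarrow> e' \<noteq> e \<Longrightarrow> oe e \<inter> PI e' = {}" using PI_Int_PI[OF assms] by blast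
  show comp: "compact (PI e)" using arc_curve[OF assms] compact_arc_image by auto
  have fin: "finite e" using edge_subset[OF assms] finite_V finite_subset by auto
  \<comment> \<open>An end of the arc is a limit point of it, since a connected set with a second
    point is perfect; removing the finite set \<open>e\<close> does not change this.\<close>
  have "PI e \<subseteq> closure (oe e)"
  proof
    fix x assume x: "x \<in> PI e"
    show "x \<in> closure (oe e)"
    proof (cases "x \<in> e")
      case True
      obtain y where "y \<in> oe e" using c by auto
      then have "\<nexists>a. PI e = {a}" using x True by (metis DiffD1 DiffD2 singletonD)
      then have "x islimpt PI e"
        using connected_imp_perfect[OF connected_arc_image[OF arc_curve[OF assms]] x] by auto
      then have "x islimpt (oe e \<union> (PI e \<inter> e))" by (simp add: Un_commute Un_Diff_Int)
      then have "x islimpt oe e" using fin by (simp add: islimpt_Un_finite islimpt_Un islimpt_finite)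
      then show ?thesis by (simp add: closure_def)
    qed (use x closure_subset[of "oe e"] in auto)
  qed
  moreover have "closure (oe e) \<subseteq> PI e"
    using compact_imp_closed[OF comp] by (simp add: closure_minimal)
  ultimately show "closure (oe e) = PI e" by auto
qed

lemma D_mono: "W' \<subseteq> W \<Longrightarrow> D W' \<subseteq> D W"
  unfolding D_def by auto

lemma compact_D: "W \<subseteq> V \<Longrightarrow> compact (D W)"
proof -
  assume "W \<subseteq> V"
  then have "compact W" by (rule finite_imp_compact[OF finite_subset[OF _ finite_V]])
  moreover have "compact (\<Union>e\<in>{e \<in> E. e \<subseteq> W}. PI e)"
    by (rule compact_UN) (simp_all add: finite_E oe_props(7))
  ultimately show ?thesis unfolding D_def by (rule compact_Un)
qed

lemma closed_D: "W \<subseteq> V \<Longrightarrow> closed (D W)"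
  by (rule compact_imp_closed[OF compact_D])

lemma D_Int_V: "W \<subseteq> V \<Longrightarrow> D W \<inter> V = W"
proof -
  assume "W \<subseteq> V"
  then have "D W \<inter> V = W \<union> (\<Union>e\<in>{e \<in> E. e \<subseteq> W}. PI e \<inter> V)"
    unfolding D_def by (simp add: Int_Un_distrib2 Int_absorb2)
  also have "(\<Union>e\<in>{e \<in> E. e \<subseteq> W}. PI e \<inter> V) = (\<Union>e\<in>{e \<in> E. e \<subseteq> W}. e)"
    by (intro SUP_cong refl) (simp add: PI_Int_V)
  finally show ?thesis by (simp add: Un_absorb2 Sup_le_iff)
qed

lemma oe_Int_D:
  assumes "e \<in> E" "W \<subseteq> V" "\<not> e \<subseteq> W"
  shows "oe e \<inter> D W = {}"
proof -
  have "oe e \<inter> PI e' = {}" if "e' \<in> E" "e' \<subseteq> W" for e'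
    using oe_props(5)[OF assms(1) that(1)] that(2) assms(3) by auto
  then show ?thesis
    using oe_props(4)[OF assms(1)] assms(2) unfolding D_def by auto
qed

lemma B_subset: "B W \<subseteq> W"
  unfolding B_def by auto

lemma closure_Out: "W \<subseteq> V \<Longrightarrow> closure (Out W) \<subseteq> D W \<union> Out W"
  by (rule closure_outside_subset[OF closed_D])

text \<open>Deleting vertices shrinks the drawing and enlarges the outer face.\<close>

lemma B_mono: "W' \<subseteq> W \<Longrightarrow> W \<subseteq> V \<Longrightarrow> v \<in> B W \<Longrightarrow> v \<in> W' \<Longrightarrow> v \<in> B W'"
  unfolding B_def using closure_mono[OF outside_mono[OF D_mono[of W' W]]] by auto

text \<open>The deleted vertex is in the closure of the larger outer face; this closure adds to the
  face only points of the remaining drawing, and the vertex is no longer one of them.\<close>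

lemma B_imp_Out: "W' \<subseteq> W \<Longrightarrow> W \<subseteq> V \<Longrightarrow> c \<in> B W \<Longrightarrow> c \<notin> W' \<Longrightarrow> c \<in> Out W'"
proof -
  assume a: "W' \<subseteq> W" "W \<subseteq> V" "c \<in> B W" "c \<notin> W'"
  then have "c \<in> closure (Out W')"
    unfolding B_def using closure_mono[OF outside_mono[OF D_mono[of W' W]]] by auto
  then have "c \<in> D W' \<union> Out W'" using closure_Out[of W'] a by auto
  moreover have "c \<notin> D W'" using D_Int_V[of W'] a B_subset[of W] by auto
  ultimately show ?thesis by auto
qed

text \<open>The half-open edge from \<open>c\<close> towards \<open>x\<close> is connected and
  misses the drawing of \<open>W'\<close>, so it stays in the outer face, and \<open>x\<close> is in
  its closure. This is how a deletion turns neighbours into boundary vertices.\<close>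

lemma expose:
  assumes "W' \<subseteq> V" "c \<in> V" "c \<in> Out W'" "adj E c x"
  shows "x \<notin> W' \<Longrightarrow> x \<in> Out W'" "x \<in> W' \<Longrightarrow> x \<in> B W'"
proof -
  let ?e = "{c, x}"
  have e: "?e \<in> E" using assms adj_def by auto
  have cW: "c \<notin> W'" using assms(3) by (auto simp: D_def outside_def)
  note p = oe_props[OF e]
  have "oe ?e \<subseteq> insert c (oe ?e)" "insert c (oe ?e) \<subseteq> closure (oe ?e)" using p by auto
  then have "connected (insert c (oe ?e))" using connected_intermediate_closure p(1) by blast
  moreover have "insert c (oe ?e) \<inter> D W' = {}"
    using oe_Int_D[OF e assms(1)] D_Int_V[OF assms(1)] cW assms(2) by auto
  ultimately have sub: "insert c (oe ?e) \<subseteq> Out W'"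
    using connected_subset_outside[OF closed_D[OF assms(1)]] assms(3) by blast
  then have "closure (oe ?e) \<subseteq> closure (Out W')" by (intro closure_mono) auto
  then have x: "x \<in> closure (Out W')" using p by auto
  then show "x \<in> W' \<Longrightarrow> x \<in> B W'" unfolding B_def by auto
  assume "x \<notin> W'"
  then have "x \<notin> D W'" using D_Int_V[OF assms(1)] adjD[OF assms(4)] by auto
  then show "x \<in> Out W'" using x closure_Out[OF assms(1)] by auto
qed

text \<open>One set is added at a time: it is disjoint from the union so far, and the empty
  intersection is connected, as Janiszewski's theorem demands.\<close>

lemma connected_compl_finite_Union:
  fixes T :: "'i \<Rightarrow> complex set"
  assumes "finite I" "\<And>i. i \<in> I \<Longrightarrow> compact (T i) \<and> connected (- T i)"
    "\<And>i j. i \<in> I \<Longrightarrow> j \<in> I \<Longrightarrow> i \<noteq> j \<Longrightarrow> T i \<inter> T j = {}"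
  shows "connected (- (\<Union>i\<in>I. T i))"
  using assms
proof (induction I rule: finite_induct)
  case (insert i I)
  have "closed (\<Union>j\<in>I. T j)" using insert by (auto intro: compact_imp_closed)
  moreover have "T i \<inter> (\<Union>j\<in>I. T j) = {}" using insert by fastforce
  ultimately have "connected (- (T i \<union> (\<Union>j\<in>I. T j)))"
    using insert by (intro Janiszewski_connected) auto
  then show ?case by simp
qed (simp add: convex_connected)

text \<open>As \<open>F\<close> avoids the ends of the arc, the parameters at which the curve meets
  \<open>F\<close> have a minimum and a maximum strictly between 0 and 1. The subarc between bounds
  halfway to 0 and to 1 covers them, and an arc does not separate the plane.\<close>

lemma subarc_cover:
  assumes "e \<in> E" "closed F" "F \<inter> e = {}"
  obtains T where "compact T" "connected (- T)" "F \<inter> PI e \<subseteq> T" "T \<subseteq> oe e"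
proof (cases "F \<inter> PI e = {}")
  case True
  then show ?thesis using that[of "{}"] by auto
next
  case False
  let ?g = "curve e"
  have g: "arc ?g" using assms arc_curve by auto
  then have cont: "continuous_on {0..1} ?g" using arc_imp_path path_def by auto
  define K where "K = {0..1} \<inter> ?g -` F"
  have "closed K" unfolding K_def using continuous_closed_preimage[OF cont _ assms(2)] by auto
  moreover have "bounded K" unfolding K_def by (rule bounded_subset[of "{0..1}"]) auto
  ultimately have "compact K" by (simp add: compact_eq_bounded_closed)
  moreover have "K \<noteq> {}" using False unfolding K_def path_image_def by auto
  ultimately obtain m M where m: "m \<in> K" "\<And>t. t \<in> K \<Longrightarrow> m \<le> t" and M: "M \<in> K" "\<And>t. t \<in> K \<Longrightarrow> t \<le> M"
    using compact_attains_inf compact_attains_sup by metis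
  have ends: "?g 0 \<in> e" "?g 1 \<in> e" using curve_ends[OF assms(1)] unfolding pathstart_def pathfinish_def by auto
  have "m \<noteq> 0" "M \<noteq> 1" using m M ends assms(3) unfolding K_def by auto
  moreover have "0 \<le> m" "M \<le> 1" using m M unfolding K_def by auto
  ultimately have mM: "0 < m" "M < 1" "m \<le> M" using m M by auto
  define \<alpha> \<beta> where "\<alpha> = m / 2" and "\<beta> = (M + 1) / 2"
  have ab: "0 < \<alpha>" "\<alpha> < \<beta>" "\<beta> < 1" "\<alpha> < m" "M < \<beta>" using mM unfolding \<alpha>_def \<beta>_def by auto
  have im: "path_image (subpath \<alpha> \<beta> ?g) = ?g ` {\<alpha>..\<beta>}" using ab by (simp add: path_image_subpath)
  have arc: "arc (subpath \<alpha> \<beta> ?g)" using ab by (intro arc_subpath_arc[OF g]) auto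
  show ?thesis
  proof (rule that[of "path_image (subpath \<alpha> \<beta> ?g)"])
    show "compact (path_image (subpath \<alpha> \<beta> ?g))" "connected (- path_image (subpath \<alpha> \<beta> ?g))"
      using arc compact_arc_image connected_arc_complement[OF arc] by auto
    show "F \<inter> PI e \<subseteq> path_image (subpath \<alpha> \<beta> ?g)"
    proof
      fix x assume "x \<in> F \<inter> PI e"
      then obtain t where "t \<in> {0..1}" "x = ?g t" "x \<in> F" unfolding path_image_def by auto
      then have "t \<in> K" unfolding K_def by auto
      then have "t \<in> {\<alpha>..\<beta>}" using m(2) M(2) ab by force
      then show "x \<in> path_image (subpath \<alpha> \<beta> ?g)" using im \<open>x = _\<close> by auto
    qed
    show "path_image (subpath \<alpha> \<beta> ?g) \<subseteq> oe e"
    proof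
      fix x assume "x \<in> path_image (subpath \<alpha> \<beta> ?g)"
      then obtain t where t: "t \<in> {\<alpha>..\<beta>}" "x = ?g t" using im by auto
      then have "t \<in> {0..1}" "t \<noteq> 0" "t \<noteq> 1" using ab by auto
      moreover have "inj_on ?g {0..1}" using g unfolding arc_def by auto
      ultimately have "x \<noteq> ?g 0" "x \<noteq> ?g 1" using t unfolding inj_on_def by force+
      then have "x \<notin> e" using curve_ends[OF assms(1)] unfolding pathstart_def pathfinish_def by auto
      then show "x \<in> oe e" using t \<open>t \<in> {0..1}\<close> unfolding path_image_def by auto
    qed
  qed
qed

text \<open>If the frontier of the outer face avoided all vertices, it would be contained in finitely many
  disjoint arcs, which do not separate the plane.\<close>
lemma B_nonempty:
  assumes "W \<subseteq> V" "W \<noteq> {}"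
  shows "B W \<noteq> {}"
proof
  assume empty: "B W = {}"
  let ?F = "frontier (Out W)" and ?I = "{e \<in> E. e \<subseteq> W}"
  have FD: "?F \<subseteq> D W" by (rule frontier_outside_subset[OF closed_D[OF assms(1)]])
  have FW: "?F \<inter> W = {}" using empty unfolding B_def frontier_def by auto
  have "\<exists>T. compact T \<and> connected (- T) \<and> ?F \<inter> PI e \<subseteq> T \<and> T \<subseteq> oe e" if "e \<in> ?I" for e
  proof -
    have "e \<in> E" "?F \<inter> e = {}" using that FW by auto
    then show ?thesis by (rule subarc_cover[OF _ frontier_closed]) metis
  qed
  then obtain T where T: "\<And>e. e \<in> ?I \<Longrightarrow> compact (T e) \<and> connected (- T e) \<and> ?F \<inter> PI e \<subseteq> T e \<and> T e \<subseteq> oe e"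
    by metis
  let ?X = "- (\<Union>e\<in>?I. T e)"
  have "connected ?X"
  proof (rule connected_compl_finite_Union)
    show "finite ?I" using finite_E by auto
    show "T e \<inter> T e' = {}" if "e \<in> ?I" "e' \<in> ?I" "e \<noteq> e'" for e e'
      proof -
      have "oe e \<inter> PI e' = {}" using oe_props(5)[of e e'] that by simp
      then show ?thesis using T[OF that(1)] T[OF that(2)] by auto
    qed
  qed (use T in simp)
  moreover have "?F \<inter> ?X = {}"
  proof -
    have "x \<in> (\<Union>e\<in>?I. T e)" if "x \<in> ?F" for x
    proof -
      have "x \<in> (\<Union>e\<in>?I. PI e)" using that FD FW unfolding D_def by auto
      then obtain e where "e \<in> ?I" "x \<in> PI e" by auto
      then have "x \<in> T e" using T[OF \<open>e \<in> ?I\<close>] that by auto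
      then show ?thesis using \<open>e \<in> ?I\<close> by auto
    qed
    then show ?thesis by auto
  qed
  moreover have "Out W \<inter> (\<Union>e\<in>?I. T e) = {}"
  proof -
    have "T e \<subseteq> D W" if "e \<in> ?I" for e
      using T[OF that] that unfolding D_def by auto
    then show ?thesis by (auto simp: outside_def)
  qed
  moreover have "Out W \<noteq> {}"
    using unbounded_outside[OF compact_imp_bounded[OF compact_D[OF assms(1)]]] by fastforce
  \<comment> \<open>The connected set \<open>?X\<close> contains the outer face and also the vertex
    \<open>w\<close>, which is not in that face, so it would have to meet the frontier.\<close>
  moreover obtain w where "w \<in> W" using assms by auto
  moreover have "w \<in> ?X" proof -
    have "w \<notin> T e" if "e \<in> ?I" for e
      using T[OF that] oe_props(4)[of e] that \<open>w \<in> W\<close> assms(1) by auto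
    then show ?thesis by auto
  qed
  moreover have "w \<notin> Out W" using \<open>w \<in> W\<close> by (auto simp: D_def outside_def)
  ultimately show False
    using connected_Int_frontier[of ?X "Out W"] by blast
qed

section \<open>Paths as vertex lists, and the arcs and closed curves they form\<close>

fun es :: "complex list \<Rightarrow> complex set set" where
  "es (x # y # zs) = insert {x, y} (es (y # zs))"
| "es _ = {}"

definition pim :: "complex list \<Rightarrow> complex set" where
  "pim xs = set xs \<union> (\<Union>e\<in>es xs. PI e)"

definition pth :: "complex set \<Rightarrow> complex list \<Rightarrow> bool" where
  "pth A xs \<longleftrightarrow> xs \<noteq> [] \<and> distinct xs \<and> set xs \<subseteq> A \<and> successively (adj E) xs"

lemma es_subset: "e \<in> es xs \<Longrightarrow> e \<subseteq> set xs"
  by (induction xs rule: es.induct) auto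

lemma es_edges: "successively (adj E) xs \<Longrightarrow> es xs \<subseteq> E"
  by (induction xs rule: es.induct) (auto simp: adj_def)

lemma es_append: "es (xs @ y # ys) = es (xs @ [y]) \<union> es (y # ys)"
  by (induction xs rule: es.induct) auto

lemma es_rev: "es (rev xs) = es xs"
proof (induction xs rule: es.induct)
  case (1 x y zs)
  then show ?case using es_append[of "rev zs" y "[x]"] by (auto simp: insert_commute)
qed auto

lemma pth_edges: "pth A xs \<Longrightarrow> es xs \<subseteq> E"
  unfolding pth_def using es_edges by auto

lemma pth_mono: "pth A xs \<Longrightarrow> A \<subseteq> A' \<Longrightarrow> pth A' xs"
  unfolding pth_def by auto

lemma pth_rev: "pth A xs \<Longrightarrow> pth A (rev xs)"
  unfolding pth_def using adj_sym by (simp add: successively_rev)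

lemma pim_Int_V: "pth V xs \<Longrightarrow> pim xs \<inter> V = set xs"
  unfolding pim_def using PI_Int_V pth_edges[of V xs] es_subset by (fastforce simp: pth_def)

lemma pim_Int_pim:
  assumes "pth V xs" "pth V ys" "es xs \<inter> es ys = {}"
  shows "pim xs \<inter> pim ys = set xs \<inter> set ys"
proof
  show "pim xs \<inter> pim ys \<subseteq> set xs \<inter> set ys"
  proof
    fix p assume p: "p \<in> pim xs \<inter> pim ys"
    have "p \<in> V"
    proof (rule ccontr)
      assume "p \<notin> V"
      then obtain e e' where e: "e \<in> es xs" "e' \<in> es ys" "p \<in> PI e" "p \<in> PI e'"
        using p assms(1,2) unfolding pim_def pth_def by blast
      then have "e \<in> E" "e' \<in> E" "e \<noteq> e'" using assms pth_edges by blast+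
      then show False using PI_Int_PI[of e e'] e edge_subset \<open>p \<notin> V\<close> by blast
    qed
    then show "p \<in> set xs \<inter> set ys" using p pim_Int_V assms by blast
  qed
qed (auto simp: pim_def)

text \<open>Edge by edge: the arc of the new edge meets the arc of the remaining path only in their
  common vertex, because the new vertex is not on that path.\<close>

lemma arc_of_path:
  "pth V xs \<Longrightarrow> length xs \<ge> 2 \<Longrightarrow>
     \<exists>g. arc g \<and> pathstart g = hd xs \<and> pathfinish g = last xs \<and> path_image g = pim xs"
proof (induction xs rule: es.induct)
  case (1 x y zs)
  have adj: "adj E x y" using 1 unfolding pth_def by auto
  obtain g where g: "arc g" "pathstart g = x" "pathfinish g = y" "path_image g = PI {x, y}"
    using oriented_curve[OF adj] by metis
  have e: "{x, y} \<in> E" using adj adj_def by auto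
  show ?case
  proof (cases zs)
    case Nil
    then show ?thesis using g oe_props(6)[OF e] unfolding pim_def by auto
  next
    case (Cons z zs')
    have p: "pth V (y # zs)" using 1 unfolding pth_def by (auto simp: successively_Cons)
    then obtain h where h: "arc h" "pathstart h = y" "pathfinish h = last (y # zs)" "path_image h = pim (y # zs)"
      using 1 Cons by auto
    have x: "x \<notin> set (y # zs)" using 1 unfolding pth_def by auto
    have "pth V [x, y]" using adj adjD unfolding pth_def by auto
    moreover have "es [x, y] \<inter> es (y # zs) = {}" using es_subset[of "{x, y}" "y # zs"] x by auto
    ultimately have "pim [x, y] \<inter> pim (y # zs) = set [x, y] \<inter> set (y # zs)"
      using pim_Int_pim p by blast
    moreover have "pim [x, y] = PI {x, y}" unfolding pim_def using oe_props(6)[OF e] by auto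
    ultimately have "path_image g \<inter> path_image h \<subseteq> {pathstart h}" using g h x by auto
    then have "arc (g +++ h)" using g h by (intro arc_join) auto
    moreover have "path_image (g +++ h) = pim (x # y # zs)"
      using g h oe_props(6)[OF e] by (auto simp: path_image_join pim_def)
    ultimately show ?thesis using g h by (intro exI[of _ "g +++ h"]) auto
  qed
qed auto

text \<open>A common edge would have both ends among the common vertices, hence be the edge from
  \<open>a\<close> to \<open>b\<close>.\<close>

lemma es_Int_disjoint:
  assumes "set xs \<inter> set ys = {a, b}" "{a, b} \<notin> es xs \<or> {a, b} \<notin> es ys"
    "successively (adj E) xs"
  shows "es xs \<inter> es ys = {}"
proof (rule ccontr)
  assume "es xs \<inter> es ys \<noteq> {}"
  then obtain e where e: "e \<in> es xs" "e \<in> es ys" by auto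
  then have "e \<in> E" using es_edges[OF assms(3)] by auto
  then obtain u v where uv: "u \<noteq> v" "e = {u, v}" by (rule edgeE)
  have "e \<subseteq> {a, b}" using e es_subset assms(1) by blast
  then have "e = {a, b}" using uv by auto
  then show False using e assms(2) by auto
qed

text \<open>Two paths that form a cycle, cut at two of its vertices. The condition on edges excludes
  the degenerate case that both lists are the single edge from \<open>a\<close> to \<open>b\<close>.
  Three paths pairwise in this relation form a theta graph, which is how a cycle with a cut is
  handled.\<close>

definition theta :: "complex list \<Rightarrow> complex list \<Rightarrow> complex \<Rightarrow> complex \<Rightarrow> bool" where
  "theta xs ys a b \<longleftrightarrow> pth V xs \<and> pth V ys \<and> a \<noteq> b \<and> hd xs = a \<and> last xs = b \<and> hd ys = a \<and> last ys = b \<and>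
     set xs \<inter> set ys = {a, b} \<and> es xs \<inter> es ys = {}"

lemma path_length_ge2: "(xs :: complex list) \<noteq> [] \<Longrightarrow> hd xs \<noteq> last xs \<Longrightarrow> length xs \<ge> 2"
  by (cases xs rule: es.cases) auto

lemma theta_lengths: "theta xs ys a b \<Longrightarrow> length xs \<ge> 2 \<and> length ys \<ge> 2"
  unfolding theta_def pth_def by (metis path_length_ge2)

lemma theta_pth: "theta xs ys a b \<Longrightarrow> pth V xs" "theta xs ys a b \<Longrightarrow> pth V ys"
  by (simp_all only: theta_def)

lemma theta_es: "theta xs ys a b \<Longrightarrow> es xs \<inter> es ys = {}"
  by (simp only: theta_def)

lemma theta_sym: "theta xs ys a b \<Longrightarrow> theta ys xs a b"
  unfolding theta_def by (auto simp: Int_commute)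

lemma theta_arcs:
  assumes "theta xs ys a b"
  obtains g h where "arc g" "pathstart g = a" "pathfinish g = b" "path_image g = pim xs"
    "arc h" "pathstart h = a" "pathfinish h = b" "path_image h = pim ys"
    "pim xs \<inter> pim ys = {a, b}"
proof -
  have xs: "pth V xs" "length xs \<ge> 2" "hd xs = a" "last xs = b"
    and ys: "pth V ys" "length ys \<ge> 2" "hd ys = a" "last ys = b"
    using assms theta_lengths[OF assms] unfolding theta_def by auto
  have i: "pim xs \<inter> pim ys = {a, b}"
    using assms pim_Int_pim[of xs ys] unfolding theta_def by auto
  from arc_of_path[OF xs(1,2)] arc_of_path[OF ys(1,2)] xs(3,4) ys(3,4) i that
  show ?thesis by metis
qed

abbreviation loop :: "complex list \<Rightarrow> complex list \<Rightarrow> complex set" where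
  "loop xs ys \<equiv> pim xs \<union> pim ys"

lemma theta_jordan:
  assumes "theta xs ys a b"
  shows "open (inside (loop xs ys))" "connected (inside (loop xs ys))" "open (outside (loop xs ys))"
    "connected (outside (loop xs ys))" "frontier (inside (loop xs ys)) = loop xs ys"
    "frontier (outside (loop xs ys)) = loop xs ys" "inside (loop xs ys) \<noteq> {}" "compact (loop xs ys)"
    "closure (inside (loop xs ys)) = loop xs ys \<union> inside (loop xs ys)"
    "closure (outside (loop xs ys)) = loop xs ys \<union> outside (loop xs ys)"
    "closed (loop xs ys)"
proof -
  obtain g h where gh: "arc g" "pathstart g = a" "pathfinish g = b" "path_image g = pim xs"
    "arc h" "pathstart h = a" "pathfinish h = b" "path_image h = pim ys"
    "pim xs \<inter> pim ys = {a, b}"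
    using theta_arcs[OF assms] by metis
  have i: "path_image g \<inter> path_image h = {a, b}" using gh by simp
  show "open (inside (loop xs ys))" "connected (inside (loop xs ys))" "open (outside (loop xs ys))"
    "connected (outside (loop xs ys))" "frontier (inside (loop xs ys)) = loop xs ys"
    "frontier (outside (loop xs ys)) = loop xs ys" "inside (loop xs ys) \<noteq> {}"
    and c: "compact (loop xs ys)"
    using jordan_two_arcs[OF gh(1-3) gh(5-7) i] unfolding gh by simp_all
  show "closure (inside (loop xs ys)) = loop xs ys \<union> inside (loop xs ys)"
    "closure (outside (loop xs ys)) = loop xs ys \<union> outside (loop xs ys)"
    using closed_inside_two_arcs[OF gh(1-3) gh(5-7) i] unfolding gh by simp_all
  show "closed (loop xs ys)" using c by (rule compact_imp_closed)
qed

lemma theta_split: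
  assumes "theta xs ys a b" "theta xs r a b" "theta ys r a b" "pim r \<inter> inside (loop xs ys) \<noteq> {}"
  shows "inside (loop xs r) \<inter> inside (loop ys r) = {}"
    "inside (loop xs r) \<union> inside (loop ys r) \<union> (pim r - {a, b}) = inside (loop xs ys)"
proof -
  obtain g h where gh: "arc g" "pathstart g = a" "pathfinish g = b" "path_image g = pim xs"
    "arc h" "pathstart h = a" "pathfinish h = b" "path_image h = pim ys"
    "pim xs \<inter> pim ys = {a, b}"
    using theta_arcs[OF assms(1)] by metis
  obtain g' k where k: "arc k" "pathstart k = a" "pathfinish k = b" "path_image k = pim r" "pim xs \<inter> pim r = {a, b}"
    using theta_arcs[OF assms(2)] by metis
  have "pim ys \<inter> pim r = {a, b}"
    using theta_arcs[OF assms(3)] by metis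
  then have i: "path_image g \<inter> path_image h = {a, b}" "path_image g \<inter> path_image k = {a, b}"
    "path_image h \<inter> path_image k = {a, b}" "path_image k \<inter> inside (path_image g \<union> path_image h) \<noteq> {}"
    using gh k assms(4) by simp_all
  show "inside (loop xs r) \<inter> inside (loop ys r) = {}"
    "inside (loop xs r) \<union> inside (loop ys r) \<union> (pim r - {a, b}) = inside (loop xs ys)"
    using split_inside_arcs[OF gh(1-3) gh(5-7) k(1-3) i] unfolding gh k by simp_all
qed

lemma oe_pim_disjoint: "e \<in> E \<Longrightarrow> pth V xs \<Longrightarrow> e \<notin> es xs \<Longrightarrow> oe e \<inter> pim xs = {}"
proof -
  assume a: "e \<in> E" "pth V xs" "e \<notin> es xs"
  have "oe e \<inter> PI e' = {}" if "e' \<in> es xs" for e'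
    using oe_props(5)[OF a(1), of e'] that a pth_edges[OF a(2)] by auto
  moreover have "oe e \<inter> set xs = {}"
    using oe_props(4)[OF a(1)] a(2) unfolding pth_def by auto
  ultimately show ?thesis unfolding pim_def by auto
qed

lemma oe_inside_ends:
  assumes "theta xs ys a b" "e \<in> E" "oe e \<subseteq> inside (loop xs ys)"
  shows "e \<subseteq> loop xs ys \<union> inside (loop xs ys)"
proof -
  have "PI e \<subseteq> closure (inside (loop xs ys))"
    using closure_mono[OF assms(3)] oe_props(3)[OF assms(2)] by auto
  then show ?thesis using theta_jordan(9)[OF assms(1)] oe_props(6)[OF assms(2)] by auto
qed

section \<open>Discs bounded by cycles, and their cuts along a path\<close>

definition disc :: "complex set \<Rightarrow> complex list \<Rightarrow> complex list \<Rightarrow> complex \<Rightarrow> complex \<Rightarrow> bool" where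
  "disc W xs ys a b \<longleftrightarrow> W \<subseteq> V \<and> theta xs ys a b \<and> set xs \<union> set ys \<subseteq> W \<and> D W \<subseteq> loop xs ys \<union> inside (loop xs ys)"

lemma pim_subset_D: "pth V xs \<Longrightarrow> set xs \<subseteq> W \<Longrightarrow> pim xs \<subseteq> D W"
proof -
  assume a: "pth V xs" "set xs \<subseteq> W"
  have "e \<in> E \<and> e \<subseteq> W" if "e \<in> es xs" for e
    using that pth_edges[OF a(1)] es_subset[OF that] a(2) by auto
  then show ?thesis unfolding pim_def D_def using a(2) by auto
qed

text \<open>Nothing is drawn outside the cycle, and this outside is connected and unbounded, so it
  is the whole outer face; its frontier is the cycle.\<close>

lemma B_disc:
  assumes "theta xs ys a b" "W \<subseteq> V" "set xs \<union> set ys \<subseteq> W" "D W \<subseteq> loop xs ys \<union> inside (loop xs ys)"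
  shows "B W = set xs \<union> set ys"
proof -
  note j = theta_jordan[OF assms(1)]
  have pth: "pth V xs" "pth V ys" using assms(1) unfolding theta_def by auto
  have sub: "loop xs ys \<subseteq> D W" using pim_subset_D pth assms(3) by auto
  have "outside (loop xs ys) \<subseteq> Out W"
  proof
    fix p assume p: "p \<in> outside (loop xs ys)"
    have "outside (loop xs ys) \<subseteq> - D W" using assms(4) by (auto simp: outside_inside)
    then have "connected_component_set (- D W) p \<supseteq> outside (loop xs ys)"
      using connected_component_maximal[OF p j(4)] by auto
    moreover have "\<not> bounded (outside (loop xs ys))"
      using unbounded_outside[OF compact_imp_bounded[OF j(8)]] .
    ultimately have "\<not> bounded (connected_component_set (- D W) p)" using bounded_subset by blast
    then show "p \<in> Out W" by (simp add: outside)
  qed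
  moreover have "Out W \<subseteq> outside (loop xs ys)" by (rule outside_mono[OF sub])
  ultimately have "Out W = outside (loop xs ys)" by auto
  then have "B W = W \<inter> (loop xs ys \<union> outside (loop xs ys))"
    unfolding B_def using j(10) by simp
  also have "\<dots> = W \<inter> loop xs ys"
    using assms(4) by (auto simp: D_def outside_inside)
  also have "\<dots> = set xs \<union> set ys"
    using pim_Int_V[OF pth(1)] pim_Int_V[OF pth(2)] assms(2,3) by auto
  finally show ?thesis .
qed

text \<open>The part of \<open>W\<close> strictly on one side of the cut: the vertices of
  \<open>r\<close>, including \<open>a\<close> and \<open>b\<close>, belong to neither side.\<close>

definition side :: "complex set \<Rightarrow> complex list \<Rightarrow> complex list \<Rightarrow> complex \<Rightarrow> complex \<Rightarrow> complex set" where
  "side W xs r a b = (W \<inter> inside (loop xs r)) \<union> (set xs - {a, b})"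

context
  fixes W xs ys r a b
  assumes disc: "disc W xs ys a b"
    and xr: "theta xs r a b" and yr: "theta ys r a b" and rW: "set r \<subseteq> W"
begin

lemma cut_basic:
  shows "W \<subseteq> V" "pth V xs" "pth V ys" "pth V r" "theta xs ys a b" "a \<noteq> b"
    "set xs \<inter> set ys = {a, b}" "set xs \<inter> set r = {a, b}" "set ys \<inter> set r = {a, b}"
    "set xs \<subseteq> W" "set ys \<subseteq> W" "D W \<subseteq> loop xs ys \<union> inside (loop xs ys)"
    "pim xs \<inter> pim r = {a, b}" "pim ys \<inter> pim r = {a, b}" "pim xs \<inter> pim ys = {a, b}"
  using disc xr yr pim_Int_pim unfolding disc_def theta_def by auto

text \<open>An edge of \<open>r\<close> belongs to neither path of the cycle and yet lies in the
  closed disc, so it runs inside the cycle; therefore \<open>r\<close> really splits the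
  inside.\<close>

lemma cut_inside:
  shows "inside (loop xs r) \<inter> inside (loop ys r) = {}"
    "inside (loop xs r) \<union> inside (loop ys r) \<union> (pim r - {a, b}) = inside (loop xs ys)"
proof -
  have r2: "length r \<ge> 2" using theta_lengths[OF xr] by auto
  then obtain e where e: "e \<in> es r" by (cases r rule: es.cases) auto
  then have eE: "e \<in> E" using pth_edges cut_basic(4) by auto
  have "e \<notin> es xs" "e \<notin> es ys" using e xr yr unfolding theta_def by auto
  then have "oe e \<inter> loop xs ys = {}" using oe_pim_disjoint eE cut_basic(2,3) by auto
  moreover have "oe e \<subseteq> pim r" using e unfolding pim_def by auto
  moreover have "pim r \<subseteq> D W" using pim_subset_D[OF cut_basic(4) rW] .
  ultimately have "oe e \<subseteq> inside (loop xs ys)" using cut_basic(12) by blast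
  then have ne: "pim r \<inter> inside (loop xs ys) \<noteq> {}" using \<open>oe e \<subseteq> pim r\<close> oe_props(2)[OF eE] by auto
  show "inside (loop xs r) \<inter> inside (loop ys r) = {}"
    "inside (loop xs r) \<union> inside (loop ys r) \<union> (pim r - {a, b}) = inside (loop xs ys)"
    by (rule theta_split[OF cut_basic(5) xr yr ne])+
qed

lemma cut_inside_iff:
  "p \<in> inside (loop xs ys) \<longleftrightarrow>
     p \<in> inside (loop xs r) \<or> p \<in> inside (loop ys r) \<or> p \<in> pim r \<and> p \<noteq> a \<and> p \<noteq> b"
  unfolding cut_inside(2)[symmetric] by auto

lemma cut_avoid:
  shows "inside (loop xs r) \<inter> loop xs ys = {}" "inside (loop ys r) \<inter> loop xs ys = {}"
    "inside (loop xs r) \<inter> pim r = {}" "inside (loop ys r) \<inter> pim r = {}"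
proof -
  have "inside (loop xs ys) \<inter> loop xs ys = {}" by simp
  then show "inside (loop xs r) \<inter> loop xs ys = {}" "inside (loop ys r) \<inter> loop xs ys = {}"
    using cut_inside(2) by blast+
  have "inside (loop xs r) \<inter> loop xs r = {}" "inside (loop ys r) \<inter> loop ys r = {}" by simp_all
  then show "inside (loop xs r) \<inter> pim r = {}" "inside (loop ys r) \<inter> pim r = {}"
    by (simp_all add: Int_Un_distrib)
qed

lemma cut_partition:
  "W = set r \<union> side W xs r a b \<union> side W ys r a b"
  "side W xs r a b \<inter> side W ys r a b = {}"
  "side W xs r a b \<inter> set r = {}" "side W ys r a b \<inter> set r = {}"
proof -
  have V: "pim xs \<inter> V = set xs" "pim ys \<inter> V = set ys" "pim r \<inter> V = set r"
    using pim_Int_V cut_basic by auto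
  have sub: "set xs \<subseteq> pim xs" "set ys \<subseteq> pim ys" "set r \<subseteq> pim r" unfolding pim_def by auto
  have ab: "a \<in> set r" "b \<in> set r" using cut_basic(8) by auto
  have "W \<subseteq> loop xs ys \<union> inside (loop xs ys)" using cut_basic(12) unfolding D_def by auto
  have "W \<subseteq> set r \<union> side W xs r a b \<union> side W ys r a b"
  proof
    fix x assume x: "x \<in> W"
    then have "x \<in> V" using cut_basic(1) by auto
    from x \<open>W \<subseteq> loop xs ys \<union> _\<close> have "x \<in> pim xs \<or> x \<in> pim ys \<or> x \<in> inside (loop xs ys)" by auto
    then have "x \<in> set xs \<or> x \<in> set ys \<or> x \<in> inside (loop xs r) \<or> x \<in> inside (loop ys r) \<or> x \<in> set r"
      using V \<open>x \<in> V\<close> cut_inside_iff[of x] by auto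
    then show "x \<in> set r \<union> side W xs r a b \<union> side W ys r a b"
      using x ab unfolding side_def by auto
  qed
  then show "W = set r \<union> side W xs r a b \<union> side W ys r a b"
    using rW cut_basic(10,11) unfolding side_def by auto
  show "side W xs r a b \<inter> side W ys r a b = {}"
    using cut_inside(1) cut_avoid sub cut_basic(7) unfolding side_def by auto
  show "side W xs r a b \<inter> set r = {}" "side W ys r a b \<inter> set r = {}"
    using cut_avoid sub cut_basic(8,9) unfolding side_def by auto
qed

text \<open>The open edge misses all three paths, so it lies in the union of the two open disjoint
  regions; being connected, it lies in one of them.\<close>

lemma cut_oe:
  assumes "e \<in> E" "e \<subseteq> W" "e \<notin> es xs" "e \<notin> es ys" "e \<notin> es r"
  shows "oe e \<subseteq> inside (loop xs r) \<or> oe e \<subseteq> inside (loop ys r)"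
proof -
  have d: "oe e \<inter> pim xs = {}" "oe e \<inter> pim ys = {}" "oe e \<inter> pim r = {}"
    using oe_pim_disjoint assms cut_basic by auto
  moreover have "oe e \<subseteq> D W" using assms unfolding D_def by auto
  ultimately have "oe e \<subseteq> inside (loop xs ys)"
    using cut_basic(12) by auto
  with d(3) have sub: "oe e \<subseteq> inside (loop xs r) \<union> inside (loop ys r)"
    unfolding cut_inside(2)[symmetric] by auto
  show ?thesis
    using connectedD[OF oe_props(1)[OF assms(1)] theta_jordan(1)[OF xr] theta_jordan(1)[OF yr]]
      sub cut_inside(1) by auto
qed

text \<open>Such an edge would run inside one of the two regions, and its end on the other side
  would not be in the closure of that region.\<close>

lemma cut_edge:
  assumes "x \<in> side W xs r a b" "y \<in> side W ys r a b"
  shows "\<not> adj E x y"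
proof
  assume adj: "adj E x y"
  let ?e = "{x, y}"
  have e: "?e \<in> E" using adj adj_def by auto
  have W: "x \<in> W" "y \<in> W" "x \<notin> set r" "y \<notin> set r" "x \<notin> side W ys r a b" "y \<notin> side W xs r a b"
    using assms cut_partition by auto
  have ab: "a \<in> set r" "b \<in> set r" using cut_basic(8) by auto
  have "x \<notin> set ys" using W ab unfolding side_def by auto
  have "y \<notin> set xs" using W ab unfolding side_def by auto
  have n: "?e \<notin> es xs" "?e \<notin> es ys" "?e \<notin> es r"
    using es_subset[of ?e] W \<open>x \<notin> set ys\<close> \<open>y \<notin> set xs\<close> by auto
  have xV: "x \<notin> pim ys" "x \<notin> pim r" "y \<notin> pim xs" "y \<notin> pim r"
    using pim_Int_V cut_basic(1-4) W \<open>x \<notin> set ys\<close> \<open>y \<notin> set xs\<close> by blast+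
  have "?e \<subseteq> W" using W by auto
  then have "oe ?e \<subseteq> inside (loop xs r) \<or> oe ?e \<subseteq> inside (loop ys r)"
    using cut_oe e n by auto
  then show False
  proof
    assume "oe ?e \<subseteq> inside (loop xs r)"
    then have "y \<in> inside (loop xs r)"
      using oe_inside_ends[OF xr e] xV by auto
    then show False using W unfolding side_def by auto
  next
    assume "oe ?e \<subseteq> inside (loop ys r)"
    then have "x \<in> inside (loop ys r)"
      using oe_inside_ends[OF yr e] xV by auto
    then show False using W unfolding side_def by auto
  qed
qed

text \<open>The part of the drawing induced by \<open>r\<close> and the \<open>ys\<close> side lies
  in the disc bounded by \<open>ys\<close> and \<open>r\<close>, so \<open>r\<close> is on its
  boundary. The two hypotheses keep every edge with both ends on \<open>r\<close> from running on
  the \<open>xs\<close> side, where it could cover \<open>r\<close>.\<close>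

lemma cut_boundary:
  assumes ind: "\<And>e. e \<in> E \<Longrightarrow> e \<subseteq> set r \<Longrightarrow> e \<in> es r \<union> es ys" and ab: "{a, b} \<notin> es xs"
  shows "set r \<subseteq> B (set r \<union> side W ys r a b)"
proof -
  let ?W = "set r \<union> side W ys r a b"
  have abr: "a \<in> set r" "b \<in> set r" using cut_basic(8) by auto
  have sub: "set xs \<subseteq> pim xs" "set ys \<subseteq> pim ys" "set r \<subseteq> pim r" unfolding pim_def by auto
  have WW: "?W \<subseteq> W" using cut_partition(1) by auto
  have ysW: "set ys \<union> set r \<subseteq> ?W" using abr cut_basic(11) unfolding side_def by auto
  have vert: "?W \<subseteq> loop ys r \<union> inside (loop ys r)" using sub unfolding side_def by auto
  have "PI e \<subseteq> loop ys r \<union> inside (loop ys r)" if e: "e \<in> E" "e \<subseteq> ?W" for e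
  proof (cases "e \<in> es ys \<or> e \<in> es r")
    case True
    then show ?thesis unfolding pim_def by auto
  next
    case False
    have "e \<notin> es xs"
    proof
      assume "e \<in> es xs"
      then have "e \<subseteq> set xs" using es_subset by auto
      moreover have "set xs \<inter> ?W \<subseteq> {a, b}"
        using cut_basic(7,8) cut_avoid(2) sub unfolding side_def by blast
      ultimately have "e \<subseteq> {a, b}" using e by blast
      moreover obtain u v where "u \<noteq> v" "e = {u, v}" using e edgeE by metis
      ultimately have "e = {a, b}" by auto
      then show False using ab \<open>e \<in> es xs\<close> by auto
    qed
    then have "oe e \<subseteq> inside (loop xs r) \<or> oe e \<subseteq> inside (loop ys r)"
      using cut_oe e False WW by auto
    then show ?thesis
    proof
      assume "oe e \<subseteq> inside (loop xs r)"
      then have "e \<subseteq> loop xs r \<union> inside (loop xs r)" using oe_inside_ends[OF xr] e by auto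
      then have "e \<subseteq> W \<inter> (loop xs r \<union> inside (loop xs r))" using e WW by auto
      moreover have "?W \<inter> (pim xs \<union> inside (loop xs r)) \<subseteq> set r"
      proof -
        have "?W \<inter> pim xs \<subseteq> set r"
          using pim_Int_V[OF cut_basic(2)] WW cut_basic(1,7) cut_avoid(2) sub abr unfolding side_def by blast
        moreover have "?W \<inter> inside (loop xs r) \<subseteq> set r"
          using cut_inside(1) cut_avoid(1) sub unfolding side_def by blast
        ultimately show ?thesis by auto
      qed
      moreover have "?W \<inter> pim r \<subseteq> set r"
        using pim_Int_V[OF cut_basic(4)] WW cut_basic(1) by auto
      ultimately have "e \<subseteq> set r" using e by blast
      then show ?thesis using ind e False by auto
    next
      assume "oe e \<subseteq> inside (loop ys r)"
      then show ?thesis using vert e by blast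
    qed
  qed
  then have "D ?W \<subseteq> loop ys r \<union> inside (loop ys r)" unfolding D_def using vert by auto
  then have "B ?W = set ys \<union> set r"
    using B_disc[OF yr _ ysW] subset_trans[OF WW cut_basic(1)] by simp
  then show ?thesis by auto
qed

end

text \<open>Both regions bounded by the two cycles through the outer edge \<open>ab\<close> contain the points near that edge;
  as neither contains a vertex, the regions coincide.\<close>
lemma four_cycle_unique:
  assumes disc: "disc W xs [a, b] a b"
    and r: "theta xs [a, s, t, b] a b" "theta [a, b] [a, s, t, b] a b" "{s, t} \<subseteq> W"
    and r': "theta xs [a, s', t', b] a b" "theta [a, b] [a, s', t', b] a b" "{s', t'} \<subseteq> W"
    and e1: "W \<inter> inside (loop [a, b] [a, s, t, b]) = {}"
    and e2: "W \<inter> inside (loop [a, b] [a, s', t', b]) = {}"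
    and n: "\<not> adj E a t" "\<not> adj E s b" "\<not> adj E a t'" "\<not> adj E s' b"
  shows "s = s' \<and> t = t'"
proof -
  have abW: "a \<in> W" "b \<in> W" "W \<subseteq> V" using disc unfolding disc_def by auto
  have adjab: "adj E a b" using r(2) unfolding theta_def pth_def by auto
  then have abE: "{a, b} \<in> E" unfolding adj_def .
  have key: "inside (loop [a, b] [a, s, t, b]) \<subseteq> inside (loop [a, b] [a, s', t', b])"
    if r: "theta xs [a, s, t, b] a b" "theta [a, b] [a, s, t, b] a b" "{s, t} \<subseteq> W"
      and r': "theta xs [a, s', t', b] a b" "theta [a, b] [a, s', t', b] a b" "{s', t'} \<subseteq> W"
      and e1: "W \<inter> inside (loop [a, b] [a, s, t, b]) = {}"
      and n: "\<not> adj E a t" "\<not> adj E s b" for s t s' t'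
  proof -
    let ?r = "[a, s, t, b]" and ?r' = "[a, s', t', b]"
    have rW: "set ?r \<subseteq> W" "set ?r' \<subseteq> W" using r r' abW by auto
    note c = cut_basic[OF disc r(1,2) rW(1)] and c' = cut_basic[OF disc r'(1,2) rW(2)]
    note i = cut_inside[OF disc r(1,2) rW(1)] and i' = cut_inside[OF disc r'(1,2) rW(2)]
    note v = cut_avoid[OF disc r(1,2) rW(1)] and v' = cut_avoid[OF disc r'(1,2) rW(2)]
    let ?I = "inside (loop [a, b] ?r)" and ?I' = "inside (loop [a, b] ?r')"
    have oe: "oe {a, b} \<noteq> {}" "oe {a, b} \<subseteq> pim [a, b]" using oe_props(2)[OF abE] unfolding pim_def by auto
    obtain m where m: "m \<in> oe {a, b}" using oe by auto
    have nb: "{a, b} \<notin> es xs" "{a, b} \<notin> es ?r" "{a, b} \<notin> es ?r'"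
    proof -
      have "{a, b} \<in> es [a, b]" by simp
      moreover have "es xs \<inter> es [a, b] = {}" using theta_es disc unfolding disc_def by metis
      ultimately show "{a, b} \<notin> es xs" "{a, b} \<notin> es ?r" "{a, b} \<notin> es ?r'"
        using theta_es[OF r(2)] theta_es[OF r'(2)] by blast+
    qed
    have md: "m \<notin> pim xs" "m \<notin> pim ?r" "m \<notin> pim ?r'"
      using m oe_pim_disjoint[OF abE c(2) nb(1)] oe_pim_disjoint[OF abE c(4) nb(2)]
        oe_pim_disjoint[OF abE c'(4) nb(3)] by blast+
    have "m \<notin> closure (inside (loop xs ?r))"
      unfolding theta_jordan(9)[OF r(1)] using md(1,2) v(1) m oe(2) by blast
    moreover have "m \<notin> closure (inside (loop xs ?r'))"
      unfolding theta_jordan(9)[OF r'(1)] using md(1,3) v'(1) m oe(2) by blast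
    moreover have clo: "closed (pim ?r)" "closed (pim ?r')"
    proof -
      have "length ?r \<ge> 2" "length ?r' \<ge> 2" by auto
      then show "closed (pim ?r)" "closed (pim ?r')"
        using arc_of_path[OF c(4)] arc_of_path[OF c'(4)] closed_arc_image by metis+
    qed
    \<comment> \<open>\<open>U\<close> is a neighbourhood of the point \<open>m\<close> of the edge
      \<open>ab\<close> that avoids both paths and everything beyond them. A point of
      \<open>U\<close> inside the outer cycle therefore lies in both four-cycle regions.\<close>
    moreover define U where "U = - (closure (inside (loop xs ?r)) \<union> closure (inside (loop xs ?r')) \<union> pim ?r \<union> pim ?r')"
    ultimately have "m \<in> U" "open U"
      using md(2,3) clo unfolding U_def by (simp_all add: open_Compl closed_Un open_Int)
    moreover have "m \<in> closure (inside (loop xs [a, b]))"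
      using theta_jordan(9)[OF c(5)] m oe by blast
    ultimately have "U \<inter> inside (loop xs [a, b]) \<noteq> {}"
      using open_Int_closure_eq_empty[of U "inside (loop xs [a, b])"] by blast
    then obtain w where w: "w \<in> inside (loop xs [a, b])" "w \<in> U" by blast
    have w': "w \<notin> inside (loop xs ?r)" "w \<notin> inside (loop xs ?r')" "w \<notin> pim ?r" "w \<notin> pim ?r'"
      using w(2) closure_subset[of "inside (loop xs ?r)"] closure_subset[of "inside (loop xs ?r')"]
      unfolding U_def by blast+
    have "w \<in> ?I" using w(1) w'(1,3) cut_inside_iff[OF disc r(1,2) rW(1), of w] by simp
    have "w \<in> ?I'" using w(1) w'(2,4) cut_inside_iff[OF disc r'(1,2) rW(2), of w] by simp
    have "?I \<inter> pim ?r' = {}"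
    proof -
      have V: "?I \<inter> set ?r' = {}" using e1 rW by auto
      have "PI e \<inter> ?I = {}" if e: "e \<in> es ?r'" for e
      proof (cases "e \<in> es ?r")
        case True
        then have "PI e \<subseteq> pim ?r" unfolding pim_def by auto
        then show ?thesis using v(4) by auto
      next
        case False
        have eE: "e \<in> E" using e pth_edges[OF c'(4)] by auto
        have "e \<subseteq> set ?r'" using es_subset[OF e] .
        then have eW: "e \<subseteq> W" using rW by auto
        have en: "e \<notin> es xs" "e \<notin> es [a, b]" using e theta_es[OF r'(1)] theta_es[OF r'(2)] by blast+
        \<comment> \<open>As \<open>?I\<close> contains no vertex, an edge of the second path drawn
          in it would join two vertices of the first four-cycle, which has no chord.\<close>
        have "\<not> oe e \<subseteq> ?I"
        proof
          assume "oe e \<subseteq> ?I"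
          then have "e \<subseteq> loop [a, b] ?r \<union> ?I" by (rule oe_inside_ends[OF r(2) eE])
          then have "e \<subseteq> W \<inter> loop [a, b] ?r" using e1 eW by auto
          then have "e \<subseteq> (pim [a, b] \<inter> V) \<union> (pim ?r \<inter> V)" using abW(3) by blast
          then have sub: "e \<subseteq> {a, s, t, b}"
            unfolding pim_Int_V[OF c(3)] pim_Int_V[OF c(4)] by auto
          obtain p q where pq: "p \<noteq> q" "e = {p, q}" using eE edgeE by metis
          then have "adj E p q" using eE adj_def by auto
          then have "e = {a, b} \<or> e = {a, s} \<or> e = {s, t} \<or> e = {t, b}"
            using sub pq n adj_sym by auto
          then show False using False en by auto
        qed
        then have "oe e \<subseteq> inside (loop xs ?r)"
          using cut_oe[OF disc r(1,2) rW(1) eE eW en False] by auto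
        then have "oe e \<inter> ?I = {}" using i(1) by auto
        moreover have "e \<inter> ?I = {}" using eW e1 by auto
        ultimately show ?thesis by auto
      qed
      then show ?thesis using V unfolding pim_def by auto
    qed
    then have "?I \<inter> loop [a, b] ?r' = {}" using v(2) by auto
    then show "?I \<subseteq> ?I'"
      using connected_inside_or_outside[OF theta_jordan(11)[OF r'(2)] theta_jordan(2)[OF r(2)]]
        \<open>w \<in> ?I\<close> \<open>w \<in> ?I'\<close> inside_Int_outside[of "loop [a, b] ?r'"] by blast
  qed
  have "inside (loop [a, b] [a, s, t, b]) = inside (loop [a, b] [a, s', t', b])"
    using key[OF r r' e1 n(1,2)] key[OF r' r e2 n(3,4)] by auto
  \<comment> \<open>Equal regions have equal frontiers, hence the same vertices; the absence of
    chords then fixes their order.\<close>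
  then have "loop [a, b] [a, s, t, b] = loop [a, b] [a, s', t', b]"
    using theta_jordan(5)[OF r(2)] theta_jordan(5)[OF r'(2)] by metis
  moreover note p = theta_pth(2)[OF r(2)] theta_pth(2)[OF r'(2)] theta_pth(1)[OF r(2)]
  ultimately have "(pim [a, b] \<inter> V) \<union> (pim [a, s, t, b] \<inter> V) = (pim [a, b] \<inter> V) \<union> (pim [a, s', t', b] \<inter> V)"
    by blast
  then have eq: "{a, b, s, t} = {a, b, s', t'}"
    unfolding p[THEN pim_Int_V] by auto
  have "distinct [a, s, t, b]" "distinct [a, s', t', b]" "adj E a s'" "adj E t' b"
    using p unfolding pth_def by auto
  moreover have "s' \<noteq> t" "t' \<noteq> s" using calculation n by auto
  moreover have "s' \<in> {a, b, s, t}" "t' \<in> {a, b, s, t}" unfolding eq by auto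
  ultimately show ?thesis by auto
qed

section \<open>Outer cycles\<close>

text \<open>As a reflexive closure this holds for equal arguments even outside \<open>A\<close>,
  which is why membership or distinctness is sometimes required separately.\<close>

definition conn :: "complex set \<Rightarrow> complex \<Rightarrow> complex \<Rightarrow> bool" where
  "conn A = (\<lambda>x y. x \<in> A \<and> y \<in> A \<and> adj E x y)\<^sup>*\<^sup>*"

lemma conn_refl: "conn A u u"
  unfolding conn_def by simp

lemma conn_step: "x \<in> A \<Longrightarrow> y \<in> A \<Longrightarrow> adj E x y \<Longrightarrow> conn A x y"
  unfolding conn_def by (rule r_into_rtranclp) simp

lemma conn_trans: "conn A x y \<Longrightarrow> conn A y z \<Longrightarrow> conn A x z"
  unfolding conn_def by (rule rtranclp_trans)

lemma conn_sym: "conn A x y \<Longrightarrow> conn A y x"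
  unfolding conn_def
proof (induction rule: rtranclp_induct)
  case (step y z)
  then have "z \<in> A \<and> y \<in> A \<and> adj E z y" using adj_sym by auto
  then show ?case using step.IH by (rule converse_rtranclp_into_rtranclp)
qed simp

lemma conn_mono: "conn A x y \<Longrightarrow> A \<subseteq> A' \<Longrightarrow> conn A' x y"
  unfolding conn_def by (erule rtranclp_mono[THEN predicate2D, rotated]) auto

lemma conn_induct [consumes 1, case_names refl step]:
  assumes "conn A x y" "P x"
    "\<And>y z. conn A x y \<Longrightarrow> y \<in> A \<Longrightarrow> z \<in> A \<Longrightarrow> adj E y z \<Longrightarrow> P y \<Longrightarrow> P z"
  shows "P y"
  using assms(1) unfolding conn_def
proof (induction rule: rtranclp_induct)
  case (step y z)
  then show ?case using assms(3)[of y z] unfolding conn_def by simp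
qed (rule assms(2))

lemma conn_in: "conn A x y \<Longrightarrow> x \<noteq> y \<Longrightarrow> y \<in> A"
  unfolding conn_def by (erule rtranclp.cases) auto

lemma conn_nbr: "conn A x y \<Longrightarrow> x \<noteq> y \<Longrightarrow> \<exists>z\<in>A. adj E x z"
  unfolding conn_def by (erule converse_rtranclpE) auto

text \<open>The path is built backwards from \<open>y\<close>. If the next vertex is already on it,
  the part of the path before that vertex is dropped, which keeps the path simple.\<close>

lemma conn_path:
  assumes "conn A x y" "x \<in> A"
  obtains xs where "pth A xs" "hd xs = x" "last xs = y"
proof -
  have "conn A y x" using assms conn_sym by auto
  then have "\<exists>xs. pth A xs \<and> hd xs = x \<and> last xs = y" if "y \<in> A"
    using that
  proof (induction rule: conn_induct)
    case refl
    then show ?case by (intro exI[of _ "[y]"]) (auto simp: pth_def)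
  next
    case (step u v)
    then obtain xs where xs: "pth A xs" "hd xs = u" "last xs = y" by auto
    show ?case
    proof (cases "v \<in> set xs")
      case True
      then obtain ps qs where "xs = ps @ v # qs" by (meson split_list)
      then have "pth A (v # qs)" "last (v # qs) = y"
        using xs unfolding pth_def by (auto simp: successively_append_iff)
      then show ?thesis by (intro exI[of _ "v # qs"]) auto
    next
      case False
      have "adj E v (hd xs)" using step xs adj_sym by auto
      then have "pth A (v # xs)" using xs False step unfolding pth_def by (auto simp: successively_Cons)
      then show ?thesis using xs by (intro exI[of _ "v # xs"]) (auto simp: pth_def)
    qed
  qed
  moreover have "y \<in> A" using assms conn_in by metis
  ultimately show ?thesis using that by auto
qed

lemma es_append2: "xs \<noteq> [] \<Longrightarrow> ys \<noteq> [] \<Longrightarrow> es (xs @ ys) = es xs \<union> es ys \<union> {{last xs, hd ys}}"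
proof (induction xs rule: es.induct)
  case ("2_2" v)
  then show ?case by (cases ys) auto
qed auto

lemma es_ends: "pth A zs \<Longrightarrow> length zs \<ge> 3 \<Longrightarrow> {hd zs, last zs} \<notin> es zs"
proof (cases zs rule: es.cases)
  case (1 x y ws)
  assume a: "pth A zs" "length zs \<ge> 3"
  then have "ws \<noteq> []" "distinct (x # y # ws)" using 1 unfolding pth_def by auto
  then have "last zs \<noteq> y" "x \<notin> set (y # ws)" "last zs \<in> set ws" using 1 by auto
  then show ?thesis using 1 es_subset[of "{x, last zs}" "y # ws"] by (auto simp: doubleton_eq_iff)
qed auto

section \<open>Cycles as vertex lists\<close>

definition ring :: "complex set \<Rightarrow> complex list \<Rightarrow> bool" where
  "ring A ks \<longleftrightarrow> length ks \<ge> 3 \<and> distinct ks \<and> set ks \<subseteq> A \<and> successively (adj E) ks \<and> adj E (last ks) (hd ks)"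

definition kes :: "complex list \<Rightarrow> complex set set" where
  "kes ks = insert {last ks, hd ks} (es ks)"

definition kim :: "complex list \<Rightarrow> complex set" where
  "kim ks = set ks \<union> (\<Union>e\<in>kes ks. PI e)"

lemma kes_edges: "ring A ks \<Longrightarrow> kes ks \<subseteq> E"
  using es_edges unfolding ring_def kes_def adj_def by auto

lemma kes_subset: "ring A ks \<Longrightarrow> e \<in> kes ks \<Longrightarrow> e \<subseteq> set ks"
proof -
  assume a: "ring A ks" "e \<in> kes ks"
  then have "ks \<noteq> []" unfolding ring_def by auto
  then have "{last ks, hd ks} \<subseteq> set ks" by simp
  then show ?thesis using a(2) es_subset[of e ks] unfolding kes_def by blast
qed

lemma kim_Int_V: "ring V ks \<Longrightarrow> kim ks \<inter> V = set ks"
proof -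
  assume r: "ring V ks"
  have "PI e \<inter> V \<subseteq> set ks" if "e \<in> kes ks" for e
    using PI_Int_V[of e] kes_edges[OF r] kes_subset[OF r that] that by auto
  then show ?thesis using r unfolding kim_def ring_def by auto
qed

text \<open>Passage from cyclic lists to pairs of paths: the cycle is cut at two of its vertices,
  and the second path is reversed so that both lead from \<open>a\<close> to
  \<open>b\<close>.\<close>

lemma ring_split:
  assumes "ring V ks" "ks = us @ a # vs @ b # ws"
  shows "theta (a # vs @ [b]) (rev (b # ws @ us @ [a])) a b"
    "es (a # vs @ [b]) \<union> es (rev (b # ws @ us @ [a])) = kes ks"
    "loop (a # vs @ [b]) (rev (b # ws @ us @ [a])) = kim ks"
proof -
  let ?x = "a # vs @ [b]" and ?y' = "b # ws @ us @ [a]"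
  have d: "distinct ks" "set ks \<subseteq> V" "successively (adj E) ks" "adj E (last ks) (hd ks)" "length ks \<ge> 3"
    using assms(1) unfolding ring_def by auto
  have lh: "last ks = last (b # ws)" "hd ks = hd (us @ [a])" using assms(2) by (auto simp: hd_append)
  have px: "pth V ?x"
    using d assms(2) unfolding pth_def by (auto simp: successively_append_iff successively_Cons hd_append)
  have sy: "successively (adj E) ((b # ws) @ (us @ [a]))"
  proof -
    have "successively (adj E) (b # ws)" "successively (adj E) (us @ [a])"
      using d(3) unfolding assms(2) by (auto simp: successively_append_iff successively_Cons)
    moreover have "adj E (last (b # ws)) (hd (us @ [a]))" using d(4) lh by simp
    ultimately show ?thesis by (simp only: successively_append_iff) simp
  qed
  then have py: "pth V ?y'"
    using d assms(2) unfolding pth_def by auto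
  have "es ?y' = es (b # ws) \<union> es (us @ [a]) \<union> {{last (b # ws), hd (us @ [a])}}"
    using es_append2[of "b # ws" "us @ [a]"] by simp
  moreover have "es ks = es (us @ [a]) \<union> es ?x \<union> es (b # ws)"
    using es_append[of us a "vs @ b # ws"] es_append[of "a # vs" b ws] assms(2) by auto
  ultimately show kes: "es ?x \<union> es (rev ?y') = kes ks"
    unfolding kes_def lh es_rev by auto
  have "set ?x \<inter> set ?y' = {a, b}" using d assms(2) by auto
  \<comment> \<open>A cycle has at least three vertices, so one of the two paths is longer than an
    edge.\<close>
  moreover have "{a, b} \<notin> es ?x \<or> {a, b} \<notin> es ?y'"
  proof -
    have "length ?x \<ge> 3 \<or> length ?y' \<ge> 3" using d assms(2) by (cases vs; cases ws; cases us) auto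
    then show ?thesis using es_ends[OF px] es_ends[OF py] by (auto simp: insert_commute)
  qed
  ultimately have "es ?x \<inter> es ?y' = {}"
    using es_Int_disjoint[of ?x ?y' a b] px unfolding pth_def by auto
  then show "theta ?x (rev ?y') a b"
    using px pth_rev[OF py] \<open>set ?x \<inter> set ?y' = {a, b}\<close> d assms(2) es_rev[of ?y'] unfolding theta_def by auto
  have "set ?x \<union> set (rev ?y') = set ks" using assms(2) by auto
  then show "loop ?x (rev ?y') = kim ks"
    unfolding pim_def kim_def kes[symmetric] by blast
qed

lemma ring_of_theta:
  assumes "theta xs ys a b" "set xs \<union> set ys \<subseteq> A"
  obtains ks where "ring A ks" "kim ks = loop xs ys"
proof -
  have p: "pth V xs" "pth V ys" "hd xs = a" "last xs = b" "hd ys = a" "last ys = b" "a \<noteq> b"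
    "set xs \<inter> set ys = {a, b}" "es xs \<inter> es ys = {}"
    using assms unfolding theta_def by auto
  have l: "length xs \<ge> 2" "length ys \<ge> 2" using theta_lengths[OF assms(1)] by auto
  obtain ms where ms: "ys = a # ms @ [b]"
  proof -
    obtain ys' where "ys = a # ys'" using l p by (cases ys) auto
    moreover then have "ys' = butlast ys' @ [b]" using l p by (cases ys' rule: rev_cases) auto
    ultimately show ?thesis using that by metis
  qed
  obtain ns where ns: "xs = a # ns @ [b]"
  proof -
    obtain xs' where "xs = a # xs'" using l p by (cases xs) auto
    moreover then have "xs' = butlast xs' @ [b]" using l p by (cases xs' rule: rev_cases) auto
    ultimately show ?thesis using that by metis
  qed
  let ?ks = "xs @ rev ms"
  have lh: "hd ?ks = a" "last ?ks = hd (ms @ [b])" using p ns by (auto simp: last_rev hd_append)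
  have sy: "successively (adj E) (rev ys)" using pth_rev[OF p(2)] unfolding pth_def by auto
  then have s: "successively (adj E) ((b # rev ms) @ [a])" using ms by simp
  then have 1: "successively (adj E) (b # rev ms)" "adj E (last (b # rev ms)) a"
    by (auto simp only: successively_append_iff) auto
  have "es (rev ys) = es (b # rev ms) \<union> es [a] \<union> {{last (b # rev ms), hd [a]}}"
    using es_append2[of "b # rev ms" "[a]"] ms by simp
  then have "es ys = es (b # rev ms) \<union> {{last ?ks, hd ?ks}}" using es_rev lh p by (auto simp: last_rev hd_append)
  moreover have "es ?ks = es xs \<union> es (b # rev ms)"
    using es_append[of "a # ns" b "rev ms"] ns by simp
  ultimately have kes: "kes ?ks = es xs \<union> es ys" unfolding kes_def by auto
  have len: "length ?ks \<ge> 3"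
  proof (rule ccontr)
    assume "\<not> ?thesis"
    then have "ns = []" "ms = []" using ns by (cases ns; cases ms; simp)+
    then show False using p ns ms by auto
  qed
  have "distinct ?ks" using p ns ms unfolding pth_def by auto
  moreover have "successively (adj E) ?ks"
  proof -
    have "successively (adj E) (a # ns @ [b])" using p(1) ns unfolding pth_def by simp
    then show ?thesis using 1(1) ns successively_append_iff[of _ "a # ns" "[b]"]
        successively_append_iff[of _ "a # ns" "b # rev ms"] by simp
  qed
  moreover have "adj E (last ?ks) (hd ?ks)" using 1 lh by (auto simp: last_rev hd_append)
  ultimately have "ring A ?ks" using len assms(2) ms unfolding ring_def by auto
  moreover have "kim ?ks = loop xs ys"
    unfolding kim_def pim_def kes using ms ns by auto
  ultimately show ?thesis using that by blast
qed

text \<open>The form of \<open>disc\<close> in which the two vertices at which the outer cycle is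
  cut are not yet chosen.\<close>

definition rdisc :: "complex set \<Rightarrow> complex list \<Rightarrow> bool" where
  "rdisc W ks \<longleftrightarrow> W \<subseteq> V \<and> ring W ks \<and> D W \<subseteq> kim ks \<union> inside (kim ks)"

lemma ring_mono: "ring A ks \<Longrightarrow> A \<subseteq> A' \<Longrightarrow> ring A' ks"
  unfolding ring_def by auto

lemma rdisc_disc:
  assumes "rdisc W ks" "ks = us @ a # vs @ b # ws"
  shows "disc W (a # vs @ [b]) (rev (b # ws @ us @ [a])) a b"
proof -
  have r: "ring V ks" using assms(1) ring_mono unfolding rdisc_def by auto
  have "set (a # vs @ [b]) \<union> set (rev (b # ws @ us @ [a])) = set ks" using assms(2) by auto
  then show ?thesis
    using assms(1) ring_split[OF r assms(2)] unfolding disc_def rdisc_def ring_def by simp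
qed

lemma ring_as_split:
  assumes "ring A ks" obtains a b vs where "ks = [] @ a # vs @ b # []"
proof -
  have "length ks \<ge> 3" using assms unfolding ring_def by auto
  then obtain a ys where ys: "ks = a # ys" "ys \<noteq> []" by (cases ks rule: es.cases) auto
  then have "ks = [] @ a # butlast ys @ last ys # []" by simp
  then show ?thesis using that by blast
qed

lemma B_rdisc: "rdisc W ks \<Longrightarrow> B W = set ks"
proof -
  assume a: "rdisc W ks"
  then obtain x y vs where ks: "ks = [] @ x # vs @ y # []" unfolding rdisc_def by (metis ring_as_split)
  show ?thesis
    using rdisc_disc[OF a ks] B_disc ks unfolding disc_def by auto
qed

lemma kim_jordan:
  assumes "ring V ks"
  shows "closure (outside (kim ks)) = kim ks \<union> outside (kim ks)"
    "closure (inside (kim ks)) = kim ks \<union> inside (kim ks)" "closed (kim ks)"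
proof -
  obtain a b vs where ks: "ks = [] @ a # vs @ b # []" by (rule ring_as_split[OF assms])
  note t = ring_split[OF assms ks]
  show "closure (outside (kim ks)) = kim ks \<union> outside (kim ks)"
    "closure (inside (kim ks)) = kim ks \<union> inside (kim ks)" "closed (kim ks)"
    using theta_jordan(9-11)[OF t(1)] unfolding t(3) by auto
qed

text \<open>One of the two arcs of the cycle between the ends of the ear \<open>R\<close> is
  exchanged for \<open>R\<close>; for one of the two choices the new closed disc contains the old
  one.\<close>

lemma ear_enlarges:
  assumes ks: "ring W ks" "W \<subseteq> V" "ks = us @ a # vs @ b # ws"
    and R: "pth W R" "hd R = a" "last R = b" "set R \<inter> set ks = {a, b}" "es R \<inter> kes ks = {}"
    and out: "pim R \<inter> outside (kim ks) \<noteq> {}"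
  obtains ks' where "ring W ks'" "kim ks \<union> inside (kim ks) \<union> pim R \<subseteq> kim ks' \<union> inside (kim ks')"
proof -
  let ?x = "a # vs @ [b]" and ?y = "rev (b # ws @ us @ [a])"
  have rV: "ring V ks" using ring_mono ks by auto
  note sp = ring_split[OF rV ks(3)]
  have RV: "pth V R" using pth_mono R(1) ks(2) by auto
  have ab: "a \<in> set R" "b \<in> set R" "a \<noteq> b" using R(1-3) sp(1) unfolding pth_def theta_def by auto
  have sub: "set ?x \<subseteq> set ks" "set ?y \<subseteq> set ks" "set ks \<subseteq> W" "set R \<subseteq> W" using ks R unfolding ring_def pth_def by auto
  have "set ?x \<inter> set R = {a, b}" "set ?y \<inter> set R = {a, b}" using R(4) sub ab by auto
  moreover have "es ?x \<inter> es R = {}" "es ?y \<inter> es R = {}" using R(5) sp(2) by blast+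
  moreover note p = theta_pth[OF sp(1)]
  ultimately have tx: "theta ?x R a b" and ty: "theta ?y R a b"
    using RV R(2,3) sp(1) unfolding theta_def by simp_all
  obtain g h where gh: "arc g" "pathstart g = a" "pathfinish g = b" "path_image g = pim ?x"
    "arc h" "pathstart h = a" "pathfinish h = b" "path_image h = pim ?y" "pim ?x \<inter> pim ?y = {a, b}"
    using theta_arcs[OF sp(1)] by metis
  obtain k where k: "arc k" "pathstart k = a" "pathfinish k = b" "path_image k = pim R" "pim ?x \<inter> pim R = {a, b}"
    using theta_arcs[OF tx] by metis
  have i: "pim ?y \<inter> pim R = {a, b}" using theta_arcs[OF ty] by metis
  have ii: "path_image g \<inter> path_image h = {a, b}" "path_image g \<inter> path_image k = {a, b}"
    "path_image h \<inter> path_image k = {a, b}" "path_image k \<inter> outside (path_image g \<union> path_image h) \<noteq> {}"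
    using gh k i out sp(3) by simp_all
  have "loop ?x ?y \<union> pim R \<union> inside (loop ?x ?y) \<subseteq> loop ?x R \<union> inside (loop ?x R) \<or>
     loop ?x ?y \<union> pim R \<union> inside (loop ?x ?y) \<subseteq> loop ?y R \<union> inside (loop ?y R)"
    using ear_enlarges_closed_inside[OF gh(1-3) gh(5-7) k(1-3) ii] unfolding gh(4,8) k(4) .
  then show ?thesis
  proof
    assume x: "loop ?x ?y \<union> pim R \<union> inside (loop ?x ?y) \<subseteq> loop ?x R \<union> inside (loop ?x R)"
    have "set ?x \<union> set R \<subseteq> W" using sub by blast
    then obtain ks' where ks': "ring W ks'" "kim ks' = loop ?x R" by (rule ring_of_theta[OF tx])
    show ?thesis by (rule that[OF ks'(1)]) (use x in \<open>unfold ks'(2) sp(3), simp\<close>)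
  next
    assume x: "loop ?x ?y \<union> pim R \<union> inside (loop ?x ?y) \<subseteq> loop ?y R \<union> inside (loop ?y R)"
    have "set ?y \<union> set R \<subseteq> W" using sub by blast
    then obtain ks' where ks': "ring W ks'" "kim ks' = loop ?y R" by (rule ring_of_theta[OF ty])
    show ?thesis by (rule that[OF ks'(1)]) (use x in \<open>unfold ks'(2) sp(3), simp\<close>)
  qed
qed

text \<open>Some vertex \<open>x\<close> has two different neighbours \<open>y\<close> and
  \<open>z\<close>, the second because \<open>W - {y}\<close> is connected; a path from
  \<open>y\<close> to \<open>z\<close> that avoids \<open>x\<close> closes up to a cycle.\<close>

lemma ring_exists:
  assumes "card W \<ge> 3" "finite W"
    and c1: "\<And>u v. u \<in> W \<Longrightarrow> v \<in> W \<Longrightarrow> conn W u v"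
    and c2: "\<And>c u v. c \<in> W \<Longrightarrow> u \<in> W - {c} \<Longrightarrow> v \<in> W - {c} \<Longrightarrow> conn (W - {c}) u v"
  shows "\<exists>ks. ring W ks"
proof -
  have ne: "\<exists>z\<in>W. z \<notin> S" if "card S \<le> 2" "finite S" for S
  proof (rule ccontr)
    assume "\<not> ?thesis"
    then have "W \<subseteq> S" by auto
    then have "card W \<le> card S" using card_mono[OF that(2)] by simp
    then show False using that(1) assms(1) by linarith
  qed
  obtain x where x: "x \<in> W" using ne[of "{}"] by auto
  obtain y' where "y' \<in> W" "y' \<noteq> x" using ne[of "{x}"] by auto
  then obtain y where y: "y \<in> W" "adj E x y" using conn_nbr c1 x by metis
  have xy: "x \<noteq> y" using adjD y by auto
  have "card {x, y} \<le> 2" by (simp add: card_insert_if)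
  then obtain z' where "z' \<in> W" "z' \<notin> {x, y}" using ne[of "{x, y}"] by auto
  then have "conn (W - {y}) x z'" "x \<noteq> z'" using c2[of y x z'] y x xy by auto
  then obtain z where z: "z \<in> W - {y}" "adj E x z" using conn_nbr by metis
  have "z \<noteq> x" using adjD(3)[OF z(2)] by auto
  then have "conn (W - {x}) y z" using c2[of x y z] x y z xy by auto
  then obtain xs where xs: "pth (W - {x}) xs" "hd xs = y" "last xs = z"
    by (rule conn_path) (use y xy in auto)
  have "length xs \<ge> 2" using path_length_ge2[of xs] xs z unfolding pth_def by auto
  then have "ring W (x # xs)"
    using xs x y z adj_sym unfolding ring_def pth_def by (auto simp: successively_Cons)
  then show ?thesis by auto
qed

text \<open>A cycle is taken whose closed disc contains as many vertices and edges as possible. If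
  part of the drawing were outside this disc, there would be an edge leaving it at a vertex of the
  cycle, two-connectedness would extend that edge to an ear, and \<open>ear_enlarges\<close> would
  give a cycle with a larger disc.\<close>

theorem outer_cycle_exists:
  assumes WV: "W \<subseteq> V" and card: "card W \<ge> 3"
    and c1: "\<And>u v. u \<in> W \<Longrightarrow> v \<in> W \<Longrightarrow> conn W u v"
    and c2: "\<And>c u v. c \<in> W \<Longrightarrow> u \<in> W - {c} \<Longrightarrow> v \<in> W - {c} \<Longrightarrow> conn (W - {c}) u v"
  shows "\<exists>ks. rdisc W ks"
proof -
  have finW: "finite W" using WV finite_V finite_subset by auto
  define cl where "cl ks = kim ks \<union> inside (kim ks)" for ks
  define vs where "vs ks = {v \<in> W. v \<in> cl ks}" for ks
  define eds where "eds ks = {e \<in> E. e \<subseteq> W \<and> PI e \<subseteq> cl ks}" for ks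
  \<comment> \<open>Edges are counted as well, since a chord drawn outside the cycle adds no
    vertex.\<close>
  define \<mu> where "\<mu> ks = card (vs ks) + card (eds ks)" for ks
  have fin: "finite (vs ks)" "finite (eds ks)" for ks
    using finW finite_E unfolding vs_def eds_def by auto
  have "\<mu> ks < card W + card E + 1" for ks
    using card_mono[OF finW, of "vs ks"] card_mono[OF finite_E, of "eds ks"] unfolding \<mu>_def vs_def eds_def by auto
  then have bound: "\<forall>ks. ring W ks \<longrightarrow> \<mu> ks < card W + card E + 1" by blast
  have "\<exists>ks. ring W ks" by (rule ring_exists[OF card finW c1 c2]) simp_all
  then obtain ks0 where "ring W ks0" ..
  then have "\<exists>ks. ring W ks \<and> (\<forall>ks'. ring W ks' \<longrightarrow> \<mu> ks' \<le> \<mu> ks)"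
    using bound by (rule ex_has_greatest_nat)
  then obtain ks where ks: "ring W ks" and max: "\<And>ks'. ring W ks' \<Longrightarrow> \<mu> ks' \<le> \<mu> ks"
    by blast
  have rV: "ring V ks" using ks ring_mono WV by auto
  note j = kim_jordan[OF rV]
  have kV: "kim ks \<inter> V = set ks" using kim_Int_V[OF rV] .
  have ksW: "set ks \<subseteq> W" using ks unfolding ring_def by auto
  have ncl: "x \<notin> cl ks \<longleftrightarrow> x \<in> outside (kim ks)" for x
    unfolding cl_def by (simp add: outside_inside)
  have edge_out: "oe e \<subseteq> outside (kim ks) \<and> e \<notin> kes ks" if e: "e \<in> E" "\<not> PI e \<subseteq> cl ks" for e
  proof -
    have n: "e \<notin> kes ks" using e unfolding cl_def kim_def by auto
    have "oe e \<inter> PI e' = {}" if "e' \<in> kes ks" for e'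
      using oe_props(5)[OF e(1), of e'] that n kes_edges[OF rV] by auto
    moreover have "oe e \<inter> set ks = {}" using oe_props(4)[OF e(1)] ksW WV by auto
    ultimately have "oe e \<inter> kim ks = {}" unfolding kim_def by auto
    then consider "oe e \<subseteq> inside (kim ks)" | "oe e \<subseteq> outside (kim ks)"
      using connected_inside_or_outside[OF j(3) oe_props(1)[OF e(1)]] by auto
    then show ?thesis
    proof cases
      case 1
      then have "PI e \<subseteq> cl ks"
        using closure_mono[OF 1] oe_props(3)[OF e(1)] j(2) unfolding cl_def by auto
      then show ?thesis using e by auto
    qed (use n in simp)
  qed
  have edge_end: "x \<in> set ks" if e: "e \<in> E" "e \<subseteq> W" "\<not> PI e \<subseteq> cl ks" "x \<in> e" "x \<in> cl ks" for e x
  proof -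
    have "PI e \<subseteq> closure (outside (kim ks))"
      using edge_out[OF e(1,3)] closure_mono[of "oe e"] oe_props(3)[OF e(1)] by auto
    then have "x \<in> kim ks \<union> outside (kim ks)" using oe_props(6)[OF e(1)] e(4) j(1) by auto
    then have "x \<in> kim ks" using ncl e(5) by auto
    then show ?thesis using kV e(2,4) WV by auto
  qed
  show ?thesis
  proof (rule exI[of _ ks], rule ccontr)
    assume "\<not> rdisc W ks"
    then have not: "\<not> D W \<subseteq> cl ks" using ks WV unfolding rdisc_def cl_def by auto
    \<comment> \<open>If all vertices are in the disc, an edge is not, and both of its ends are on
      the cycle; otherwise connectivity of \<open>W\<close> gives an edge from the disc to a vertex
      outside.\<close>
    obtain u v where uv: "adj E u v" "u \<in> W" "v \<in> W" "u \<in> set ks" "\<not> PI {u, v} \<subseteq> cl ks"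
      "v \<in> set ks \<or> v \<notin> cl ks"
    proof (cases "W \<subseteq> cl ks")
      case True
      then obtain e where e: "e \<in> E" "e \<subseteq> W" "\<not> PI e \<subseteq> cl ks" using not unfolding D_def by auto
      obtain u v where "e = {u, v}" using e edgeE by metis
      then show ?thesis using that[of u v] e edge_end[OF e] True unfolding adj_def by auto
    next
      case False
      then obtain w where w: "w \<in> W" "w \<notin> cl ks" by auto
      have k0: "hd ks \<in> W" "hd ks \<in> cl ks"
        using ks ksW unfolding ring_def cl_def kim_def by (cases ks; auto)+
      have "conn W (hd ks) w" using c1 k0 w by auto
      then have "w \<notin> cl ks \<longrightarrow> (\<exists>x y. x \<in> W \<and> y \<in> W \<and> adj E x y \<and> x \<in> cl ks \<and> y \<notin> cl ks)"
        by (induction rule: conn_induct) (use k0 in auto)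
      then obtain x y where xy: "x \<in> W" "y \<in> W" "adj E x y" "x \<in> cl ks" "y \<notin> cl ks" using w by auto
      then have e: "{x, y} \<in> E" unfolding adj_def by auto
      then have "\<not> PI {x, y} \<subseteq> cl ks" using xy oe_props(6)[OF e] by auto
      then show ?thesis using that[of x y] xy edge_end[OF e] by auto
    qed
    have e: "{u, v} \<in> E" using uv unfolding adj_def by auto
    have eo: "oe {u, v} \<subseteq> outside (kim ks)" "{u, v} \<notin> kes ks" using edge_out[OF e uv(5)] by auto
    have un: "u \<noteq> v" using adjD uv by auto
    obtain R q where R: "pth W R" "hd R = u" "last R = q" "set R \<inter> set ks = {u, q}" "u \<noteq> q" "q \<in> set ks"
      "{u, v} \<in> es R" "es R \<inter> kes ks = {}"
    proof (cases "v \<in> set ks")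
      case True
      show ?thesis by (rule that[of "[u, v]" v]) (use True uv un eo in \<open>auto simp: pth_def\<close>)
    next
      case False
      have "\<not> set ks \<subseteq> {u}"
        using ks card_mono[of "{u}" "set ks"] distinct_card[of ks] unfolding ring_def by auto
      then obtain k where k: "k \<in> set ks" "k \<noteq> u" by auto
      \<comment> \<open>A way from \<open>v\<close> back to the cycle that avoids \<open>u\<close>;
        stopped at its first vertex \<open>q\<close> on the cycle, it completes the ear.\<close>
      then have "conn (W - {u}) v k" using c2[of u v k] uv un ksW by auto
      then obtain xs where xs: "pth (W - {u}) xs" "hd xs = v" "last xs = k"
        by (rule conn_path) (use uv un in auto)
      then have "\<exists>x\<in>set xs. x \<in> set ks" using k unfolding pth_def by (metis last_in_set)
      then obtain ps q qs where q: "xs = ps @ q # qs" "q \<in> set ks" "\<forall>p\<in>set ps. p \<notin> set ks"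
        using split_list_first_prop[of xs "\<lambda>x. x \<in> set ks"] by blast
      obtain ps' where ps: "ps = v # ps'" using q xs False by (cases ps) auto
      let ?R = "u # ps @ [q]"
      have p: "pth W ?R"
        using xs q ps uv unfolding pth_def by (auto simp: successively_append_iff successively_Cons hd_append)
      have i: "set ?R \<inter> set ks = {u, q}" using q uv by auto
      have uq: "u \<noteq> q" using xs q unfolding pth_def by auto
      have "{u, q} \<notin> es ?R" using es_ends[OF p] ps by auto
      then have "f \<notin> es ?R" if "f \<in> kes ks" for f
      proof -
        have "f \<in> E" "f \<subseteq> set ks" using that kes_edges[OF rV] kes_subset[OF rV] by auto
        moreover obtain s t where "s \<noteq> t" "f = {s, t}" using \<open>f \<in> E\<close> edgeE by metis
        moreover have "f \<subseteq> {u, q}" if "f \<in> es ?R"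
          using es_subset[OF that] \<open>f \<subseteq> set ks\<close> i by blast
        ultimately show ?thesis using \<open>{u, q} \<notin> es ?R\<close> by (auto simp: insert_commute)
      qed
      then show ?thesis using that[of ?R q] p i uq q ps by auto
    qed
    have "pim R \<inter> outside (kim ks) \<noteq> {}"
      using R(7) eo oe_props(2)[OF e] unfolding pim_def by blast
    \<comment> \<open>The ends of the ear have to be taken in the order in which they occur in the
      list, so the ear is reversed if \<open>q\<close> precedes \<open>u\<close>.\<close>
    have "\<exists>ks'. ring W ks' \<and> cl ks \<union> pim R \<subseteq> cl ks'"
    proof -
      obtain us rs where us: "ks = us @ u # rs" using uv split_list by metis
      then consider "q \<in> set rs" | "q \<in> set us" using R by auto
      then show ?thesis
      proof cases
        case 1
        then obtain vs ws where "rs = vs @ q # ws" using split_list by metis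
        then have "ks = us @ u # vs @ q # ws" using us by simp
        from ear_enlarges[OF ks WV this R(1-4,8) \<open>pim R \<inter> _ \<noteq> {}\<close>]
        obtain ks' where "ring W ks'" "kim ks \<union> inside (kim ks) \<union> pim R \<subseteq> kim ks' \<union> inside (kim ks')"
          by blast
        then show ?thesis unfolding cl_def by blast
      next
        case 2
        then obtain vs ws where "us = vs @ q # ws" using split_list by metis
        then have sp: "ks = vs @ q # ws @ u # rs" using us by simp
        have "hd (rev R) = q" "last (rev R) = u" "set (rev R) \<inter> set ks = {q, u}" "es (rev R) \<inter> kes ks = {}"
          "pim (rev R) = pim R"
          using R unfolding pth_def pim_def by (auto simp: hd_rev last_rev es_rev)
        with \<open>pim R \<inter> _ \<noteq> {}\<close> have "pim (rev R) \<inter> outside (kim ks) \<noteq> {}" by simp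
        with ear_enlarges[OF ks WV sp pth_rev[OF R(1)] \<open>hd (rev R) = q\<close> \<open>last (rev R) = u\<close>
            \<open>set (rev R) \<inter> set ks = {q, u}\<close> \<open>es (rev R) \<inter> kes ks = {}\<close>]
        obtain ks' where "ring W ks'" "kim ks \<union> inside (kim ks) \<union> pim (rev R) \<subseteq> kim ks' \<union> inside (kim ks')"
          by blast
        then show ?thesis unfolding cl_def \<open>pim (rev R) = pim R\<close> by blast
      qed
    qed
    then obtain ks' where ks': "ring W ks'" "cl ks \<union> pim R \<subseteq> cl ks'" by auto
    have "PI {u, v} \<subseteq> cl ks'" using ks' R(7) unfolding pim_def by blast
    then have "{u, v} \<in> eds ks'" "{u, v} \<notin> eds ks" using uv e unfolding eds_def by auto
    moreover have "eds ks \<subseteq> eds ks'" "vs ks \<subseteq> vs ks'" using ks' unfolding eds_def vs_def by auto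
    ultimately have "card (eds ks) < card (eds ks')" "card (vs ks) \<le> card (vs ks')"
      using fin by (auto intro!: psubset_card_mono card_mono)
    then show False using max[OF ks'(1)] unfolding \<mu>_def by auto
  qed
qed

end

section \<open>Colourings and gluing\<close>

locale triangle_free_drawing = plane_drawing +
  assumes tf: "triangle_free V E"
begin

lemma no_triangle: "adj E a b \<Longrightarrow> adj E b c \<Longrightarrow> \<not> adj E a c"
  using tf adjD unfolding triangle_free_def by blast

abbreviation forest :: "complex set \<Rightarrow> bool" where "forest A \<equiv> induces_forest E A"

lemma forest_iff: "forest A \<longleftrightarrow> (\<nexists>ks. ring A ks)"
  unfolding induces_forest_def has_cycle_in_def ring_def successively_conv_nth by blast

lemma ring_rotate: "ring A (xs @ ys) \<Longrightarrow> ring A (ys @ xs)"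
proof (cases "xs = [] \<or> ys = []")
  case False
  assume r: "ring A (xs @ ys)"
  then have "successively (adj E) (xs @ ys)" "adj E (last ys) (hd xs)" using False unfolding ring_def by auto
  then have "successively (adj E) (ys @ xs)" "adj E (last xs) (hd ys)"
    using False by (simp_all add: successively_append_iff)
  then show ?thesis using r False unfolding ring_def by auto
qed auto

lemma ring_rotate_to: "ring A ks \<Longrightarrow> x \<in> set ks \<Longrightarrow> \<exists>ys. ring A (x # ys) \<and> set (x # ys) = set ks"
proof -
  assume r: "ring A ks" "x \<in> set ks"
  then obtain as bs where ks: "ks = as @ x # bs" using split_list by metis
  then have "ring A (x # bs @ as)" using ring_rotate[of A as "x # bs"] r by auto
  then show ?thesis using ks by (intro exI[of _ "bs @ as"]) auto
qed

lemma path_conn: "pth A xs \<Longrightarrow> conn A (hd xs) (last xs)"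
proof (induction xs rule: es.induct)
  case (1 x y zs)
  then have "pth A (y # zs)" "adj E x y" "x \<in> A" "y \<in> A"
    unfolding pth_def by (auto simp: successively_Cons)
  then have "conn A x y" "conn A y (last (y # zs))" using 1(1) conn_step[of x A y] by simp_all
  then have "conn A x (last (y # zs))" by (rule conn_trans)
  then show ?case by simp
qed (auto simp: conn_refl pth_def)

text \<open>A cycle through \<open>d\<close> would use two different neighbours of \<open>d\<close>
  in \<open>A\<close>.\<close>

lemma forest_insert_leaf:
  assumes "forest A" "\<And>x y. x \<in> A \<Longrightarrow> y \<in> A \<Longrightarrow> adj E d x \<Longrightarrow> adj E d y \<Longrightarrow> x = y"
  shows "forest (insert d A)"
  unfolding forest_iff
proof
  assume "\<exists>ks. ring (insert d A) ks"
  then obtain ks where ks: "ring (insert d A) ks" ..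
  show False
  proof (cases "d \<in> set ks")
    case False
    then have "ring A ks" using ks unfolding ring_def by auto
    then show False using assms(1) forest_iff by auto
  next
    case True
    then obtain ys where ys: "ring (insert d A) (d # ys)" using ring_rotate_to ks by metis
    then have l: "length ys \<ge> 2" "d \<notin> set ys" "set ys \<subseteq> A" "distinct ys" unfolding ring_def by auto
    then obtain x y zs where z: "ys = x # y # zs" by (cases ys rule: es.cases) auto
    have "adj E d x" "adj E (last ys) d" using ys z unfolding ring_def by auto
    moreover have "last ys \<in> A" "x \<in> A" "last ys \<noteq> x" using l z by auto
    ultimately show False using assms(2)[of x "last ys"] adj_sym by auto
  qed
qed

text \<open>The pair is a separation whose two sides both contain the cut
  \<open>V1 \<inter> V2\<close>.\<close>

definition nocross :: "complex set \<Rightarrow> complex set \<Rightarrow> bool" where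
  "nocross V1 V2 \<longleftrightarrow> (\<forall>x\<in>V1 - V2. \<forall>y\<in>V2 - V1. \<not> adj E x y)"

lemma nocross_sym: "nocross V1 V2 \<Longrightarrow> nocross V2 V1"
  unfolding nocross_def using adj_sym by blast

lemma nocrossD: "nocross V1 V2 \<Longrightarrow> adj E x y \<Longrightarrow> x \<in> V1 \<Longrightarrow> y \<in> V2 \<Longrightarrow> y \<notin> V1 \<Longrightarrow> x \<in> V2"
  unfolding nocross_def by blast

text \<open>A cycle leaving \<open>V1\<close> contains a segment through \<open>V2 - V1\<close> between two vertices of \<open>V1 \<inter> V2\<close>; closing it
  up inside \<open>V1 \<inter> V2\<close> gives a cycle in \<open>V2\<close>.\<close>
lemma forest_glue:
  assumes A: "A \<subseteq> V1 \<union> V2" and nc: "nocross V1 V2"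
    and f: "forest (A \<inter> V1)" "forest (A \<inter> V2)"
    and c: "\<And>s s'. s \<in> A \<inter> V1 \<inter> V2 \<Longrightarrow> s' \<in> A \<inter> V1 \<inter> V2 \<Longrightarrow> s \<noteq> s' \<Longrightarrow> conn (A \<inter> V2) s s' \<Longrightarrow> conn (A \<inter> V1 \<inter> V2) s s'"
  shows "forest A"
  unfolding forest_iff
proof
  assume "\<exists>ks. ring A ks"
  then obtain ks where ks: "ring A ks" ..
  have ksA: "set ks \<subseteq> A" using ks unfolding ring_def by auto
  have "\<not> set ks \<subseteq> V1" "\<not> set ks \<subseteq> V2" using f ks ksA unfolding forest_iff ring_def by auto
  then obtain v0 r where v0: "v0 \<in> set ks" "v0 \<notin> V2" and r: "r \<in> set ks" "r \<notin> V1" by auto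
  obtain ys where ys: "ring A (v0 # ys)" "set (v0 # ys) = set ks" using ring_rotate_to ks v0 by metis
  have v01: "v0 \<in> V1" using v0 ksA A by auto
  have "\<exists>x\<in>set ys. x \<notin> V1" using r ys(2) v01 by auto
  then obtain as r bs where s1: "ys = as @ r # bs" "r \<notin> V1" "\<forall>x\<in>set as. x \<in> V1"
    using split_list_first_prop[of ys "\<lambda>x. x \<notin> V1"] by blast
  have d: "distinct (v0 # as @ r # bs)" "successively (adj E) (v0 # as @ r # bs)"
    "adj E (last (r # bs)) v0" "set (v0 # as @ r # bs) \<subseteq> A"
    using ys s1 unfolding ring_def by auto
  have rV2: "r \<in> V2" using s1 d A by auto
  define s where "s = last (v0 # as)"
  have sas: "s \<in> set (v0 # as)" unfolding s_def by (rule last_in_set) simp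
  have adjsr: "adj E s r"
    using d(2) successively_append_iff[of _ "v0 # as" "r # bs"] unfolding s_def by simp
  have sV1: "s \<in> V1" using sas s1 v01 by auto
  then have sV2: "s \<in> V2" using nocrossD[OF nc adjsr sV1 rV2] s1 by auto
  \<comment> \<open>Otherwise the cycle would return to \<open>v0\<close> by an edge from
    \<open>V2 - V1\<close> to \<open>V1 - V2\<close>.\<close>
  have "\<exists>x\<in>set bs. x \<in> V1"
  proof (rule ccontr)
    assume "\<not> ?thesis"
    then have "last (r # bs) \<notin> V1" using s1 by auto
    moreover have "last (r # bs) \<in> A" using d(4) by (cases bs rule: rev_cases) auto
    ultimately have "v0 \<in> V2" using nocrossD[OF nc, of v0 "last (r # bs)"] d(3) adj_sym v01 A by auto
    then show False using v0 by simp
  qed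
  then obtain cs s' ds where s2: "bs = cs @ s' # ds" "s' \<in> V1" "\<forall>x\<in>set cs. x \<notin> V1"
    using split_list_first_prop[of bs "\<lambda>x. x \<in> V1"] by blast
  have succ: "successively (adj E) ((v0 # as) @ (r # cs) @ (s' # ds))" using d(2) s2 by simp
  have succ2: "successively (adj E) (r # cs)" "adj E (last (r # cs)) s'"
    using succ by (simp_all only: successively_append_iff) auto
  have rcs: "set (r # cs) \<subseteq> A \<inter> V2" "set (r # cs) \<inter> V1 = {}"
    using s1 s2 d A by auto
  have lcs: "last (r # cs) \<in> set (r # cs)" by (rule last_in_set) simp
  have s'V2: "s' \<in> V2"
    using nocrossD[OF nc, of s' "last (r # cs)"] succ2 adj_sym s2 lcs rcs by blast
  have ss': "s \<noteq> s'" using d(1) s2 sas by auto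
  have sA: "s \<in> A" "s' \<in> A" using d(4) s2 sas by auto
  have "successively (adj E) ((r # cs) @ [s'])"
    using succ2 by (simp only: successively_append_iff) simp
  then have "pth (A \<inter> V2) (s # (r # cs) @ [s'])"
    using succ2 adjsr rcs d(1) s2 sas sV2 s'V2 sA ss'
    unfolding pth_def by (auto simp: successively_append_iff)
  then have "conn (A \<inter> V2) s s'" using path_conn by fastforce
  then have "conn (A \<inter> V1 \<inter> V2) s s'" using c sA sV1 sV2 s2 s'V2 ss' by auto
  then have "conn (A \<inter> V1 \<inter> V2) s' s" by (rule conn_sym)
  then obtain xs where xs: "pth (A \<inter> V1 \<inter> V2) xs" "hd xs = s'" "last xs = s"
    by (rule conn_path) (use sA s2 s'V2 in auto)
  have "length xs \<ge> 2" using path_length_ge2[of xs] xs ss' unfolding pth_def by auto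
  then have "ring (A \<inter> V2) (xs @ r # cs)"
    using xs rcs succ2 adjsr d(1) s2 unfolding ring_def pth_def by (auto simp: successively_append_iff)
  then show False using f(2) forest_iff by auto
qed

text \<open>The walk is followed step by step. An excursion into \<open>V2\<close> that returns to
  the cut is replaced by a walk inside the cut, which \<open>c\<close> supplies, so only the last
  excursion has to be remembered.\<close>

lemma conn_via_separator:
  assumes "conn A u z" "u \<in> V1" and A: "A \<subseteq> V1 \<union> V2" and nc: "nocross V1 V2"
    and c: "\<And>s s'. s \<in> A \<inter> V1 \<inter> V2 \<Longrightarrow> s' \<in> A \<inter> V1 \<inter> V2 \<Longrightarrow> s \<noteq> s' \<Longrightarrow> conn (A \<inter> V2) s s' \<Longrightarrow> conn (A \<inter> V1 \<inter> V2) s s'"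
  shows "(z \<in> V1 \<longrightarrow> conn (A \<inter> V1) u z) \<and>
    (z \<notin> V1 \<longrightarrow> (\<exists>s\<in>A \<inter> V1 \<inter> V2. conn (A \<inter> V1) u s \<and> conn (A \<inter> V2) s z))"
  using assms(1)
proof (induction rule: conn_induct)
  case refl
  then show ?case using assms(2) conn_refl by auto
next
  case (step y z)
  show ?case
  proof (cases "y \<in> V1")
    case True
    then have 1: "conn (A \<inter> V1) u y" using step by auto
    show ?thesis
    proof (cases "z \<in> V1")
      case zV1: True
      then have "conn (A \<inter> V1) y z" using step True by (intro conn_step) auto
      then show ?thesis using 1 conn_trans zV1 by blast
    next
      case False
      then have "z \<in> V2" using step A by auto
      then have "y \<in> V2" using nocrossD[OF nc] step False True by blast
      then have "conn (A \<inter> V2) y z" using step \<open>z \<in> V2\<close> by (intro conn_step) auto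
      then show ?thesis using 1 False True \<open>y \<in> V2\<close> step by blast
    qed
  next
    case False
    then obtain s where s: "s \<in> A \<inter> V1 \<inter> V2" "conn (A \<inter> V1) u s" "conn (A \<inter> V2) s y" using step by auto
    have yV2: "y \<in> V2" using step False A by auto
    have zV2: "z \<in> V2"
    proof (cases "z \<in> V1")
      case True
      then show ?thesis using nocrossD[OF nc, of z y] step adj_sym yV2 False by blast
    qed (use step A in auto)
    then have "conn (A \<inter> V2) y z" using step yV2 by (intro conn_step) auto
    then have sz: "conn (A \<inter> V2) s z" using s conn_trans by blast
    show ?thesis
    proof (cases "z \<in> V1")
      case True
      have "conn (A \<inter> V1) s z"
      proof (cases "s = z")
        case False
        then have "conn (A \<inter> V1 \<inter> V2) s z" using c s True zV2 step sz by auto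
        then show ?thesis by (rule conn_mono) auto
      qed (simp add: conn_refl)
      then show ?thesis using s conn_trans True by blast
    next
      case False
      then show ?thesis using s sz by blast
    qed
  qed
qed

section \<open>Scenes, their colourings, and the gluing of two colourings\<close>

definition cls :: "complex set \<Rightarrow> (complex \<Rightarrow> nat) \<Rightarrow> nat \<Rightarrow> complex set" where
  "cls W \<phi> c = {v \<in> W. \<phi> v = c}"

definition ones :: "complex set \<Rightarrow> (complex \<Rightarrow> nat) \<Rightarrow> complex \<Rightarrow> complex set" where
  "ones W \<phi> v = {u \<in> W. \<phi> u = 1 \<and> adj E u v}"

text \<open>Conditions (G1), (G2) and (G4) together with the prescribed colours, for the subgraph
  induced by \<open>W\<close>. (G3) is kept apart in \<open>linkfree\<close> because it is not
  demanded of scenes with nonempty \<open>S\<close>.\<close>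

definition good :: "complex set \<Rightarrow> complex set \<Rightarrow> complex set \<Rightarrow> (complex \<Rightarrow> nat) \<Rightarrow> (complex \<Rightarrow> nat) \<Rightarrow> bool" where
  "good W P Q \<delta> \<phi> \<longleftrightarrow>
     (\<forall>v\<in>W. \<phi> v = 1 \<or> \<phi> v = 2) \<and> (\<forall>v\<in>P. \<phi> v = \<delta> v) \<and> (\<forall>q\<in>Q. \<phi> q = 2) \<and>
     forest (cls W \<phi> 1) \<and> forest (cls W \<phi> 2) \<and>
     (\<forall>v\<in>W. \<phi> v = 1 \<longrightarrow> card (ones W \<phi> v) \<le> 3) \<and>
     (\<forall>v\<in>P. \<forall>u\<in>W - P. \<delta> v = 1 \<longrightarrow> adj E u v \<longrightarrow> \<phi> u = 2) \<and>
     (\<forall>v\<in>B W - P. \<phi> v = 1 \<longrightarrow> card (ones W \<phi> v) \<le> 2)"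

text \<open>A stronger (G3): \<open>w\<close> may be any neighbour of \<open>v\<close> on the
  boundary, joined to it by an edge of the outer cycle or not. Only colour 2 matters, as
  \<open>u\<close> is in \<open>Q\<close>.\<close>

definition linkfree :: "complex set \<Rightarrow> complex set \<Rightarrow> complex set \<Rightarrow> (complex \<Rightarrow> nat) \<Rightarrow> (complex \<Rightarrow> nat) \<Rightarrow> bool" where
  "linkfree W P Q \<delta> \<phi> \<longleftrightarrow>
     (\<forall>v u w. {x \<in> P. \<delta> x = 1} = {v} \<longrightarrow> u \<in> Q \<longrightarrow> adj E u v \<longrightarrow> w \<in> B W \<longrightarrow> adj E w v \<longrightarrow> w \<noteq> u \<longrightarrow>
        \<not> conn (cls W \<phi> 2) u w)"

text \<open>\<open>S\<close> is empty for an ordinary scene. Otherwise it contains the single vertex of \<open>Q\<close> that may have neighbours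
  in \<open>Q\<close>; such scenes arise when a precoloured edge with both ends of colour 1 loses an end.\<close>
definition gscene :: "complex set \<Rightarrow> complex set \<Rightarrow> complex set \<Rightarrow> (complex \<Rightarrow> nat) \<Rightarrow> complex set \<Rightarrow> bool" where
  "gscene W P Q \<delta> S \<longleftrightarrow>
     W \<subseteq> V \<and> P \<subseteq> B W \<and> card P \<le> 2 \<and> (\<forall>x\<in>P. \<forall>y\<in>P. x \<noteq> y \<longrightarrow> adj E x y) \<and>
     Q \<subseteq> B W - P \<and> (\<forall>x\<in>Q - S. \<forall>y\<in>Q - S. \<not> adj E x y) \<and> (\<forall>v\<in>P. \<delta> v = 1 \<or> \<delta> v = 2) \<and>
     (S = {} \<or> (\<exists>p1 p2 q. P = {p1, p2} \<and> p1 \<noteq> p2 \<and> \<delta> p1 = 1 \<and> \<delta> p2 = 2 \<and> S = {q} \<and> q \<in> Q \<and> adj E p2 q))"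

definition solvable :: "complex set \<Rightarrow> complex set \<Rightarrow> complex set \<Rightarrow> (complex \<Rightarrow> nat) \<Rightarrow> complex set \<Rightarrow> bool" where
  "solvable W P Q \<delta> S \<longleftrightarrow> (\<exists>\<phi>. good W P Q \<delta> \<phi> \<and> (S = {} \<longrightarrow> linkfree W P Q \<delta> \<phi>))"

text \<open>What a colouring of the second side needs in order to be glued to a given colouring of
  the first. A cut vertex of colour 1 gets no further neighbour of colour 1 in
  \<open>V2 - V1\<close>, so its degree is settled in \<open>V1\<close>; in colour 2 the second side
  must not connect cut vertices that the cut alone does not connect.\<close>

definition extends :: "complex set \<Rightarrow> complex set \<Rightarrow> complex set \<Rightarrow> complex set \<Rightarrow> (complex \<Rightarrow> nat) \<Rightarrow> (complex \<Rightarrow> nat) \<Rightarrow> bool" where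
  "extends W V1 V2 Q \<phi>1 \<phi>2 \<longleftrightarrow>
     (\<forall>v\<in>V2. \<phi>2 v = 1 \<or> \<phi>2 v = 2) \<and> (\<forall>v\<in>V1 \<inter> V2. \<phi>2 v = \<phi>1 v) \<and> (\<forall>q\<in>Q \<inter> V2. \<phi>2 q = 2) \<and>
     forest (cls V2 \<phi>2 1) \<and> forest (cls V2 \<phi>2 2) \<and>
     (\<forall>v\<in>V2 - V1. \<phi>2 v = 1 \<longrightarrow> card (ones V2 \<phi>2 v) \<le> 3) \<and>
     (\<forall>v\<in>(V2 - V1) \<inter> B W. \<phi>2 v = 1 \<longrightarrow> card (ones V2 \<phi>2 v) \<le> 2) \<and>
     (\<forall>s\<in>V1 \<inter> V2. \<forall>u\<in>V2 - V1. \<phi>2 s = 1 \<longrightarrow> adj E u s \<longrightarrow> \<phi>2 u = 2) \<and>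
     (\<forall>s\<in>V1 \<inter> V2. \<forall>s'\<in>V1 \<inter> V2. \<phi>2 s = 2 \<longrightarrow> \<phi>2 s' = 2 \<longrightarrow> s \<noteq> s' \<longrightarrow> conn (cls V2 \<phi>2 2) s s' \<longrightarrow>
        conn (cls (V1 \<inter> V2) \<phi>2 2) s s')"

definition glue :: "complex set \<Rightarrow> (complex \<Rightarrow> nat) \<Rightarrow> (complex \<Rightarrow> nat) \<Rightarrow> complex \<Rightarrow> nat" where
  "glue V1 \<phi>1 \<phi>2 v = (if v \<in> V1 then \<phi>1 v else \<phi>2 v)"

context
  fixes W V1 V2 P Q \<delta> \<phi>1 \<phi>2
  assumes W: "W = V1 \<union> V2" "W \<subseteq> V" and nc: "nocross V1 V2" and P: "P \<subseteq> V1" and Q: "Q \<subseteq> W"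
    and g1: "good V1 P (Q \<inter> V1) \<delta> \<phi>1" and ext: "extends W V1 V2 Q \<phi>1 \<phi>2"
begin

lemma glue_simps:
  "v \<in> V1 \<Longrightarrow> glue V1 \<phi>1 \<phi>2 v = \<phi>1 v" "v \<in> V2 \<Longrightarrow> glue V1 \<phi>1 \<phi>2 v = \<phi>2 v"
  using ext unfolding glue_def extends_def by auto

lemma glue_agree: "v \<in> V1 \<Longrightarrow> v \<in> V2 \<Longrightarrow> \<phi>2 v = \<phi>1 v"
  using ext unfolding extends_def by auto

lemma glue_cls:
  "cls W (glue V1 \<phi>1 \<phi>2) c \<inter> V1 = cls V1 \<phi>1 c" "cls W (glue V1 \<phi>1 \<phi>2) c \<inter> V2 = cls V2 \<phi>2 c"
  "cls W (glue V1 \<phi>1 \<phi>2) c \<inter> V1 \<inter> V2 = cls (V1 \<inter> V2) \<phi>2 c"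
  "cls W (glue V1 \<phi>1 \<phi>2) c \<subseteq> V1 \<union> V2"
  unfolding cls_def W(1) using glue_simps glue_agree by auto

lemma glue_link:
  assumes "s \<in> cls W (glue V1 \<phi>1 \<phi>2) 2 \<inter> V1 \<inter> V2" "s' \<in> cls W (glue V1 \<phi>1 \<phi>2) 2 \<inter> V1 \<inter> V2" "s \<noteq> s'"
    "conn (cls W (glue V1 \<phi>1 \<phi>2) 2 \<inter> V2) s s'"
  shows "conn (cls W (glue V1 \<phi>1 \<phi>2) 2 \<inter> V1 \<inter> V2) s s'"
proof -
  have "s \<in> V1 \<inter> V2" "s' \<in> V1 \<inter> V2" "\<phi>2 s = 2" "\<phi>2 s' = 2"
    using assms(1,2) unfolding glue_cls(3) by (auto simp: cls_def)
  then show ?thesis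
    using ext assms(3,4) unfolding extends_def glue_cls(2,3) by blast
qed

lemma glue_good: "good W P Q \<delta> (glue V1 \<phi>1 \<phi>2)"
proof -
  let ?\<phi> = "glue V1 \<phi>1 \<phi>2"
  have e: "\<And>v. v \<in> V2 \<Longrightarrow> \<phi>2 v = 1 \<or> \<phi>2 v = 2" "\<And>q. q \<in> Q \<Longrightarrow> q \<in> V2 \<Longrightarrow> \<phi>2 q = 2"
    "forest (cls V2 \<phi>2 1)" "forest (cls V2 \<phi>2 2)"
    "\<And>v. v \<in> V2 \<Longrightarrow> v \<notin> V1 \<Longrightarrow> \<phi>2 v = 1 \<Longrightarrow> card (ones V2 \<phi>2 v) \<le> 3"
    "\<And>v. v \<in> V2 \<Longrightarrow> v \<notin> V1 \<Longrightarrow> v \<in> B W \<Longrightarrow> \<phi>2 v = 1 \<Longrightarrow> card (ones V2 \<phi>2 v) \<le> 2"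
    "\<And>s u. s \<in> V1 \<Longrightarrow> s \<in> V2 \<Longrightarrow> u \<in> V2 \<Longrightarrow> u \<notin> V1 \<Longrightarrow> \<phi>2 s = 1 \<Longrightarrow> adj E u s \<Longrightarrow> \<phi>2 u = 2"
    using ext unfolding extends_def by auto
  have g: "\<And>v. v \<in> V1 \<Longrightarrow> \<phi>1 v = 1 \<or> \<phi>1 v = 2" "\<And>v. v \<in> P \<Longrightarrow> \<phi>1 v = \<delta> v" "\<And>q. q \<in> Q \<Longrightarrow> q \<in> V1 \<Longrightarrow> \<phi>1 q = 2"
    "forest (cls V1 \<phi>1 1)" "forest (cls V1 \<phi>1 2)"
    "\<And>v. v \<in> V1 \<Longrightarrow> \<phi>1 v = 1 \<Longrightarrow> card (ones V1 \<phi>1 v) \<le> 3"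
    "\<And>v u. v \<in> P \<Longrightarrow> u \<in> V1 \<Longrightarrow> u \<notin> P \<Longrightarrow> \<delta> v = 1 \<Longrightarrow> adj E u v \<Longrightarrow> \<phi>1 u = 2"
    "\<And>v. v \<in> B V1 \<Longrightarrow> v \<notin> P \<Longrightarrow> \<phi>1 v = 1 \<Longrightarrow> card (ones V1 \<phi>1 v) \<le> 2"
    using g1 unfolding good_def by auto
  \<comment> \<open>No edge with both ends of colour 1 leaves \<open>V1\<close> through the cut.
    Hence every degree in colour 1 is determined on one side, and a walk of colour 1 that starts in
    the cut and runs in \<open>V2\<close> never leaves the cut.\<close>
  have strong: "?\<phi> u = 2" if "s \<in> V1" "u \<in> V2" "u \<notin> V1" "?\<phi> s = 1" "adj E u s" for s u
  proof -
    have "s \<in> V2" using nocrossD[OF nc, of s u] that adj_sym by blast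
    then show ?thesis using e(7)[of s u] that glue_simps(2) by simp
  qed
  have o1: "ones W ?\<phi> v = ones V1 \<phi>1 v" if "v \<in> V1" "?\<phi> v = 1" for v
    unfolding ones_def W(1) using glue_simps strong[OF that(1)] that by fastforce
  have o2: "ones W ?\<phi> v = ones V2 \<phi>2 v" if "v \<in> V2" "v \<notin> V1" for v
  proof -
    have "u \<in> V2" if "u \<in> W" "adj E u v" for u
      using nocrossD[OF nc, of u v] that \<open>v \<in> V2\<close> \<open>v \<notin> V1\<close> W(1) by blast
    then have "(u \<in> W \<and> ?\<phi> u = 1 \<and> adj E u v) = (u \<in> V2 \<and> \<phi>2 u = 1 \<and> adj E u v)" for u
    proof (cases "u \<in> V2")
      case True
      then show ?thesis using glue_simps(2)[OF True] W(1) by simp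
    next
      case False
      then show ?thesis using \<open>\<And>u. u \<in> W \<Longrightarrow> adj E u v \<Longrightarrow> u \<in> V2\<close> by metis
    qed
    then show ?thesis unfolding ones_def by auto
  qed
  have "forest (cls W ?\<phi> 2)"
    by (rule forest_glue[OF glue_cls(4) nc]) (use glue_link glue_cls g(5) e(4) in simp_all)
  moreover have "forest (cls W ?\<phi> 1)"
  proof (rule forest_glue[OF glue_cls(4) nc])
    fix s s' assume s: "s \<in> cls W ?\<phi> 1 \<inter> V1 \<inter> V2" "s' \<in> cls W ?\<phi> 1 \<inter> V1 \<inter> V2" "s \<noteq> s'"
      and "conn (cls W ?\<phi> 1 \<inter> V2) s s'"
    from this(4) have "s' \<in> V1 \<and> conn (cls W ?\<phi> 1 \<inter> V1 \<inter> V2) s s'"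
    proof (induction rule: conn_induct)
      case (step y z)
      have "z \<in> V1"
      proof (rule ccontr)
        assume "z \<notin> V1"
        then have "?\<phi> z = 2" using strong[of y z] step adj_sym unfolding cls_def by auto
        then show False using step unfolding cls_def by auto
      qed
      then have "conn (cls W ?\<phi> 1 \<inter> V1 \<inter> V2) y z" using step by (intro conn_step) auto
      then show ?case using step conn_trans \<open>z \<in> V1\<close> by blast
    qed (use s conn_refl in auto)
    then show "conn (cls W ?\<phi> 1 \<inter> V1 \<inter> V2) s s'" ..
  qed (use glue_cls g(4) e(3) in simp_all)
  moreover have "card (ones W ?\<phi> v) \<le> 3" if "v \<in> W" "?\<phi> v = 1" for v
    using o1 o2 g(6) e(5) that glue_simps W(1) by (cases "v \<in> V1") auto
  moreover have "?\<phi> u = 2" if "v \<in> P" "u \<in> W" "u \<notin> P" "\<delta> v = 1" "adj E u v" for v u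
  proof (cases "u \<in> V1")
    case True
    then show ?thesis using g(7) that glue_simps by auto
  next
    case False
    moreover have "?\<phi> v = 1" using that P g(2) glue_simps by auto
    ultimately show ?thesis using strong[of v u] that P W(1) by auto
  qed
  moreover have "card (ones W ?\<phi> v) \<le> 2" if "v \<in> B W" "v \<notin> P" "?\<phi> v = 1" for v
  proof (cases "v \<in> V1")
    case True
    then have "v \<in> B V1" using B_mono[of V1 W v] W that by auto
    then show ?thesis using o1[OF True] g(8) that glue_simps(1)[OF True] by auto
  next
    case False
    then have "v \<in> V2" using B_subset that W by auto
    then show ?thesis using o2 e(6) that False glue_simps by auto
  qed
  moreover have "?\<phi> v = 1 \<or> ?\<phi> v = 2" if "v \<in> W" for v
    using that g(1)[of v] e(1)[of v] glue_simps(1)[of v] glue_simps(2)[of v]  unfolding W(1) by (elim UnE) simp_all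
  moreover have "?\<phi> v = \<delta> v" if "v \<in> P" for v
    using that g(2)[of v] glue_simps(1)[of v] P by auto
  moreover have "?\<phi> q = 2" if "q \<in> Q" for q
    using that g(3)[of q] e(2)[of q] glue_simps(1)[of q] glue_simps(2)[of q] Q unfolding W(1) by auto
  ultimately show ?thesis
    unfolding good_def by blast
qed

text \<open>All vertices that (G3) refers to are in \<open>V1\<close>, and a walk of colour 2
  between them can be pulled back into \<open>V1\<close>.\<close>

lemma glue_linkfree:
  assumes "linkfree V1 P (Q \<inter> V1) \<delta> \<phi>1"
    and "\<And>v u. {x \<in> P. \<delta> x = 1} = {v} \<Longrightarrow> u \<in> Q \<union> B W \<Longrightarrow> adj E u v \<Longrightarrow> u \<in> V1"
  shows "linkfree W P Q \<delta> (glue V1 \<phi>1 \<phi>2)"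
  unfolding linkfree_def
proof (intro allI impI notI)
  fix v u w assume a: "{x \<in> P. \<delta> x = 1} = {v}" "u \<in> Q" "adj E u v" "w \<in> B W" "adj E w v" "w \<noteq> u"
    "conn (cls W (glue V1 \<phi>1 \<phi>2) 2) u w"
  have uw: "u \<in> V1" "w \<in> V1" using assms(2)[OF a(1)] a by auto
  have "conn (cls W (glue V1 \<phi>1 \<phi>2) 2 \<inter> V1) u w"
    using conn_via_separator[OF a(7) uw(1) glue_cls(4) nc glue_link] uw(2) by blast
  then have "conn (cls V1 \<phi>1 2) u w" unfolding glue_cls(1) .
  moreover have "w \<in> B V1" using B_mono[of V1 W w] W a(4) uw by auto
  ultimately show False using assms(1) a uw unfolding linkfree_def by blast
qed

end

lemma goodD:
  assumes "good W P Q \<delta> \<phi>"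
  shows "v \<in> W \<Longrightarrow> \<phi> v = 1 \<or> \<phi> v = 2" "p \<in> P \<Longrightarrow> \<phi> p = \<delta> p" "q \<in> Q \<Longrightarrow> \<phi> q = 2"
    "forest (cls W \<phi> 1)" "forest (cls W \<phi> 2)" "v \<in> W \<Longrightarrow> \<phi> v = 1 \<Longrightarrow> card (ones W \<phi> v) \<le> 3"
    "p \<in> P \<Longrightarrow> \<delta> p = 1 \<Longrightarrow> v \<in> W \<Longrightarrow> v \<notin> P \<Longrightarrow> adj E v p \<Longrightarrow> \<phi> v = 2"
    "v \<in> B W \<Longrightarrow> v \<notin> P \<Longrightarrow> \<phi> v = 1 \<Longrightarrow> card (ones W \<phi> v) \<le> 2"
  using assms unfolding good_def by auto

lemma gsceneD:
  assumes "gscene W P Q \<delta> S"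
  shows "W \<subseteq> V" "P \<subseteq> B W" "card P \<le> 2" "x \<in> P \<Longrightarrow> y \<in> P \<Longrightarrow> x \<noteq> y \<Longrightarrow> adj E x y"
    "Q \<subseteq> B W" "Q \<inter> P = {}" "x \<in> Q \<Longrightarrow> x \<notin> S \<Longrightarrow> y \<in> Q \<Longrightarrow> y \<notin> S \<Longrightarrow> \<not> adj E x y"
    "v \<in> P \<Longrightarrow> \<delta> v = 1 \<or> \<delta> v = 2" "S \<subseteq> Q" "P \<subseteq> W" "Q \<subseteq> W" "finite P"
    "S \<noteq> {} \<Longrightarrow> \<exists>p1 p2 q. P = {p1, p2} \<and> p1 \<noteq> p2 \<and> \<delta> p1 = 1 \<and> \<delta> p2 = 2 \<and> S = {q} \<and> q \<in> Q \<and> adj E p2 q"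
proof -
  show "W \<subseteq> V" "P \<subseteq> B W" "P \<subseteq> W" "Q \<subseteq> W" "finite P" "Q \<subseteq> B W"
    using assms finite_V B_subset[of W] finite_subset[of P V] unfolding gscene_def by auto
qed (use assms in \<open>auto simp: gscene_def\<close>)

lemma normal_sceneI:
  assumes "W \<subseteq> V" "P \<subseteq> B W" "card P \<le> 2" "\<And>x y. x \<in> P \<Longrightarrow> y \<in> P \<Longrightarrow> x \<noteq> y \<Longrightarrow> adj E x y"
    "Q \<subseteq> B W" "Q \<inter> P = {}" "\<And>x y. x \<in> Q \<Longrightarrow> y \<in> Q \<Longrightarrow> \<not> adj E x y"
    "\<And>v. v \<in> P \<Longrightarrow> \<delta> v = 1 \<or> \<delta> v = 2"
  shows "gscene W P Q \<delta> {}"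
  using assms unfolding gscene_def by auto

lemma B_deleted:
  assumes "U \<subseteq> V" "d \<in> B U"
  shows "x \<in> U \<Longrightarrow> adj E d x \<Longrightarrow> x \<in> B (U - {d})" "x \<in> B U \<Longrightarrow> x \<noteq> d \<Longrightarrow> x \<in> B (U - {d})"
proof -
  have "d \<in> Out (U - {d})" by (rule B_imp_Out[of _ U]) (use assms in auto)
  then show "x \<in> U \<Longrightarrow> adj E d x \<Longrightarrow> x \<in> B (U - {d})"
    using expose(2)[of "U - {d}" d x] assms adjD by blast
  show "x \<in> B U \<Longrightarrow> x \<noteq> d \<Longrightarrow> x \<in> B (U - {d})"
    using B_mono[of "U - {d}" U x] B_subset assms by blast
qed

lemma cls_edge: "x \<in> A \<Longrightarrow> y \<in> A \<Longrightarrow> \<phi> x = c \<Longrightarrow> \<phi> y = c \<Longrightarrow> adj E x y \<Longrightarrow> conn (cls A \<phi> c) x y"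
  by (rule conn_step) (auto simp: cls_def)

section \<open>Separations\<close>

text \<open>The cut is a clique, so it is empty, a vertex or an edge. The first side, which contains
  \<open>P\<close>, is coloured by induction and prescribes the colours of the cut for the second
  side. A cut vertex in \<open>Q\<close> has colour 2 on both sides anyway and stays in
  \<open>Q\<close>, so that (G3) remains available for it. The exceptional vertex is instead
  precoloured: it may have neighbours in \<open>Q\<close>, and without it the new \<open>Q\<close>
  is independent.\<close>

lemma separation_solvable:
  assumes IH: "\<And>W' P' Q' \<delta>' S'. W' \<subset> W \<Longrightarrow> gscene W' P' Q' \<delta>' S' \<Longrightarrow> solvable W' P' Q' \<delta>' S'"
    and gs: "gscene W P Q \<delta> S"
    and sep: "W = V1 \<union> V2" "V1 \<subset> W" "V2 \<subset> W" "nocross V1 V2" "P \<subseteq> V1"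
    and T: "\<And>x y. x \<in> V1 \<inter> V2 \<Longrightarrow> y \<in> V1 \<inter> V2 \<Longrightarrow> x \<noteq> y \<Longrightarrow> adj E x y"
      "V1 \<inter> V2 \<subseteq> B V2" "\<And>t. t \<in> V1 \<inter> V2 \<Longrightarrow> t \<in> B W \<or> V1 \<inter> V2 = {t}"
    and P2: "P2 = (V1 \<inter> V2 - (Q - S)) \<union> (S \<inter> V2)" "card P2 \<le> 2"
      "\<And>x y. x \<in> P2 \<Longrightarrow> y \<in> P2 \<Longrightarrow> x \<noteq> y \<Longrightarrow> adj E x y"
  shows "solvable W P Q \<delta> S"
proof -
  note g = gsceneD[OF gs]
  have BV: "x \<in> B W \<Longrightarrow> x \<in> V1 \<Longrightarrow> x \<in> B V1" "x \<in> B W \<Longrightarrow> x \<in> V2 \<Longrightarrow> x \<in> B V2" for x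
    using B_mono[of V1 W x] B_mono[of V2 W x] sep(1) g(1) by auto
  have S1: "S \<inter> V1 \<noteq> {} \<Longrightarrow> S \<inter> V1 = S" using g(13) by auto
  have "gscene V1 P (Q \<inter> V1) \<delta> (S \<inter> V1)"
    unfolding gscene_def
  proof (intro conjI)
    show "S \<inter> V1 = {} \<or> (\<exists>p1 p2 q. P = {p1, p2} \<and> p1 \<noteq> p2 \<and> \<delta> p1 = 1 \<and> \<delta> p2 = 2 \<and> S \<inter> V1 = {q} \<and> q \<in> Q \<inter> V1 \<and> adj E p2 q)"
      using g(13) S1 by fastforce
    show "P \<subseteq> B V1" using g(2) sep(5) BV(1) by auto
    show "Q \<inter> V1 \<subseteq> B V1 - P" using g(5,6) BV(1) by auto
    show "V1 \<subseteq> V" using g(1) sep(1) by auto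
    show "card P \<le> 2" by (rule g(3))
    show "\<forall>x\<in>P. \<forall>y\<in>P. x \<noteq> y \<longrightarrow> adj E x y" using g(4) by blast
    show "\<forall>x\<in>Q \<inter> V1 - S \<inter> V1. \<forall>y\<in>Q \<inter> V1 - S \<inter> V1. \<not> adj E x y" using g(7) by blast
    show "\<forall>v\<in>P. \<delta> v = 1 \<or> \<delta> v = 2" using g(8) by blast
  qed
  then obtain \<phi>1 where \<phi>1: "good V1 P (Q \<inter> V1) \<delta> \<phi>1" "S \<inter> V1 = {} \<Longrightarrow> linkfree V1 P (Q \<inter> V1) \<delta> \<phi>1"
    using IH[OF sep(2)] unfolding solvable_def by blast
  note d1 = goodD[OF \<phi>1(1)]
  \<comment> \<open>The default 2 is meant for an exceptional vertex beyond the cut, which is in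
    \<open>Q\<close>.\<close>
  define \<delta>2 where "\<delta>2 v = (if v \<in> V1 then \<phi>1 v else 2)" for v
  define Q2 where "Q2 = Q \<inter> V2 - P2"
  have "gscene V2 P2 Q2 \<delta>2 {}"
  proof (rule normal_sceneI)
    show "P2 \<subseteq> B V2" using T(2) g(5,9) BV(2) unfolding P2(1) by auto
    show "\<not> adj E x y" if "x \<in> Q2" "y \<in> Q2" for x y
      using that g(7) unfolding Q2_def P2(1) by auto
    show "\<delta>2 v = 1 \<or> \<delta>2 v = 2" for v using d1(1)[of v] unfolding \<delta>2_def by simp
    show "V2 \<subseteq> V" using g(1) sep(1) by auto
    show "Q2 \<subseteq> B V2" using g(5) BV(2) unfolding Q2_def by auto
    show "Q2 \<inter> P2 = {}" unfolding Q2_def by auto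
  qed (use P2(2,3) in blast)+
  then obtain \<phi>2 where \<phi>2: "good V2 P2 Q2 \<delta>2 \<phi>2" "linkfree V2 P2 Q2 \<delta>2 \<phi>2"
    using IH[OF sep(3)] unfolding solvable_def by blast
  note d2 = goodD[OF \<phi>2(1)]
  have agree: "\<phi>2 t = \<phi>1 t" if "t \<in> V1" "t \<in> V2" for t
  proof (cases "t \<in> P2")
    case True
    then show ?thesis using d2(2) that unfolding \<delta>2_def by auto
  next
    case False
    then have "t \<in> Q" "t \<in> Q2" using that unfolding P2(1) Q2_def by auto
    then show ?thesis using d2(3) d1(3) that by auto
  qed
  have S2: "\<phi>2 q = 2" if "q \<in> S" "q \<in> V2" for q
  proof -
    have "q \<in> P2" using that P2(1) by auto
    then have "\<phi>2 q = \<delta>2 q" using d2(2) by auto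
    moreover have "q \<in> V1 \<Longrightarrow> \<phi>1 q = 2" using d1(3) that g(9) by auto
    ultimately show ?thesis unfolding \<delta>2_def by auto
  qed
  have ext: "extends W V1 V2 Q \<phi>1 \<phi>2"
    unfolding extends_def
  proof (intro conjI ballI impI)
    fix q assume "q \<in> Q \<inter> V2"
    then show "\<phi>2 q = 2" using S2 d2(3) agree d1(3) unfolding Q2_def P2(1) by blast
  next
    fix v assume v: "v \<in> (V2 - V1) \<inter> B W" "\<phi>2 v = 1"
    then have "v \<notin> P2" using S2 unfolding P2(1) by auto
    then show "card (ones V2 \<phi>2 v) \<le> 2" using d2(8) v BV(2) by auto
  next
    fix s u assume a: "s \<in> V1 \<inter> V2" "u \<in> V2 - V1" "\<phi>2 s = 1" "adj E u s"
    have "s \<in> P2" using a d2(3)[of s] unfolding P2(1) Q2_def by auto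
    then show "\<phi>2 u = 2"
      using d2(2)[of s] d2(7)[of s u] a S2[of u] unfolding P2(1) by auto
  next
    fix s s' assume "s \<in> V1 \<inter> V2" "s' \<in> V1 \<inter> V2" "\<phi>2 s = 2" "\<phi>2 s' = 2" "s \<noteq> s'"
    then show "conn (cls (V1 \<inter> V2) \<phi>2 2) s s'" using T(1) by (intro cls_edge) auto
  qed (use d2 agree in auto)
  note gl = sep(1) g(1) sep(4,5) g(11) \<phi>1(1) ext
  have good: "good W P Q \<delta> (glue V1 \<phi>1 \<phi>2)" by (rule glue_good[OF gl])
  have "linkfree W P Q \<delta> (glue V1 \<phi>1 \<phi>2)" if S: "S = {}"
  proof (cases "\<exists>v\<in>V2. {x \<in> P. \<delta> x = 1} = {v}")
    case False
    have L1: "linkfree V1 P (Q \<inter> V1) \<delta> \<phi>1" using \<phi>1(2) S by auto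
    show ?thesis
    proof (rule glue_linkfree[OF gl L1])
      fix v u assume a: "{x \<in> P. \<delta> x = 1} = {v}" "u \<in> Q \<union> B W" "adj E u v"
      then have "v \<in> V1" "v \<notin> V2" "u \<in> W" using False sep(5) g(11) B_subset[of W] by auto
      then show "u \<in> V1" using nocrossD[OF sep(4), of v u] a(3) adj_sym sep(1) by blast
    qed
  next
    case True
    then obtain v where v: "v \<in> V2" "{x \<in> P. \<delta> x = 1} = {v}" by auto
    then have vP: "v \<in> P" "\<delta> v = 1" by auto
    have vV1: "v \<in> V1" using vP sep(5) by auto
    have L1: "\<not> conn (cls V1 \<phi>1 2) u w"
      if "u \<in> Q" "u \<in> V1" "adj E u v" "w \<in> B V1" "adj E w v" "w \<noteq> u" for u w
      using \<phi>1(2) S that v unfolding linkfree_def by auto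
    \<comment> \<open>A second such vertex would be in the cut and adjacent to \<open>v\<close>; it
      is not in \<open>P\<close> by the choice of \<open>v\<close>, so (G2) on the first side gives
      it colour 2.\<close>
    have "{x \<in> P2. \<delta>2 x = 1} = {v}"
    proof -
      have "v \<in> P2" "\<delta>2 v = 1" using v(1) vP vV1 g(6) d1(2)[OF vP(1)] unfolding P2(1) \<delta>2_def by auto
      moreover have "x = v" if "x \<in> P2" "\<delta>2 x = 1" for x
      proof (rule ccontr)
        assume "x \<noteq> v"
        have x: "x \<in> V1" "x \<in> V2" using that(1) S unfolding P2(1) by auto
        then have "\<phi>1 x = 1" using that unfolding \<delta>2_def by auto
        have "x \<notin> P"
        proof
          assume "x \<in> P"
          then have "x \<in> {x \<in> P. \<delta> x = 1}" using d1(2)[of x] \<open>\<phi>1 x = 1\<close> by simp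
          then show False using \<open>x \<noteq> v\<close> unfolding v(2) by simp
        qed
        moreover have "adj E x v" using T(1) x v(1) vV1 \<open>x \<noteq> v\<close> by auto
        ultimately show False using d1(7)[of v x] vP x \<open>\<phi>1 x = 1\<close> by auto
      qed
      ultimately show ?thesis by blast
    qed
    then have L2: "\<not> conn (cls V2 \<phi>2 2) u w"
      if "u \<in> Q" "u \<in> V2" "adj E u v" "w \<in> B V2" "adj E w v" "w \<noteq> u" for u w
    proof -
      have "u \<in> Q2 \<or> u \<in> P2 \<and> u \<in> Q" using that unfolding Q2_def by auto
      then have "u \<in> Q2" using S unfolding P2(1) by auto
      then show ?thesis using \<phi>2(2) \<open>{x \<in> P2. \<delta>2 x = 1} = {v}\<close> that unfolding linkfree_def by auto
    qed
    let ?A = "cls W (glue V1 \<phi>1 \<phi>2) 2"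
    note gc = glue_cls[OF gl, of 2]
    have tv: "t \<noteq> v \<and> adj E t v \<and> t \<in> B V1 \<and> t \<in> B V2 \<and> t \<in> V1 \<and> t \<in> V2" if "t \<in> ?A \<inter> V1 \<inter> V2" for t
    proof -
      have "t \<in> cls (V1 \<inter> V2) \<phi>2 2" using that gc(3) by blast
      then have t: "t \<in> V1" "t \<in> V2" "\<phi>2 t = 2" unfolding cls_def by auto
      then have "t \<noteq> v" using agree[of v] v(1) vV1 d1(2)[OF vP(1)] vP by auto
      moreover then have "t \<in> B W" using T(3)[of t] t v(1) vV1 by auto
      ultimately show ?thesis using t T(1) v(1) vV1 BV by auto
    qed
    \<comment> \<open>Two cut vertices of colour 2 would form a triangle with \<open>v\<close>. So a
      path of colour 2 from one side to the other passes the cut in a single vertex, itself a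
      boundary neighbour of \<open>v\<close>, and one of its two parts contradicts (G3) on its
      side.\<close>
    have one: "s = s'" if "s \<in> ?A \<inter> V1 \<inter> V2" "s' \<in> ?A \<inter> V1 \<inter> V2" for s s'
    proof (rule ccontr)
      assume "s \<noteq> s'"
      then have "adj E s s'" "adj E s v" "adj E s' v" using tv that T(1) by auto
      then show False using no_triangle[of s s' v] by auto
    qed
    show ?thesis
      unfolding linkfree_def
    proof (intro allI impI notI)
      fix v' u w assume a: "{x \<in> P. \<delta> x = 1} = {v'}" "u \<in> Q" "adj E u v'" "w \<in> B W" "adj E w v'" "w \<noteq> u"
        and c: "conn ?A u w"
      have v': "v' = v" using a(1) v by auto
      have uwW: "u \<in> V1 \<or> u \<in> V2" "w \<in> V1 \<or> w \<in> V2" using a g(11) B_subset sep(1) by blast+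
      have inv1: "(z \<in> V1 \<longrightarrow> conn (cls V1 \<phi>1 2) x z) \<and>
        (z \<notin> V1 \<longrightarrow> (\<exists>s\<in>?A \<inter> V1 \<inter> V2. conn (cls V1 \<phi>1 2) x s \<and> conn (cls V2 \<phi>2 2) s z))"
        if "x \<in> V1" "conn ?A x z" for x z
        using conn_via_separator[OF that(2,1) gc(4) sep(4)] one unfolding gc(1,2) by blast
      show False
      proof (cases "u \<in> V1")
        case u: True
        show False
        proof (cases "w \<in> V1")
          case True
          then show False using inv1[OF u c] L1[of u w] a u BV(1) v' by auto
        next
          case False
          then obtain s where s: "s \<in> ?A \<inter> V1 \<inter> V2" "conn (cls V1 \<phi>1 2) u s" "conn (cls V2 \<phi>2 2) s w"
            using inv1[OF u c] by auto
          show False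
          proof (cases "u = s")
            case True
            then show False using L2[of u w] a s tv[OF s(1)] BV(2) False uwW v' by auto
          next
            case False
            then show False using L1[of u s] a s tv[OF s(1)] u v' by auto
          qed
        qed
      next
        case u: False
        then have uV2: "u \<in> V2" using uwW by auto
        show False
        proof (cases "w \<in> V1")
          case True
          then obtain s where s: "s \<in> ?A \<inter> V1 \<inter> V2" "conn (cls V2 \<phi>2 2) s u"
            using inv1[OF True conn_sym[OF c]] u by auto
          then show False using L2[of u s] a tv[OF s(1)] u uV2 v' conn_sym by auto
        next
          case False
          have "?A \<subseteq> V2 \<union> V1" using gc(4) by auto
          then have "conn (?A \<inter> V2) u w"
            using conn_via_separator[OF c uV2 _ nocross_sym[OF sep(4)]] one False uwW by blast
          then show False using L2[of u w] a uV2 False uwW BV(2) v' unfolding gc(2) by auto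
        qed
      qed
    qed
  qed
  then show ?thesis using good unfolding solvable_def by auto
qed

text \<open>Together with \<open>P\<close> a component, or a cut vertex and one component of the
  rest, forms the first side of a separation with at most one vertex in the cut.\<close>

lemma biconnected_or_solvable:
  assumes IH: "\<And>W' P' Q' \<delta>' S'. W' \<subset> W \<Longrightarrow> gscene W' P' Q' \<delta>' S' \<Longrightarrow> solvable W' P' Q' \<delta>' S'"
    and gs: "gscene W P Q \<delta> S" and "P \<noteq> {}" and not: "\<not> solvable W P Q \<delta> S"
  shows "\<And>u v. u \<in> W \<Longrightarrow> v \<in> W \<Longrightarrow> conn W u v"
    "\<And>c u v. c \<in> W \<Longrightarrow> u \<in> W - {c} \<Longrightarrow> v \<in> W - {c} \<Longrightarrow> conn (W - {c}) u v"
proof -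
  note g = gsceneD[OF gs]
  obtain p where p: "p \<in> P" using assms(3) by auto
  have pW: "p \<in> W" using p g(10) by auto
  have conn: "conn W p x" if xW: "x \<in> W" for x
  proof (rule ccontr)
    assume n: "\<not> conn W p x"
    let ?V1 = "{y \<in> W. conn W p y}"
    let ?V2 = "W - ?V1"
    have nc: "nocross ?V1 ?V2"
      unfolding nocross_def using conn_step[of _ W] conn_trans[of W p] by blast
    have PV: "P \<subseteq> ?V1"
      using g(4)[OF p] g(10) conn_step[of p W] conn_refl pW by blast
    \<comment> \<open>The exceptional vertex is adjacent to a vertex of \<open>P\<close> and so lies
      in the same component.\<close>
    have SV: "S \<inter> ?V2 = {}"
    proof (rule ccontr)
      assume ne: "S \<inter> ?V2 \<noteq> {}"
      then obtain p1 p2 q where s: "P = {p1, p2}" "S = {q}" "adj E p2 q" using g(13) by blast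
      then have "p2 \<in> ?V1" "q \<in> ?V2" using PV ne by auto
      then show False using nc s(3) unfolding nocross_def by auto
    qed
    have "p \<in> ?V1" using pW conn_refl[of W p] by simp
    then have ss: "?V1 \<subset> W" "?V2 \<subset> W" using xW n pW by blast+
    have "solvable W P Q \<delta> S"
      by (rule separation_solvable[OF IH gs _ ss nc PV, of "{}"]) (use SV in auto)
    then show False using not by auto
  qed
  show "conn W u v" if "u \<in> W" "v \<in> W" for u v
    using conn[OF that(1)] conn[OF that(2)] conn_sym conn_trans by blast
  show "conn (W - {c}) u v" if c: "c \<in> W" "u \<in> W - {c}" "v \<in> W - {c}" for c u v
  proof (rule ccontr)
    assume n: "\<not> conn (W - {c}) u v"
    \<comment> \<open>\<open>r\<close> selects the component of \<open>W - {c}\<close> for the first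
      side: the one that meets \<open>P\<close>, or that of \<open>u\<close> if \<open>P\<close> has
      no vertex besides \<open>c\<close>.\<close>
    define r where "r = (if P \<subseteq> {c} then u else SOME p. p \<in> P \<and> p \<noteq> c)"
    have r: "r \<in> W - {c}" "\<not> P \<subseteq> {c} \<Longrightarrow> r \<in> P"
    proof -
      show rP: "r \<in> P" if nP: "\<not> P \<subseteq> {c}"
      proof -
        have "\<exists>p. p \<in> P \<and> p \<noteq> c" using nP by auto
        then have "(SOME p. p \<in> P \<and> p \<noteq> c) \<in> P" by (rule someI2_ex) auto
        then show ?thesis using nP unfolding r_def by auto
      qed
      show "r \<in> W - {c}"
      proof (cases "P \<subseteq> {c}")
        case False
        then have "\<exists>p. p \<in> P \<and> p \<noteq> c" by auto
        then have "(SOME p. p \<in> P \<and> p \<noteq> c) \<noteq> c" by (rule someI2_ex) auto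
        then show ?thesis using rP[OF False] False g(10) unfolding r_def by auto
      qed (use c r_def in auto)
    qed
    define U where "U = {x \<in> W - {c}. conn (W - {c}) r x}"
    have rU: "r \<in> U" unfolding U_def using r conn_refl by auto
    have Uc: "U \<subseteq> W" "c \<notin> U" unfolding U_def by auto
    have Ustep: "z \<in> U" if "y \<in> U" "adj E y z" "z \<in> W" "z \<noteq> c" for y z
      using that conn_step[of y "W - {c}" z] conn_trans unfolding U_def by blast
    have "u \<notin> U \<or> v \<notin> U"
      using n conn_sym conn_trans unfolding U_def by blast
    then obtain y where y: "y \<in> W - {c}" "y \<notin> U" using c by auto
    let ?V1 = "insert c U" and ?V2 = "W - U"
    have int: "?V1 \<inter> ?V2 = {c}" using c Uc by auto
    have nc: "nocross ?V1 ?V2"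
      unfolding nocross_def using Ustep c(1) Uc by blast
    have PV: "P \<subseteq> ?V1"
    proof (cases "P \<subseteq> {c}")
      case False
      then show ?thesis using r(2) g(4,10) Ustep rU by blast
    qed auto
    have cB: "c \<in> B ?V2"
    proof (cases "P \<subseteq> {c}")
      case True
      then have "c \<in> B W" using assms(3) g(2) by auto
      then show ?thesis using B_mono[of ?V2 W c] g(1) Uc c by auto
    next
      \<comment> \<open>Here \<open>c\<close> need not be a boundary vertex of \<open>W\<close>. But
        with \<open>U\<close> deleted the boundary vertex \<open>r\<close> lies in the outer face,
        and this face reaches \<open>c\<close> along a walk from \<open>r\<close> to
        \<open>c\<close>.\<close>
      case False
      then have rB: "r \<in> B W" using r(2) g(2) by auto
      have "r \<in> Out ?V2" by (rule B_imp_Out[OF _ g(1) rB]) (use rU in auto)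
      have "conn W r c" using conn[of r] conn[OF c(1)] r conn_sym conn_trans by blast
      show ?thesis
      proof (rule ccontr)
        assume ncB: "c \<notin> B ?V2"
        from \<open>conn W r c\<close> have "c \<in> U \<and> c \<in> Out ?V2"
        proof (induction rule: conn_induct)
          case refl
          then show ?case using rU \<open>r \<in> Out ?V2\<close> by simp
        next
          case (step y z)
          have yV: "?V2 \<subseteq> V" "y \<in> V" "y \<in> U" "y \<in> Out ?V2" using g(1) step by auto
          show ?case
          proof (cases "z \<in> U")
            case True
            then show ?thesis using expose(1)[OF yV(1,2,4) step(4)] by auto
          next
            case False
            then have "z = c" using Ustep[OF yV(3) step(4)] step(3) by auto
            then show ?thesis using expose(2)[OF yV(1,2,4) step(4)] False step(3) ncB by auto
          qed
        qed
        then show False using Uc by simp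
      qed
    qed
    have SV: "S \<inter> ?V2 = {} \<or> (\<exists>q. S = {q} \<and> adj E c q) \<or> S = {c}"
    proof (cases "S \<inter> ?V2 = {}")
      case False
      then obtain p1 p2 q where s: "P = {p1, p2}" "S = {q}" "adj E p2 q" using g(13) by blast
      then have p2: "p2 \<in> ?V1" "q \<in> ?V2" using PV False by auto
      show ?thesis
      proof (cases "q \<in> ?V1")
        case True
        then show ?thesis using int p2 s by blast
      next
        case False
        then have "p2 \<in> ?V2" using nocrossD[OF nc s(3) p2] by auto
        then show ?thesis using int p2 s by blast
      qed
    qed simp
    define P2 where "P2 = (?V1 \<inter> ?V2 - (Q - S)) \<union> (S \<inter> ?V2)"
    have P2: "P2 \<subseteq> {c} \<or> (\<exists>q. P2 \<subseteq> {c, q} \<and> adj E c q)"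
      using SV unfolding P2_def int by blast
    then have cardP2: "card P2 \<le> 2"
    proof
      assume "P2 \<subseteq> {c}"
      then have "card P2 \<le> card {c}" by (intro card_mono) auto
      then show ?thesis by simp
    next
      assume "\<exists>q. P2 \<subseteq> {c, q} \<and> adj E c q"
      then obtain q where "P2 \<subseteq> {c, q}" by auto
      then have "card P2 \<le> card {c, q}" by (intro card_mono) auto
      also have "\<dots> \<le> 2" by (simp add: card_insert_if)
      finally show ?thesis .
    qed
    have clique: "adj E x y" if "x \<in> P2" "y \<in> P2" "x \<noteq> y" for x y
      using P2 that adj_sym by blast
    have "solvable W P Q \<delta> S"
    proof (rule separation_solvable[OF IH gs, of ?V1 ?V2 P2])
      show "W = ?V1 \<union> ?V2" using c Uc by auto
      show "?V1 \<subset> W" using c Uc y by auto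
      show "?V2 \<subset> W" using rU Uc by auto
      show "nocross ?V1 ?V2" "P \<subseteq> ?V1" using nc PV by auto
      show "?V1 \<inter> ?V2 \<subseteq> B ?V2" unfolding int using cB by auto
      show "adj E x y" if "x \<in> ?V1 \<inter> ?V2" "y \<in> ?V1 \<inter> ?V2" "x \<noteq> y" for x y
        using that unfolding int by auto
      show "t \<in> B W \<or> ?V1 \<inter> ?V2 = {t}" if "t \<in> ?V1 \<inter> ?V2" for t
        using that unfolding int by auto
      show "P2 = (?V1 \<inter> ?V2 - (Q - S)) \<union> (S \<inter> ?V2)" by (rule P2_def)
    qed (use cardP2 clique in auto)
    then show False using not by auto
  qed
qed

text \<open>\<open>P\<close> is a clique and lies in one closed side of the chord, which is coloured
  first. The obstacle is an exceptional vertex strictly on the other side: its neighbour of colour 2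
  in \<open>P\<close> is then an end of the chord, and the chord with that vertex would make three
  precoloured vertices. Hypothesis \<open>H\<close> puts the other end of the chord into
  \<open>Q\<close>, so that it need not be precoloured.\<close>

lemma chord_solvable:
  assumes IH: "\<And>W' P' Q' \<delta>' S'. W' \<subset> W \<Longrightarrow> gscene W' P' Q' \<delta>' S' \<Longrightarrow> solvable W' P' Q' \<delta>' S'"
    and gs: "gscene W P Q \<delta> S"
    and rd: "rdisc W ks" "ks = us @ a # vs @ b # ws" "vs \<noteq> []" "us @ ws \<noteq> []" and ab: "adj E a b"
    and H: "\<And>p. P \<noteq> {a, b} \<Longrightarrow> S \<noteq> {} \<Longrightarrow> p \<in> P \<Longrightarrow> \<delta> p = 2 \<Longrightarrow> p \<in> {a, b} \<Longrightarrow> {a, b} - {p} \<subseteq> Q"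
  shows "solvable W P Q \<delta> S"
proof -
  note g = gsceneD[OF gs]
  let ?x = "a # vs @ [b]" and ?y = "rev (b # ws @ us @ [a])"
  have disc: "disc W ?x ?y a b" by (rule rdisc_disc[OF rd(1,2)])
  have ring: "ring W ks" using rd(1) unfolding rdisc_def by auto
  have d: "distinct ks" "set ks \<subseteq> W" using ring unfolding ring_def by auto
  have th: "theta ?x ?y a b" using disc unfolding disc_def by auto
  note p = theta_pth[OF th]
  have abn: "a \<noteq> b" using adjD(3)[OF ab] .
  have pr: "pth V [a, b]" using ab adjD abn unfolding pth_def by auto
  have nx: "{a, b} \<notin> es ?x" using es_ends[OF p(1)] rd(3) by (cases vs) auto
  have ny: "{a, b} \<notin> es ?y"
  proof -
    have "length ?y \<ge> 3" using rd(4) by (cases us; cases ws) auto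
    then show ?thesis using es_ends[OF p(2)] by (simp add: hd_rev last_rev)
  qed
  have tx: "theta ?x [a, b] a b" and ty: "theta ?y [a, b] a b"
    using p pr abn nx ny unfolding theta_def by (auto simp: hd_rev last_rev)
  have rW: "set [a, b] \<subseteq> W" using d rd(2) by auto
  note part = cut_partition[OF disc tx ty rW]
  let ?I = "side W ?x [a, b] a b" and ?J = "side W ?y [a, b] a b"
  have nc: "\<not> adj E x y" if "x \<in> ?I" "y \<in> ?J" for x y using cut_edge[OF disc tx ty rW that] .
  have abB: "a \<in> B W" "b \<in> B W" using B_rdisc[OF rd(1)] rd(2) by auto
  have Ine: "?I \<noteq> {}"
  proof -
    obtain v where "v \<in> set vs" using rd(3) by (cases vs) auto
    then have "v \<in> set ?x - {a, b}" using d(1) rd(2) by auto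
    then show ?thesis unfolding side_def by blast
  qed
  have Jne: "?J \<noteq> {}"
  proof -
    obtain v where "v \<in> set us \<union> set ws" using rd(4) by (cases us; cases ws) auto
    then have "v \<in> set ?y - {a, b}" using d(1) rd(2) by auto
    then show ?thesis unfolding side_def by blast
  qed
  have key: "solvable W P Q \<delta> S"
    if X: "W = {a, b} \<union> X \<union> Y" "X \<inter> Y = {}" "X \<inter> {a, b} = {}" "Y \<inter> {a, b} = {}" "X \<noteq> {}" "Y \<noteq> {}"
      "\<And>x y. x \<in> X \<Longrightarrow> y \<in> Y \<Longrightarrow> \<not> adj E x y" and P: "P \<subseteq> {a, b} \<union> X" and SY: "P = {a, b} \<Longrightarrow> S \<inter> Y = {}" for X Y
  proof -
    let ?V1 = "{a, b} \<union> X" and ?V2 = "{a, b} \<union> Y"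
    have int: "?V1 \<inter> ?V2 = {a, b}" using X by auto
    have ncr: "nocross ?V1 ?V2" unfolding nocross_def using X(7) by auto
    define P2 where "P2 = (?V1 \<inter> ?V2 - (Q - S)) \<union> (S \<inter> ?V2)"
    have "\<exists>x y. P2 \<subseteq> {x, y} \<and> adj E x y"
    proof (cases "S \<inter> Y = {}")
      case True
      then show ?thesis using ab unfolding P2_def int by (intro exI[of _ a] exI[of _ b]) auto
    next
      case False
      then obtain p1 p2 q where s: "P = {p1, p2}" "\<delta> p2 = 2" "S = {q}" "adj E p2 q" using g(13) by blast
      have q: "q \<in> Y" "q \<notin> ?V1" using False s X by auto
      then have p2: "p2 \<in> {a, b}" using nocrossD[OF ncr s(4)] P s int by blast
      have "P \<noteq> {a, b}" using SY False by auto
      then have "{a, b} - {p2} \<subseteq> Q" using H[of p2] s p2 by auto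
      then have "P2 \<subseteq> {p2, q}" using s q unfolding P2_def int by auto
      then show ?thesis using s by blast
    qed
    then obtain x y where xy: "P2 \<subseteq> {x, y}" "adj E x y" by auto
    have "card P2 \<le> card {x, y}" using xy by (intro card_mono) auto
    also have "\<dots> \<le> 2" by (simp add: card_insert_if)
    finally have cardP2: "card P2 \<le> 2" .
    show ?thesis
    proof (rule separation_solvable[OF IH gs, of ?V1 ?V2 P2])
      show "W = ?V1 \<union> ?V2" using X by auto
      obtain x y where "x \<in> X" "y \<in> Y" using X by auto
      then have "x \<in> W - ?V2" "y \<in> W - ?V1" using X by auto
      then show "?V1 \<subset> W" "?V2 \<subset> W" using X(1) by blast+
      show "nocross ?V1 ?V2" "P \<subseteq> ?V1" "card P2 \<le> 2" using ncr P cardP2 by auto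
      show "?V1 \<inter> ?V2 \<subseteq> B ?V2"
        unfolding int using B_mono[of ?V2 W] abB g(1) X(1) by auto
      show "adj E u v" if "u \<in> ?V1 \<inter> ?V2" "v \<in> ?V1 \<inter> ?V2" "u \<noteq> v" for u v
        using that ab adj_sym unfolding int by auto
      show "t \<in> B W \<or> ?V1 \<inter> ?V2 = {t}" if "t \<in> ?V1 \<inter> ?V2" for t
        using that abB unfolding int by auto
      show "P2 = (?V1 \<inter> ?V2 - (Q - S)) \<union> (S \<inter> ?V2)" by (rule P2_def)
      show "adj E u v" if "u \<in> P2" "v \<in> P2" "u \<noteq> v" for u v
        using that xy adj_sym by blast
    qed
  qed
  have WIJ: "W = {a, b} \<union> ?I \<union> ?J" "W = {a, b} \<union> ?J \<union> ?I" using part(1) by auto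
  have dis: "?I \<inter> ?J = {}" "?J \<inter> ?I = {}" "?I \<inter> {a, b} = {}" "?J \<inter> {a, b} = {}" using part(2-4) by auto
  have ncJ: "\<not> adj E x y" if "x \<in> ?J" "y \<in> ?I" for x y using nc[OF that(2,1)] adj_sym by auto
  show ?thesis
  proof (cases "P = {a, b}")
    case True
    \<comment> \<open>If the chord is the precoloured edge, either side may come first; the side
      without the exceptional vertex is taken as the second.\<close>
    have "S \<inter> ?J = {} \<or> S \<inter> ?I = {}" using g(13) dis by (cases "S = {}") auto
    then show ?thesis
    proof
      assume "S \<inter> ?J = {}"
      then show ?thesis using key[of ?I ?J, OF WIJ(1) dis(1,3,4) Ine Jne nc] True by auto
    next
      assume "S \<inter> ?I = {}"
      then show ?thesis using key[of ?J ?I, OF WIJ(2) dis(2,4,3) Jne Ine ncJ] True by auto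
    qed
  next
    case False
    have "P \<subseteq> {a, b} \<union> ?I \<or> P \<subseteq> {a, b} \<union> ?J"
    proof (rule ccontr)
      assume "\<not> ?thesis"
      then obtain x y where xy: "x \<in> P" "y \<in> P" "x \<in> ?J" "y \<in> ?I" using g(10) WIJ(1) by blast
      then have "x \<noteq> y" using dis by auto
      then show False using g(4)[OF xy(1,2)] ncJ[OF xy(3,4)] by auto
    qed
    then show ?thesis
      using key[of ?I ?J, OF WIJ(1) dis(1,3,4) Ine Jne nc] key[of ?J ?I, OF WIJ(2) dis(2,4,3) Jne Ine ncJ] False
      by auto
  qed
qed

text \<open>After the side of \<open>P\<close> has been coloured, the other one is a scene with the
  precoloured edge \<open>d t\<close>, while \<open>q\<close> gets its colour 2 as a member of
  \<open>Q\<close>. This is why one end of the path must be in \<open>Q\<close> and the other must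
  not.\<close>

lemma two_chord_solvable:
  assumes IH: "\<And>W' P' Q' \<delta>' S'. W' \<subset> W \<Longrightarrow> gscene W' P' Q' \<delta>' S' \<Longrightarrow> solvable W' P' Q' \<delta>' S'"
    and gs: "gscene W P Q \<delta> S" and "P \<noteq> {}"
    and rd: "rdisc W ks" "ks = us @ a # vs @ b # ws"
    and t: "t \<in> W" "t \<notin> set ks" "adj E a t" "adj E t b"
    and dq: "{d, q} = {a, b}" "d \<notin> P" "d \<notin> Q" "q \<in> Q" "q \<notin> S"
  shows "solvable W P Q \<delta> S"
proof -
  note g = gsceneD[OF gs]
  let ?x = "a # vs @ [b]" and ?y = "rev (b # ws @ us @ [a])" and ?r = "[a, t, b]"
  have disc: "disc W ?x ?y a b" by (rule rdisc_disc[OF rd(1,2)])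
  have ring: "ring W ks" using rd(1) unfolding rdisc_def by auto
  have d: "distinct ks" "set ks \<subseteq> W" using ring unfolding ring_def by auto
  have th: "theta ?x ?y a b" using disc unfolding disc_def by auto
  note p = theta_pth[OF th]
  have abn: "a \<noteq> b" using d(1) rd(2) by auto
  have nab: "\<not> adj E a b" using no_triangle[of a t b] t by auto
  then have abE: "{a, b} \<notin> E" unfolding adj_def .
  have pr: "pth V ?r" using t adjD[OF t(3)] adjD[OF t(4)] abn unfolding pth_def by auto
  have kxy: "set ?x \<subseteq> set ks" "set ?y \<subseteq> set ks" using rd(2) by auto
  have tx: "theta ?x ?r a b" and ty: "theta ?y ?r a b"
  proof -
    have i: "set ?x \<inter> set ?r = {a, b}" "set ?y \<inter> set ?r = {a, b}" using kxy t(2) by auto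
    have n: "{a, b} \<notin> es ?r" using abE pth_edges[OF pr] by auto
    have "es ?x \<inter> es ?r = {}" by (rule es_Int_disjoint[OF i(1)]) (use n p(1) in \<open>auto simp: pth_def\<close>)
    moreover have "es ?y \<inter> es ?r = {}" by (rule es_Int_disjoint[OF i(2)]) (use n p(2) in \<open>simp_all add: pth_def\<close>)
    ultimately show "theta ?x ?r a b" "theta ?y ?r a b"
      using p pr abn i unfolding theta_def by (simp_all add: hd_rev last_rev)
  qed
  have rW: "set ?r \<subseteq> W" using d rd(2) t(1) by auto
  have disc': "disc W ?y ?x a b" using disc theta_sym unfolding disc_def by (simp add: Un_commute)
  have abB: "B W = set ks" by (rule B_rdisc[OF rd(1)])
  have ind: "e \<in> es ?r" if e: "e \<in> E" "e \<subseteq> set ?r" for e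
  proof -
    obtain x y where xy: "x \<noteq> y" "e = {x, y}" using e(1) by (rule edgeE)
    then show ?thesis using e abE by (auto simp: insert_commute doubleton_eq_iff)
  qed
  have T: "t \<notin> P" "t \<notin> Q" using g(2,5) abB t(2) by auto
  have qP: "q \<notin> P" using dq(4) g(6) by auto
  have rdq: "set ?r = {d, t, q}" using dq(1) by auto
  have dqadj: "adj E d t" "adj E t q" "d \<noteq> q" "q \<noteq> t" "d \<noteq> t"
  proof -
    have "a = d \<and> b = q \<or> a = q \<and> b = d" using dq(1) by (auto simp: doubleton_eq_iff)
    then show "adj E d t" "adj E t q" "d \<noteq> q" "q \<noteq> t" "d \<noteq> t" using t abn adj_sym adjD(3)[OF t(3)] adjD(3)[OF t(4)] by auto
  qed
  have key: "solvable W P Q \<delta> S"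
    if X: "W = set ?r \<union> X \<union> Y" "X \<inter> Y = {}" "X \<inter> set ?r = {}" "Y \<inter> set ?r = {}" "Y \<noteq> {}"
      "\<And>x y. x \<in> X \<Longrightarrow> y \<in> Y \<Longrightarrow> \<not> adj E x y" and rB: "set ?r \<subseteq> B (set ?r \<union> Y)" and p: "p \<in> P" "p \<in> X" for X Y p
  proof -
    let ?V1 = "set ?r \<union> X" and ?V2 = "set ?r \<union> Y"
    have int: "?V1 \<inter> ?V2 = {d, t, q}" using X(2-4) rdq by blast
    have nc: "nocross ?V1 ?V2" unfolding nocross_def using X(6) by auto
    have sub: "?V1 \<subset> W" "?V2 \<subset> W"
    proof -
      obtain y where "y \<in> Y" using X(5) by auto
      then have "y \<in> W - ?V1" "p \<in> W - ?V2" using X p(2) by auto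
      then show "?V1 \<subset> W" "?V2 \<subset> W" using X(1) by blast+
    qed
    have PX: "P \<subseteq> X"
    proof
      fix x assume x: "x \<in> P"
      then have "x \<notin> set ?r" using dq(2) T qP rdq by auto
      moreover have "x \<notin> Y" using X(6)[OF p(2), of x] g(4)[OF p(1) x] X(2) p(2) by auto
      ultimately show "x \<in> X" using x g(10) X(1) by auto
    qed
    have SX: "S \<subseteq> X"
    proof
      fix x assume x: "x \<in> S"
      then obtain p2 where p2: "p2 \<in> P" "adj E p2 x" using g(13) by auto
      have "x \<notin> set ?r" using x dq(3,5) T g(9) rdq by auto
      moreover have "x \<notin> Y" using X(6)[of p2 x] p2 PX by auto
      ultimately show "x \<in> X" using x g(9,11) X(1) by auto
    qed
    have W: "W = ?V1 \<union> ?V2" using X(1) by auto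
    have BV: "x \<in> B ?V2" if "x \<in> B W" "x \<in> ?V2" for x
      using B_mono[of ?V2 W x] that sub g(1) by auto
    have BV1: "x \<in> B ?V1" if "x \<in> B W" "x \<in> ?V1" for x
      using B_mono[of ?V1 W x] that sub g(1) by auto
    have gs1: "gscene ?V1 P (Q \<inter> ?V1) \<delta> S"
      unfolding gscene_def
    proof (intro conjI)
      show "P \<subseteq> B ?V1" using g(2) PX BV1 by auto
      show "Q \<inter> ?V1 \<subseteq> B ?V1 - P" using g(5,6) BV1 by auto
      show "?V1 \<subseteq> V" using g(1) sub by auto
      show "card P \<le> 2" by (rule g(3))
      show "\<forall>x\<in>P. \<forall>y\<in>P. x \<noteq> y \<longrightarrow> adj E x y" using g(4) by blast
      show "\<forall>x\<in>Q \<inter> ?V1 - S. \<forall>y\<in>Q \<inter> ?V1 - S. \<not> adj E x y" using g(7) by blast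
      show "\<forall>v\<in>P. \<delta> v = 1 \<or> \<delta> v = 2" using g(8) by blast
      show "S = {} \<or> (\<exists>p1 p2 q. P = {p1, p2} \<and> p1 \<noteq> p2 \<and> \<delta> p1 = 1 \<and> \<delta> p2 = 2 \<and> S = {q} \<and> q \<in> Q \<inter> ?V1 \<and> adj E p2 q)"
        using g(13) SX by fastforce
    qed
    obtain \<phi>1 where \<phi>1: "good ?V1 P (Q \<inter> ?V1) \<delta> \<phi>1" "S = {} \<Longrightarrow> linkfree ?V1 P (Q \<inter> ?V1) \<delta> \<phi>1"
      using IH[OF sub(1) gs1] unfolding solvable_def by blast
    note d1 = goodD[OF \<phi>1(1)]
    have V2n: "d \<in> ?V1" "t \<in> ?V1" "q \<in> ?V1" "d \<in> ?V2" "t \<in> ?V2" "q \<in> ?V2" using int by auto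
    have rdB: "d \<in> B ?V2" "t \<in> B ?V2"
    proof -
      have "d \<in> set ?r" "t \<in> set ?r" unfolding rdq by simp_all
      then show "d \<in> B ?V2" "t \<in> B ?V2" using rB by blast+
    qed
    have gs2: "gscene ?V2 {d, t} (Q \<inter> ?V2) \<phi>1 {}"
    proof (rule normal_sceneI)
      show "?V2 \<subseteq> V" using g(1) sub by auto
      show "{d, t} \<subseteq> B ?V2" using rdB by simp
      show "card {d, t} \<le> 2" by (simp add: card_insert_if)
      show "adj E x y" if "x \<in> {d, t}" "y \<in> {d, t}" "x \<noteq> y" for x y using that dqadj adj_sym by auto
      show "Q \<inter> ?V2 \<subseteq> B ?V2" using g(5) BV by auto
      show "Q \<inter> ?V2 \<inter> {d, t} = {}" using dq(3) T by auto
      show "\<not> adj E x y" if "x \<in> Q \<inter> ?V2" "y \<in> Q \<inter> ?V2" for x y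
      proof -
        have "S \<inter> ?V2 = {}" using SX X(2,3) by auto
        then show ?thesis using g(7)[of x y] that by auto
      qed
      show "\<phi>1 v = 1 \<or> \<phi>1 v = 2" if "v \<in> {d, t}" for v using d1(1)[OF V2n(1)] d1(1)[OF V2n(2)] that by blast
    qed
    obtain \<phi>2 where \<phi>2: "good ?V2 {d, t} (Q \<inter> ?V2) \<phi>1 \<phi>2" "linkfree ?V2 {d, t} (Q \<inter> ?V2) \<phi>1 \<phi>2"
      using IH[OF sub(2) gs2] unfolding solvable_def by blast
    note d2 = goodD[OF \<phi>2(1)]
    have q2: "\<phi>1 q = 2" "\<phi>2 q = 2" using d1(3)[of q] d2(3)[of q] dq(4) V2n by auto
    have dt2: "\<phi>2 d = \<phi>1 d" "\<phi>2 t = \<phi>1 t" using d2(2) by auto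
    have ext: "extends W ?V1 ?V2 Q \<phi>1 \<phi>2"
      unfolding extends_def int
    proof (intro conjI ballI impI)
      fix v assume "v \<in> {d, t, q}" then show "\<phi>2 v = \<phi>1 v" using q2 dt2 by auto
    next
      fix v assume v: "v \<in> (?V2 - ?V1) \<inter> B W" "\<phi>2 v = 1"
      then show "card (ones ?V2 \<phi>2 v) \<le> 2" using d2(8)[of v] BV[of v] V2n by blast
    next
      fix s u assume a: "s \<in> {d, t, q}" "u \<in> ?V2 - ?V1" "\<phi>2 s = 1" "adj E u s"
      have "s \<in> {d, t}" using a(1,3) q2 by auto
      moreover have "u \<notin> {d, t}" using a(2) V2n by blast
      moreover have "\<phi>1 s = 1" using \<open>s \<in> {d, t}\<close> a(3) dt2 by auto
      ultimately show "\<phi>2 u = 2" using d2(7)[of s u] a(2,4) by blast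
    next
      fix s s' assume s: "s \<in> {d, t, q}" "s' \<in> {d, t, q}" "\<phi>2 s = 2" "\<phi>2 s' = 2" "s \<noteq> s'"
        and c: "conn (cls ?V2 \<phi>2 2) s s'"
      let ?C = "cls {d, t, q} \<phi>2 2"
      have dt: "\<phi>2 d = 2 \<Longrightarrow> \<phi>2 t = 2 \<Longrightarrow> conn ?C d t" and tq: "\<phi>2 t = 2 \<Longrightarrow> conn ?C t q"
        using dqadj q2 by (auto intro!: cls_edge)
      show "conn ?C s s'"
      proof (cases "\<phi>2 t = 2")
        case True
        then have "conn ?C t x" if "x \<in> {d, t, q}" "\<phi>2 x = 2" for x
          using that dt[THEN conn_sym] tq conn_refl by auto
        then have "conn ?C t s" "conn ?C t s'" using s by blast+
        then show ?thesis using conn_trans[OF conn_sym[of ?C t s], of s'] by simp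
      next
        case False
        \<comment> \<open>With colours 2, 1, 2 on the cut, a connection of \<open>d\<close> and
          \<open>q\<close> in colour 2 on the second side is excluded by (G3) for \<open>t\<close>,
          the only precoloured vertex of colour 1 there.\<close>
        then have t1: "\<phi>2 t = 1" using d2(1)[of t] V2n by auto
        have sd: "{s, s'} = {d, q}" using s False by auto
        then have "d = s \<or> d = s'" by (auto simp: doubleton_eq_iff)
        then have d2': "\<phi>1 d = 2" using s(3,4) dt2(1) by metis
        have cdq: "conn (cls ?V2 \<phi>2 2) q d"
        proof -
          have "s = q \<and> s' = d \<or> s = d \<and> s' = q" using sd by (auto simp: doubleton_eq_iff)
          then show ?thesis using c conn_sym by blast
        qed
        have "{x \<in> {d, t}. \<phi>1 x = 1} = {t}" using t1 dt2 d2' by auto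
        moreover have "q \<in> Q \<inter> ?V2" using dq(4) V2n(6) by simp
        moreover have "adj E q t" using adj_sym[of t q] dqadj(2) by simp
        ultimately have "\<not> conn (cls ?V2 \<phi>2 2) q d"
          using \<phi>2(2)[unfolded linkfree_def, rule_format, of t q d] rdB(1) dqadj(1,3) by simp
        then show ?thesis using cdq by simp
      qed
    qed (use d2 in blast)+
    have PV1: "P \<subseteq> ?V1" using PX by auto
    note gl = W g(1) nc PV1 g(11) \<phi>1(1) ext
    have "linkfree W P Q \<delta> (glue ?V1 \<phi>1 \<phi>2)" if "S = {}"
    proof (rule glue_linkfree[OF gl \<phi>1(2)[OF that]])
      fix v u assume v: "{x \<in> P. \<delta> x = 1} = {v}" "u \<in> Q \<union> B W" "adj E u v"
      then have "v \<in> X" "u \<in> W" using PX g(11) B_subset[of W] by auto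
      then show "u \<in> ?V1" using X(1) X(6)[of v u] v(3) adj_sym by auto
    qed
    then show ?thesis using glue_good[OF gl] unfolding solvable_def by blast
  qed
  note px = cut_partition[OF disc tx ty rW] and py = cut_partition[OF disc' ty tx rW]
  have nx: "side W ?x ?r a b \<noteq> {}"
  proof -
    have "vs \<noteq> []" using nab p(1) unfolding pth_def by auto
    then obtain v where "v \<in> set vs" by (cases vs) auto
    then have "v \<in> set ?x - {a, b}" using d(1) rd(2) by auto
    then show ?thesis unfolding side_def by blast
  qed
  have ny: "side W ?y ?r a b \<noteq> {}"
  proof -
    have "ws @ us \<noteq> []"
    proof
      assume "ws @ us = []"
      then have "successively (adj E) (rev [b, a])" using p(2) unfolding pth_def by auto
      then show False using nab by simp
    qed
    then obtain v where "v \<in> set ws \<union> set us" by (cases ws; cases us) auto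
    then have "v \<in> set ?y - {a, b}" using d(1) rd(2) by auto
    then show ?thesis unfolding side_def by blast
  qed
  have abx: "{a, b} \<notin> es ?x" "{a, b} \<notin> es ?y" using abE pth_edges[OF p(1)] pth_edges[OF p(2)] by auto
  obtain p0 where p0: "p0 \<in> P" using assms(3) by auto
  then have "p0 \<notin> set ?r" using dq(2) T qP rdq by auto
  then have "p0 \<in> side W ?x ?r a b \<or> p0 \<in> side W ?y ?r a b" using px(1) p0 g(10) by blast
  then show ?thesis
  proof
    assume p0x: "p0 \<in> side W ?x ?r a b"
    have rB: "set ?r \<subseteq> B (set ?r \<union> side W ?y ?r a b)"
      by (rule cut_boundary[OF disc tx ty rW _ abx(1)]) (use ind in blast)
    show ?thesis
      by (rule key[OF px(1,2,3,4) ny _ rB p0 p0x]) (rule cut_edge[OF disc tx ty rW])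
  next
    assume p0y: "p0 \<in> side W ?y ?r a b"
    have rB: "set ?r \<subseteq> B (set ?r \<union> side W ?x ?r a b)"
      by (rule cut_boundary[OF disc' ty tx rW _ abx(2)]) (use ind in blast)
    show ?thesis
      by (rule key[OF py(1,2,3,4) nx _ rB p0 p0y]) (rule cut_edge[OF disc' ty tx rW])
  qed
qed

section \<open>Four-cycles that enclose vertices\<close>

lemma card_doubleton_le: "card {x, y} \<le> 2"
  by (simp add: card_insert_if)

lemma recolour_isolated:
  assumes "d \<in> U" and n: "\<And>u. u \<in> U \<Longrightarrow> adj E d u \<Longrightarrow> \<phi> u = 2"
    and f: "forest (cls (U - {d}) \<phi> 1)" "forest (cls (U - {d}) \<phi> 2)"
  defines "\<phi>' \<equiv> \<phi>(d := 1)"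
  shows "forest (cls U \<phi>' 1)" "forest (cls U \<phi>' 2)" "cls U \<phi>' 2 = cls (U - {d}) \<phi> 2"
    "ones U \<phi>' d = {}" "v \<in> U \<Longrightarrow> v \<noteq> d \<Longrightarrow> \<phi> v = 1 \<Longrightarrow> ones U \<phi>' v = ones (U - {d}) \<phi> v"
proof -
  have dd: "\<not> adj E d d" using adjD by blast
  show c2: "cls U \<phi>' 2 = cls (U - {d}) \<phi> 2" unfolding cls_def \<phi>'_def by auto
  then show "forest (cls U \<phi>' 2)" using f by simp
  have "cls U \<phi>' 1 = insert d (cls (U - {d}) \<phi> 1)" using assms(1) unfolding cls_def \<phi>'_def by auto
  moreover have "forest (insert d (cls (U - {d}) \<phi> 1))"
    by (rule forest_insert_leaf[OF f(1)]) (use n in \<open>auto simp: cls_def\<close>)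
  ultimately show "forest (cls U \<phi>' 1)" by simp
  show "ones U \<phi>' d = {}" unfolding ones_def \<phi>'_def using n dd adj_sym by auto
  show "ones U \<phi>' v = ones (U - {d}) \<phi> v" if "v \<in> U" "v \<noteq> d" "\<phi> v = 1"
    unfolding ones_def \<phi>'_def using n[OF that(1)] that by auto
qed

text \<open>The form that \<open>extends\<close> takes for a four-cycle \<open>C\<close> and its
  inside: no vertex strictly inside is in \<open>Q\<close> or on the outer boundary, so the
  corresponding conditions do not occur.\<close>

definition cext_by :: "complex set \<Rightarrow> complex set \<Rightarrow> (complex \<Rightarrow> nat) \<Rightarrow> (complex \<Rightarrow> nat) \<Rightarrow> bool" where
  "cext_by U C \<psi> \<phi> \<longleftrightarrow> (\<forall>v\<in>U. \<phi> v = 1 \<or> \<phi> v = 2) \<and> (\<forall>v\<in>C. \<phi> v = \<psi> v) \<and>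
     forest (cls U \<phi> 1) \<and> forest (cls U \<phi> 2) \<and> (\<forall>v\<in>U - C. \<phi> v = 1 \<longrightarrow> card (ones U \<phi> v) \<le> 3) \<and>
     (\<forall>s\<in>C. \<forall>u\<in>U - C. \<phi> s = 1 \<longrightarrow> adj E u s \<longrightarrow> \<phi> u = 2) \<and>
     (\<forall>s\<in>C. \<forall>s'\<in>C. \<phi> s = 2 \<longrightarrow> \<phi> s' = 2 \<longrightarrow> s \<noteq> s' \<longrightarrow> conn (cls U \<phi> 2) s s' \<longrightarrow> conn (cls C \<phi> 2) s s')"

definition cext :: "complex set \<Rightarrow> complex set \<Rightarrow> (complex \<Rightarrow> nat) \<Rightarrow> bool" where
  "cext U C \<psi> \<longleftrightarrow> (\<exists>\<phi>. cext_by U C \<psi> \<phi>)"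

text \<open>Up to rotation these are all non-constant patterns. For 1122 the edge of colour 1 is
  precoloured, and (G2) gives 2 to the other two vertices. In the remaining cases a vertex of colour
  1 is deleted, its neighbours are put into \<open>Q\<close>, an edge of the four-cycle is
  precoloured according to the pattern, and the vertex returns with colour 1: isolated in its class,
  or as a leaf in the case 1112.\<close>

lemma cext_cycle:
  assumes IH: "\<And>W' P' Q' \<delta>'. W' \<subseteq> U \<Longrightarrow> gscene W' P' Q' \<delta>' {} \<Longrightarrow> solvable W' P' Q' \<delta>' {}"
    and U: "U \<subseteq> V" "{c1, c2, c3, c4} \<subseteq> B U" and d: "distinct [c1, c2, c3, c4]"
    and e: "adj E c1 c2" "adj E c2 c3" "adj E c3 c4" "adj E c4 c1"
  shows "\<psi> c1 = 1 \<Longrightarrow> \<psi> c2 = 2 \<Longrightarrow> \<psi> c3 = 2 \<Longrightarrow> \<psi> c4 = 2 \<Longrightarrow> cext U {c1, c2, c3, c4} \<psi>"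
    and "\<psi> c1 = 1 \<Longrightarrow> \<psi> c2 = 1 \<Longrightarrow> \<psi> c3 = 2 \<Longrightarrow> \<psi> c4 = 2 \<Longrightarrow> cext U {c1, c2, c3, c4} \<psi>"
    and "\<psi> c1 = 1 \<Longrightarrow> \<psi> c2 = 2 \<Longrightarrow> \<psi> c3 = 1 \<Longrightarrow> \<psi> c4 = 2 \<Longrightarrow> cext U {c1, c2, c3, c4} \<psi>"
    and "\<psi> c1 = 1 \<Longrightarrow> \<psi> c2 = 1 \<Longrightarrow> \<psi> c3 = 1 \<Longrightarrow> \<psi> c4 = 2 \<Longrightarrow> cext U {c1, c2, c3, c4} \<psi>"
proof -
  let ?C = "{c1, c2, c3, c4}"
  have cU: "c1 \<in> U" "c2 \<in> U" "c3 \<in> U" "c4 \<in> U" and cB: "c1 \<in> B U" "c2 \<in> B U" "c3 \<in> B U" "c4 \<in> B U"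
    using U(2) B_subset[of U] by auto
  have e': "adj E c2 c1" "adj E c3 c2" "adj E c4 c3" "adj E c1 c4" using e adj_sym by auto
  have dn: "c1 \<noteq> c2" "c1 \<noteq> c3" "c1 \<noteq> c4" "c2 \<noteq> c3" "c2 \<noteq> c4" "c3 \<noteq> c4" using d by auto
  have n13: "\<not> adj E c1 c3" "\<not> adj E c3 c1" "\<not> adj E c2 c4" "\<not> adj E c4 c2"
    using no_triangle e adj_sym by blast+
  have indep: "\<not> adj E x y" if "adj E c x" "adj E c y" for c x y using no_triangle that adj_sym by blast
  have sol: "\<exists>\<phi>. good W' P Q \<delta> \<phi> \<and> linkfree W' P Q \<delta> \<phi>"
    if "W' \<subseteq> U" "gscene W' P Q \<delta> {}" for W' P Q \<delta>
    using IH[OF that] unfolding solvable_def by auto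
  \<comment> \<open>The neighbours of a deleted boundary vertex are exposed, and they are
    independent because there are no triangles.\<close>
  have scene: "\<exists>\<phi>. good (U - {c}) {x, y} ({u \<in> U. adj E c u} - {x, y}) \<delta> \<phi> \<and>
      linkfree (U - {c}) {x, y} ({u \<in> U. adj E c u} - {x, y}) \<delta> \<phi>"
    if "c \<in> B U" "x \<in> B U" "y \<in> B U" "adj E x y" "x \<noteq> c" "y \<noteq> c" "\<delta> x = 1 \<or> \<delta> x = 2" "\<delta> y = 1 \<or> \<delta> y = 2" for c x y \<delta>
  proof (rule sol)
    show "gscene (U - {c}) {x, y} ({u \<in> U. adj E c u} - {x, y}) \<delta> {}"
    proof (rule normal_sceneI)
      show "card {x, y} \<le> 2" by (rule card_doubleton_le)
      show "adj E u v" if "u \<in> {x, y}" "v \<in> {x, y}" "u \<noteq> v" for u v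
        using that \<open>adj E x y\<close> adj_sym by blast
      show "{x, y} \<subseteq> B (U - {c})" using B_deleted(2)[OF U(1) that(1)] that by auto
      show "{u \<in> U. adj E c u} - {x, y} \<subseteq> B (U - {c})" using B_deleted(1)[OF U(1) that(1)] by auto
      show "U - {c} \<subseteq> V" using U(1) by auto
      show "({u \<in> U. adj E c u} - {x, y}) \<inter> {x, y} = {}" by auto
      show "\<not> adj E u v" if "u \<in> {u \<in> U. adj E c u} - {x, y}" "v \<in> {u \<in> U. adj E c u} - {x, y}" for u v
        using that indep[of c u v] by simp
      show "\<delta> v = 1 \<or> \<delta> v = 2" if "v \<in> {x, y}" for v
        using that \<open>\<delta> x = 1 \<or> \<delta> x = 2\<close> \<open>\<delta> y = 1 \<or> \<delta> y = 2\<close> by auto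
    qed
  qed auto
  show "cext U ?C \<psi>" if \<psi>: "\<psi> c1 = 1" "\<psi> c2 = 2" "\<psi> c3 = 2" "\<psi> c4 = 2"
  proof -
    obtain \<phi> where \<phi>: "good (U - {c1}) {c2, c3} ({u \<in> U. adj E c1 u} - {c2, c3}) (\<lambda>_. 2) \<phi>"
      using scene[of c1 c2 c3 "\<lambda>_. 2"] cB e dn by auto
    note g = goodD[OF \<phi>]
    have nb: "\<phi> u = 2" if "u \<in> U" "adj E c1 u" for u
      using g(2)[of u] g(3)[of u] that by blast
    note r = recolour_isolated[OF cU(1) nb g(4,5)]
    have c: "\<phi> c2 = 2" "\<phi> c3 = 2" "\<phi> c4 = 2" using g(2) nb cU e' by auto
    let ?\<phi> = "\<phi>(c1 := 1)"
    have cc: "conn (cls ?C ?\<phi> 2) c3 x" if "x \<in> ?C" "?\<phi> x = 2" for x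
    proof -
      have "conn (cls ?C ?\<phi> 2) c3 c2" "conn (cls ?C ?\<phi> 2) c3 c4"
        by (rule cls_edge; use c e e' dn in auto)+
      then show ?thesis using that conn_refl by auto
    qed
    show ?thesis
      unfolding cext_def cext_by_def
    proof (intro exI[of _ ?\<phi>] conjI ballI impI)
      show "?\<phi> v = 1 \<or> ?\<phi> v = 2" if "v \<in> U" for v using g(1)[of v] that by auto
      show "?\<phi> v = \<psi> v" if "v \<in> ?C" for v using that c \<psi> dn by auto
      show "forest (cls U ?\<phi> 1)" "forest (cls U ?\<phi> 2)" using r(1,2) by simp_all
      show "card (ones U ?\<phi> v) \<le> 3" if "v \<in> U - ?C" "?\<phi> v = 1" for v
        using r(5)[of v] g(6)[of v] that by auto
      show "?\<phi> u = 2" if "s \<in> ?C" "u \<in> U - ?C" "?\<phi> s = 1" "adj E u s" for s u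
        using that c nb[of u] adj_sym by (auto split: if_splits)
      show "conn (cls ?C ?\<phi> 2) s s'" if "s \<in> ?C" "s' \<in> ?C" "?\<phi> s = 2" "?\<phi> s' = 2" for s s'
        using cc[OF that(1,3)] cc[OF that(2,4)] conn_sym conn_trans by blast
    qed
  qed
  show "cext U ?C \<psi>" if \<psi>: "\<psi> c1 = 1" "\<psi> c2 = 1" "\<psi> c3 = 2" "\<psi> c4 = 2"
  proof -
    have "gscene U {c1, c2} {} (\<lambda>_. 1) {}"
    proof (rule normal_sceneI)
      show "card {c1, c2} \<le> 2" by (rule card_doubleton_le)
    qed (use U e e' cB in auto)
    then obtain \<phi> where \<phi>: "good U {c1, c2} {} (\<lambda>_. 1) \<phi>"
      using sol by blast
    note g = goodD[OF \<phi>]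
    have c: "\<phi> c1 = 1" "\<phi> c2 = 1" "\<phi> c3 = 2" "\<phi> c4 = 2"
      using g(2) g(7)[of c2 c3] g(7)[of c1 c4] cU e e' dn by auto
    show ?thesis
      unfolding cext_def cext_by_def
    proof (intro exI[of _ \<phi>] conjI ballI impI)
      show "\<phi> v = 1 \<or> \<phi> v = 2" if "v \<in> U" for v using g(1)[of v] that by auto
      show "\<phi> v = \<psi> v" if "v \<in> ?C" for v using that c \<psi> by auto
      show "forest (cls U \<phi> 1)" "forest (cls U \<phi> 2)" using g(4,5) by simp_all
      show "card (ones U \<phi> v) \<le> 3" if "v \<in> U - ?C" "\<phi> v = 1" for v using g(6)[of v] that by auto
      show "\<phi> u = 2" if "s \<in> ?C" "u \<in> U - ?C" "\<phi> s = 1" "adj E u s" for s u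
        using that c g(7)[of s u] by auto
      show "conn (cls ?C \<phi> 2) s s'" if "s \<in> ?C" "s' \<in> ?C" "\<phi> s = 2" "\<phi> s' = 2" "s \<noteq> s'" for s s'
        by (rule cls_edge) (use that c e e' in auto)
    qed
  qed
  show "cext U ?C \<psi>" if \<psi>: "\<psi> c1 = 1" "\<psi> c2 = 2" "\<psi> c3 = 1" "\<psi> c4 = 2"
  proof -
    define \<delta> where "\<delta> v = (if v = c1 then 1 else 2 :: nat)" for v
    obtain \<phi> where \<phi>: "good (U - {c3}) {c1, c2} ({u \<in> U. adj E c3 u} - {c1, c2}) \<delta> \<phi>"
      and l: "linkfree (U - {c3}) {c1, c2} ({u \<in> U. adj E c3 u} - {c1, c2}) \<delta> \<phi>"
      using scene[of c3 c1 c2 \<delta>] cB e dn unfolding \<delta>_def by auto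
    note g = goodD[OF \<phi>]
    have c12: "\<phi> c1 = 1" "\<phi> c2 = 2" using g(2) dn unfolding \<delta>_def by auto
    have nb: "\<phi> u = 2" if "u \<in> U" "adj E c3 u" for u
      using g(3)[of u] that n13 c12 by blast
    note r = recolour_isolated[OF cU(3) nb g(4,5)]
    have c4: "\<phi> c4 = 2" using nb cU e by auto
    let ?\<phi> = "\<phi>(c3 := 1)"
    have one: "{x \<in> {c1, c2}. \<delta> x = 1} = {c1}" using dn unfolding \<delta>_def by auto
    have c4Q: "c4 \<in> {u \<in> U. adj E c3 u} - {c1, c2}" using cU e dn by auto
    have c2B: "c2 \<in> B (U - {c3})" using B_deleted(2)[OF U(1) cB(3) cB(2)] dn by auto
    \<comment> \<open>This is (G3) for \<open>c1\<close>, the only precoloured vertex of colour 1: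
      \<open>c4\<close> is in the new \<open>Q\<close>, and \<open>c2\<close> is another boundary
      neighbour of \<open>c1\<close>.\<close>
    have "\<not> conn (cls (U - {c3}) \<phi> 2) c4 c2"
      using l one c4Q e(4) c2B e'(1) dn(5) unfolding linkfree_def by blast
    then have nconn: "\<not> conn (cls U ?\<phi> 2) c4 c2" using r(3) by simp
    show ?thesis
      unfolding cext_def cext_by_def
    proof (intro exI[of _ ?\<phi>] conjI ballI impI)
      show "?\<phi> v = 1 \<or> ?\<phi> v = 2" if "v \<in> U" for v using g(1)[of v] that by auto
      show "?\<phi> v = \<psi> v" if "v \<in> ?C" for v using that c12 c4 \<psi> dn by auto
      show "forest (cls U ?\<phi> 1)" "forest (cls U ?\<phi> 2)" using r(1,2) by simp_all
      show "card (ones U ?\<phi> v) \<le> 3" if "v \<in> U - ?C" "?\<phi> v = 1" for v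
        using r(5)[of v] g(6)[of v] that by auto
      show "?\<phi> u = 2" if "s \<in> ?C" "u \<in> U - ?C" "?\<phi> s = 1" "adj E u s" for s u
      proof -
        have "s = c1 \<or> s = c3" using that c12 c4 by (auto split: if_splits)
        then show ?thesis
        proof
          assume "s = c1"
          then show ?thesis using g(7)[of c1 u] that unfolding \<delta>_def by auto
        next
          assume "s = c3"
          then show ?thesis using nb[of u] that adj_sym by auto
        qed
      qed
      show "conn (cls ?C ?\<phi> 2) s s'"
        if "s \<in> ?C" "s' \<in> ?C" "?\<phi> s = 2" "?\<phi> s' = 2" "s \<noteq> s'" and "conn (cls U ?\<phi> 2) s s'" for s s'
      proof -
        have "s = c4 \<and> s' = c2 \<or> s = c2 \<and> s' = c4" using that(1-5) c12 by (auto split: if_splits)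
        then show ?thesis using nconn that(6) conn_sym by blast
      qed
    qed
  qed
  show "cext U ?C \<psi>" if \<psi>: "\<psi> c1 = 1" "\<psi> c2 = 1" "\<psi> c3 = 1" "\<psi> c4 = 2"
  proof -
    obtain \<phi> where \<phi>: "good (U - {c3}) {c1, c2} ({u \<in> U. adj E c3 u} - {c1, c2}) (\<lambda>_. 1) \<phi>"
      using scene[of c3 c1 c2 "\<lambda>_. 1"] cB e dn by auto
    note g = goodD[OF \<phi>]
    have c12: "\<phi> c1 = 1" "\<phi> c2 = 1" using g(2) by auto
    have nb: "\<phi> u = 2" if "u \<in> U" "adj E c3 u" "u \<noteq> c2" for u
      using g(3)[of u] that n13 by blast
    have c4: "\<phi> c4 = 2" using nb cU e dn by auto
    let ?\<phi> = "\<phi>(c3 := 1)"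
    have c2: "cls U ?\<phi> 2 = cls (U - {c3}) \<phi> 2" unfolding cls_def by auto
    have "cls U ?\<phi> 1 = insert c3 (cls (U - {c3}) \<phi> 1)" using cU unfolding cls_def by auto
    moreover have "forest (insert c3 (cls (U - {c3}) \<phi> 1))"
    proof (rule forest_insert_leaf[OF g(4)])
      fix x y assume "x \<in> cls (U - {c3}) \<phi> 1" "y \<in> cls (U - {c3}) \<phi> 1" "adj E c3 x" "adj E c3 y"
      then have "x = c2" "y = c2" using nb[of x] nb[of y] unfolding cls_def by auto
      then show "x = y" by simp
    qed
    ultimately have f1: "forest (cls U ?\<phi> 1)" by simp
    show ?thesis
      unfolding cext_def cext_by_def
    proof (intro exI[of _ ?\<phi>] conjI ballI impI)
      show "?\<phi> v = 1 \<or> ?\<phi> v = 2" if "v \<in> U" for v using g(1)[of v] that by auto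
      show "?\<phi> v = \<psi> v" if "v \<in> ?C" for v using that c12 c4 \<psi> dn by auto
      show "forest (cls U ?\<phi> 1)" "forest (cls U ?\<phi> 2)" using f1 g(5) c2 by auto
      show "card (ones U ?\<phi> v) \<le> 3" if v: "v \<in> U - ?C" "?\<phi> v = 1" for v
      proof -
        have "\<not> adj E c3 v" using nb[of v] v by auto
        then have "ones U ?\<phi> v = ones (U - {c3}) \<phi> v" unfolding ones_def by auto
        then show ?thesis using g(6)[of v] v by auto
      qed
      show "?\<phi> u = 2" if "s \<in> ?C" "u \<in> U - ?C" "?\<phi> s = 1" "adj E u s" for s u
      proof -
        have "s = c1 \<or> s = c2 \<or> s = c3" using that c4 by auto
        then show ?thesis using g(7)[of s u] nb[of u] that adj_sym by auto
      qed
      show "conn (cls ?C ?\<phi> 2) s s'" if "s \<in> ?C" "s' \<in> ?C" "?\<phi> s = 2" "?\<phi> s' = 2" "s \<noteq> s'" for s s'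
        using that c12 by (auto split: if_splits)
    qed
  qed
qed

lemma cext_byD:
  assumes "cext_by U C \<psi> \<phi>"
  shows "v \<in> U \<Longrightarrow> \<phi> v = 1 \<or> \<phi> v = 2" "v \<in> C \<Longrightarrow> \<phi> v = \<psi> v"
     "forest (cls U \<phi> 1)" "forest (cls U \<phi> 2)"
     "v \<in> U - C \<Longrightarrow> \<phi> v = 1 \<Longrightarrow> card (ones U \<phi> v) \<le> 3"
     "s \<in> C \<Longrightarrow> u \<in> U - C \<Longrightarrow> \<phi> s = 1 \<Longrightarrow> adj E u s \<Longrightarrow> \<phi> u = 2"
     "s \<in> C \<Longrightarrow> s' \<in> C \<Longrightarrow> \<phi> s = 2 \<Longrightarrow> \<phi> s' = 2 \<Longrightarrow> s \<noteq> s' \<Longrightarrow>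
        conn (cls U \<phi> 2) s s' \<Longrightarrow> conn (cls C \<phi> 2) s s'"
  using assms unfolding cext_by_def by blast+

text \<open>Going around the cycle, some 2 is followed by a 1. Rotated to begin with this 1, the
  pattern is one of the four in \<open>cext_cycle\<close>.\<close>

lemma cext_nonconstant:
  assumes IH: "\<And>W' P' Q' \<delta>'. W' \<subseteq> U \<Longrightarrow> gscene W' P' Q' \<delta>' {} \<Longrightarrow> solvable W' P' Q' \<delta>' {}"
    and U: "U \<subseteq> V" "{c1, c2, c3, c4} \<subseteq> B U" and d: "distinct [c1, c2, c3, c4]"
    and e: "adj E c1 c2" "adj E c2 c3" "adj E c3 c4" "adj E c4 c1"
    and \<psi>: "\<And>v. v \<in> {c1, c2, c3, c4} \<Longrightarrow> \<psi> v = 1 \<or> \<psi> v = 2"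
    and nc: "\<not> (\<psi> c1 = \<psi> c2 \<and> \<psi> c2 = \<psi> c3 \<and> \<psi> c3 = \<psi> c4)"
  shows "cext U {c1, c2, c3, c4} \<psi>"
proof -
  have key: "cext U {d1, d2, d3, d4} \<psi>"
    if "{d1, d2, d3, d4} \<subseteq> B U" "distinct [d1, d2, d3, d4]" "adj E d1 d2" "adj E d2 d3" "adj E d3 d4" "adj E d4 d1"
      "\<psi> d1 = 1" "\<psi> d4 = 2" "\<psi> d2 = 1 \<or> \<psi> d2 = 2" "\<psi> d3 = 1 \<or> \<psi> d3 = 2" for d1 d2 d3 d4
    using cext_cycle[OF IH U(1) that(1-6), where \<psi> = \<psi>] that(7-10) by blast
  have c: "\<psi> c1 = 1 \<or> \<psi> c1 = 2" "\<psi> c2 = 1 \<or> \<psi> c2 = 2" "\<psi> c3 = 1 \<or> \<psi> c3 = 2" "\<psi> c4 = 1 \<or> \<psi> c4 = 2"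
    using \<psi> by auto
  then consider "\<psi> c1 = 1" "\<psi> c4 = 2" | "\<psi> c2 = 1" "\<psi> c1 = 2" | "\<psi> c3 = 1" "\<psi> c2 = 2" | "\<psi> c4 = 1" "\<psi> c3 = 2"
    using nc by force
  then show ?thesis
  proof cases
    case 1
    then show ?thesis using key[of c1 c2 c3 c4] U d e c by simp
  next
    case 2
    then have "cext U {c2, c3, c4, c1} \<psi>" by (intro key) (use U d e c in auto)
    moreover have "{c2, c3, c4, c1} = {c1, c2, c3, c4}" by auto
    ultimately show ?thesis by simp
  next
    case 3
    then have "cext U {c3, c4, c1, c2} \<psi>" by (intro key) (use U d e c in auto)
    moreover have "{c3, c4, c1, c2} = {c1, c2, c3, c4}" by auto
    ultimately show ?thesis by simp
  next
    case 4
    then have "cext U {c4, c1, c2, c3} \<psi>" by (intro key) (use U d e c in auto)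
    moreover have "{c4, c1, c2, c3} = {c1, c2, c3, c4}" by auto
    ultimately show ?thesis by simp
  qed
qed

lemma four_cycle_setup:
  assumes rd: "rdisc W (us @ a # b # ws)"
    and s: "s \<in> W" "s \<notin> set (us @ a # b # ws)" "t \<in> W" "t \<notin> set (us @ a # b # ws)"
    and e: "adj E a s" "adj E s t" "adj E t b"
  shows "disc W (rev (b # ws @ us @ [a])) [a, b] a b"
    "theta (rev (b # ws @ us @ [a])) [a, s, t, b] a b" "theta [a, b] [a, s, t, b] a b"
    "\<not> adj E a t" "\<not> adj E s b" "{a, b} \<notin> es (rev (b # ws @ us @ [a]))" "adj E a b"
proof -
  let ?ks = "us @ a # [] @ b # ws" and ?y = "rev (b # ws @ us @ [a])" and ?r = "[a, s, t, b]"
  have rd': "rdisc W ?ks" using rd by simp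
  have disc: "disc W [a, b] ?y a b" using rdisc_disc[OF rd' refl] by simp
  then show "disc W ?y [a, b] a b" using theta_sym unfolding disc_def by (simp add: Un_commute)
  have th: "theta [a, b] ?y a b" using disc unfolding disc_def by auto
  note p = theta_pth[OF th]
  show abE: "adj E a b" using p(1) unfolding pth_def by auto
  show n: "\<not> adj E a t" "\<not> adj E s b" using no_triangle[of a s t] no_triangle[of s t b] e by auto
  have abn: "a \<noteq> b" using adjD(3)[OF abE] .
  have pr: "pth V ?r" using s e adjD[OF e(1)] adjD[OF e(2)] adjD[OF e(3)] abn unfolding pth_def by auto
  have nr: "{a, b} \<notin> es ?r" using es_ends[OF pr] by simp
  have "{a, b} \<in> es [a, b]" by simp
  then show "{a, b} \<notin> es ?y" using theta_es[OF th] by blast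
  have i: "set [a, b] \<inter> set ?r = {a, b}" "set ?y \<inter> set ?r = {a, b}" using s(2,4) by auto
  have "es [a, b] \<inter> es ?r = {}" using nr by simp
  then show "theta [a, b] ?r a b" using p pr i abn unfolding theta_def by simp
  have "es ?y \<inter> es ?r = {}" by (rule es_Int_disjoint[OF i(2)]) (use nr p(2) in \<open>simp_all add: pth_def\<close>)
  then show "theta ?y ?r a b" using p pr i abn unfolding theta_def by (simp add: hd_rev last_rev)
qed

text \<open>Since \<open>a\<close> and \<open>b\<close> are not in \<open>P\<close> or
  \<open>Q\<close>, both sets lie strictly outside the four-cycle, and that part together with the
  four-cycle is coloured first. The inside has no condition of its own except to match.\<close>

lemma four_cycle_solvable:
  assumes IH: "\<And>W' P' Q' \<delta>' S'. W' \<subset> W \<Longrightarrow> gscene W' P' Q' \<delta>' S' \<Longrightarrow> solvable W' P' Q' \<delta>' S'"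
    and gs: "gscene W P Q \<delta> S" and "P \<noteq> {}"
    and rd: "rdisc W (us @ a # b # ws)"
    and s: "s \<in> W" "s \<notin> set (us @ a # b # ws)" "t \<in> W" "t \<notin> set (us @ a # b # ws)"
    and e: "adj E a s" "adj E s t" "adj E t b"
    and ab: "a \<notin> P \<union> Q" "b \<notin> P \<union> Q"
    and ne: "W \<inter> inside (loop [a, b] [a, s, t, b]) \<noteq> {}"
  shows "solvable W P Q \<delta> S"
proof -
  note g = gsceneD[OF gs]
  let ?ks = "us @ a # b # ws" and ?y = "rev (b # ws @ us @ [a])" and ?r = "[a, s, t, b]"
  note f = four_cycle_setup[OF rd s e]
  have rW: "set ?r \<subseteq> W" using f(1) s unfolding disc_def by auto
  have BW: "B W = set ?ks" by (rule B_rdisc[OF rd])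
  let ?J = "side W ?y ?r a b" and ?I = "side W [a, b] ?r a b"
  note part = cut_partition[OF f(1,2,3) rW]
  have "e' \<in> es ?r \<union> es [a, b]" if e': "e' \<in> E" "e' \<subseteq> set ?r" for e'
  proof -
    obtain x y where xy: "x \<noteq> y" "e' = {x, y}" using e'(1) by (rule edgeE)
    moreover have "{a, t} \<notin> E" "{s, b} \<notin> E" using f(4,5) unfolding adj_def by auto
    ultimately show ?thesis using e' by (auto simp: insert_commute doubleton_eq_iff)
  qed
  then have rB: "set ?r \<subseteq> B (set ?r \<union> ?I)"
    using cut_boundary[OF f(1,2,3) rW _ f(6)] by blast
  have Ine: "?I \<noteq> {}" using ne unfolding side_def by blast
  have ksJ: "set ?ks - {a, b} \<subseteq> ?J" unfolding side_def by auto
  have PJ: "P \<subseteq> ?J" using g(2) BW ab ksJ by auto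
  have QJ: "Q \<subseteq> ?J" using g(5) BW ab ksJ by auto
  let ?V1 = "set ?r \<union> ?J" and ?V2 = "set ?r \<union> ?I"
  have int: "?V1 \<inter> ?V2 = {a, s, t, b}"
  proof -
    have "?V1 \<inter> ?V2 = set ?r" using part(2-4) by blast
    then show ?thesis by simp
  qed
  have cut: "\<not> adj E x y" if "x \<in> ?J" "y \<in> ?I" for x y using cut_edge[OF f(1,2,3) rW that] .
  have nc: "nocross ?V1 ?V2" unfolding nocross_def using cut by blast
  have W: "W = ?V1 \<union> ?V2" using part(1) by blast
  obtain p where "p \<in> P" using assms(3) by auto
  have sub: "?V1 \<subset> W" "?V2 \<subset> W"
  proof -
    obtain y where "y \<in> ?I" using Ine by auto
    then have "y \<in> W - ?V1" "p \<in> W - ?V2" using part PJ \<open>p \<in> P\<close> by blast+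
    then show "?V1 \<subset> W" "?V2 \<subset> W" using W by blast+
  qed
  have BV1: "x \<in> B ?V1" if "x \<in> B W" "x \<in> ?V1" for x
    using B_mono[of ?V1 W x] that sub g(1) by auto
  have QV: "Q \<inter> ?V1 = Q" using QJ by auto
  have "gscene ?V1 P (Q \<inter> ?V1) \<delta> S"
    unfolding gscene_def QV
  proof (intro conjI)
    show "P \<subseteq> B ?V1" using g(2) PJ BV1 by auto
    show "Q \<subseteq> B ?V1 - P" using g(5,6) QJ BV1 by auto
    show "?V1 \<subseteq> V" using g(1) sub by auto
    show "card P \<le> 2" by (rule g(3))
    show "\<forall>x\<in>P. \<forall>y\<in>P. x \<noteq> y \<longrightarrow> adj E x y" using g(4) by blast
    show "\<forall>x\<in>Q - S. \<forall>y\<in>Q - S. \<not> adj E x y" using g(7) by blast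
    show "\<forall>v\<in>P. \<delta> v = 1 \<or> \<delta> v = 2" using g(8) by blast
    show "S = {} \<or> (\<exists>p1 p2 q. P = {p1, p2} \<and> p1 \<noteq> p2 \<and> \<delta> p1 = 1 \<and> \<delta> p2 = 2 \<and> S = {q} \<and> q \<in> Q \<and> adj E p2 q)"
      using g(13) by blast
  qed
  then obtain \<phi>1 where \<phi>1: "good ?V1 P (Q \<inter> ?V1) \<delta> \<phi>1" "S = {} \<Longrightarrow> linkfree ?V1 P (Q \<inter> ?V1) \<delta> \<phi>1"
    using IH[OF sub(1)] unfolding solvable_def by blast
  note d1 = goodD[OF \<phi>1(1)]
  have ab': "adj E b a" using f(7) adj_sym by auto
  have dr: "distinct [a, s, t, b]" using theta_pth(2)[OF f(3)] unfolding pth_def by auto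
  \<comment> \<open>A four-cycle of one colour would be a cycle in a colour class, which is a
    forest.\<close>
  have nconst: "\<not> (\<phi>1 a = \<phi>1 s \<and> \<phi>1 s = \<phi>1 t \<and> \<phi>1 t = \<phi>1 b)"
  proof
    assume c: "\<phi>1 a = \<phi>1 s \<and> \<phi>1 s = \<phi>1 t \<and> \<phi>1 t = \<phi>1 b"
    have "ring (cls ?V1 \<phi>1 (\<phi>1 a)) [a, s, t, b]"
      using c dr e ab' unfolding ring_def cls_def by auto
    moreover have "forest (cls ?V1 \<phi>1 (\<phi>1 a))" using d1(1)[of a] d1(4,5) by auto
    ultimately show False unfolding forest_iff by blast
  qed
  have "cext ?V2 {a, s, t, b} \<phi>1"
  proof (rule cext_nonconstant)
    show "solvable W' P' Q' \<delta>' {}" if "W' \<subseteq> ?V2" "gscene W' P' Q' \<delta>' {}" for W' P' Q' \<delta>'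
      using IH[OF _ that(2)] that(1) sub(2) by blast
    show "?V2 \<subseteq> V" using sub(2) g(1) by auto
    show "{a, s, t, b} \<subseteq> B ?V2" using rB by simp
    show "\<phi>1 v = 1 \<or> \<phi>1 v = 2" if "v \<in> {a, s, t, b}" for v using d1(1)[of v] that by auto
  qed (use dr e ab' nconst in auto)
  then obtain \<phi>2 where w: "cext_by ?V2 {a, s, t, b} \<phi>1 \<phi>2" unfolding cext_def by (elim exE)
  note \<phi>2 = cext_byD[OF w]
  have VV: "?V2 - ?V1 = ?V2 - {a, s, t, b}" using int by blast
  have QV2: "Q \<inter> ?V2 = {}" using QJ part(2,3) by blast
  have BV2: "(?V2 - ?V1) \<inter> B W = {}"
  proof -
    have "B W \<subseteq> ?V1" using BW ksJ by auto
    then show ?thesis by blast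
  qed
  have ext: "extends W ?V1 ?V2 Q \<phi>1 \<phi>2"
    unfolding extends_def int
  proof (intro conjI ballI impI)
    show "\<phi>2 v = 1 \<or> \<phi>2 v = 2" if "v \<in> ?V2" for v by (rule \<phi>2(1)[OF that])
    show "\<phi>2 v = \<phi>1 v" if "v \<in> {a, s, t, b}" for v by (rule \<phi>2(2)[OF that])
    show "\<phi>2 q = 2" if "q \<in> Q \<inter> ?V2" for q using that unfolding QV2 by simp
    show "forest (cls ?V2 \<phi>2 1)" by (rule \<phi>2(3))
    show "forest (cls ?V2 \<phi>2 2)" by (rule \<phi>2(4))
    show "card (ones ?V2 \<phi>2 v) \<le> 3" if "v \<in> ?V2 - ?V1" "\<phi>2 v = 1" for v
      by (rule \<phi>2(5)[OF that[unfolded VV]])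
    show "card (ones ?V2 \<phi>2 v) \<le> 2" if "v \<in> (?V2 - ?V1) \<inter> B W" for v
      using that(1) unfolding BV2 by simp
    show "\<phi>2 u = 2" if "s' \<in> {a, s, t, b}" "u \<in> ?V2 - ?V1" "\<phi>2 s' = 1" "adj E u s'" for s' u
      by (rule \<phi>2(6)[OF that[unfolded VV]])
    show "conn (cls {a, s, t, b} \<phi>2 2) s1 s2"
      if "s1 \<in> {a, s, t, b}" "s2 \<in> {a, s, t, b}" "\<phi>2 s1 = 2" "\<phi>2 s2 = 2" "s1 \<noteq> s2" "conn (cls ?V2 \<phi>2 2) s1 s2" for s1 s2
      by (rule \<phi>2(7)[OF that])
  qed
  have PV1: "P \<subseteq> ?V1" using PJ by auto
  note gl = W g(1) nc PV1 g(11) \<phi>1(1) ext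
  have "linkfree W P Q \<delta> (glue ?V1 \<phi>1 \<phi>2)" if "S = {}"
  proof (rule glue_linkfree[OF gl \<phi>1(2)[OF that]])
    fix v u assume v: "{x \<in> P. \<delta> x = 1} = {v}" "u \<in> Q \<union> B W" "adj E u v"
    then have "v \<in> ?J" "u \<in> W" using PJ g(11) B_subset[of W] by blast+
    then show "u \<in> ?V1" using part(1) cut[of v u] v(3) adj_sym by blast
  qed
  then show ?thesis using glue_good[OF gl] unfolding solvable_def by blast
qed

lemma recolour_leaf:
  assumes "d \<in> U" and n: "\<forall>u\<in>U. adj E d u \<longrightarrow> u \<noteq> e \<longrightarrow> \<phi> u = 2"
    and f: "forest (cls (U - {d}) \<phi> 1)" "forest (cls (U - {d}) \<phi> 2)"
  defines "\<phi>' \<equiv> \<phi>(d := 1)"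
  shows "forest (cls U \<phi>' 1)" "forest (cls U \<phi>' 2)" "cls U \<phi>' 2 = cls (U - {d}) \<phi> 2"
    "ones U \<phi>' d \<subseteq> {e}" "ones U \<phi>' e \<subseteq> insert d (ones (U - {d}) \<phi> e)"
    "v \<in> U \<Longrightarrow> v \<noteq> d \<Longrightarrow> v \<noteq> e \<Longrightarrow> \<phi> v = 1 \<Longrightarrow> ones U \<phi>' v = ones (U - {d}) \<phi> v"
proof -
  have dd: "\<not> adj E d d" using adjD(3)[of d d] by blast
  have n': "u = e" if "u \<in> U" "adj E d u" "\<phi> u = 1" for u using n that by auto
  show c2: "cls U \<phi>' 2 = cls (U - {d}) \<phi> 2" unfolding cls_def \<phi>'_def by auto
  then show "forest (cls U \<phi>' 2)" using f by simp
  have "cls U \<phi>' 1 = insert d (cls (U - {d}) \<phi> 1)" using assms(1) unfolding cls_def \<phi>'_def by auto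
  moreover have "forest (insert d (cls (U - {d}) \<phi> 1))"
    by (rule forest_insert_leaf[OF f(1)]) (auto simp: cls_def dest!: n')
  ultimately show "forest (cls U \<phi>' 1)" by simp
  show "ones U \<phi>' d \<subseteq> {e}"
  proof
    fix u assume "u \<in> ones U \<phi>' d"
    then have "u \<in> U" "adj E d u" "u \<noteq> d" "\<phi> u = 1" using dd adj_sym unfolding ones_def \<phi>'_def by (auto split: if_splits)
    then show "u \<in> {e}" using n' by simp
  qed
  show "ones U \<phi>' e \<subseteq> insert d (ones (U - {d}) \<phi> e)" unfolding ones_def \<phi>'_def by auto
  show "ones U \<phi>' v = ones (U - {d}) \<phi> v" if "v \<in> U" "v \<noteq> d" "v \<noteq> e" "\<phi> v = 1"
  proof -
    have "\<not> adj E d v" using n'[of v] that by auto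
    then show ?thesis unfolding ones_def \<phi>'_def by auto
  qed
qed

text \<open>All vertices outside \<open>P\<close> get colour 2. A cycle, a degree above two and the
  three vertices of (G3) each need more than two vertices.\<close>

lemma small_solvable:
  assumes gs: "gscene W P Q \<delta> S" and c: "card W \<le> 2"
  shows "solvable W P Q \<delta> S"
proof -
  note g = gsceneD[OF gs]
  have fin: "finite W" using g(1) finite_V finite_subset by auto
  let ?\<phi> = "\<lambda>v. if v \<in> P then \<delta> v else 2"
  have forest: "forest A" if "A \<subseteq> W" for A
    unfolding forest_iff
  proof
    assume "\<exists>ks. ring A ks"
    then obtain ks where "ring A ks" ..
    then have "length ks \<ge> 3" "distinct ks" "set ks \<subseteq> W" using that unfolding ring_def by auto
    then show False using card_mono[OF fin, of "set ks"] distinct_card[of ks] c by linarith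
  qed
  have ones: "card (ones W ?\<phi> v) \<le> 2" for v
    using card_mono[OF fin, of "ones W ?\<phi> v"] c unfolding ones_def by force
  have "good W P Q \<delta> ?\<phi>"
    unfolding good_def
  proof (intro conjI ballI impI)
    show "?\<phi> v = 1 \<or> ?\<phi> v = 2" for v using g(8)[of v] by simp
    show "?\<phi> q = 2" if "q \<in> Q" for q using g(6) that by auto
    show "forest (cls W ?\<phi> 1)" "forest (cls W ?\<phi> 2)" by (rule forest; auto simp: cls_def)+
    show "card (ones W ?\<phi> v) \<le> 3" "card (ones W ?\<phi> v) \<le> 2" for v using ones[of v] by linarith+
  qed auto
  moreover have "linkfree W P Q \<delta> ?\<phi>"
    unfolding linkfree_def
  proof (intro allI impI)
    fix v u w assume a: "{x \<in> P. \<delta> x = 1} = {v}" "u \<in> Q" "adj E u v" "w \<in> B W" "adj E w v" "w \<noteq> u"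
    then have "v \<in> P" by blast
    then have "{u, v, w} \<subseteq> W" using a(2,4) g(10,11) B_subset[of W] by auto
    moreover have "card {u, v, w} = 3" using adjD(3)[OF a(3)] adjD(3)[OF a(5)] a(6) by auto
    ultimately show "\<not> conn (cls W ?\<phi> 2) u w" using card_mono[OF fin, of "{u, v, w}"] c by simp
  qed
  ultimately show ?thesis unfolding solvable_def by blast
qed

section \<open>Rotation and reversal of the outer cycle\<close>

lemma kes_rotate:
  assumes "xs \<noteq> []" "ys \<noteq> []" shows "kes (ys @ xs) = kes (xs @ ys)"
  using assms es_append2[of xs ys] es_append2[of ys xs] unfolding kes_def by auto

lemma rdisc_rotate: "rdisc W (xs @ ys) \<Longrightarrow> rdisc W (ys @ xs)"
proof (cases "xs = [] \<or> ys = []")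
  case False
  assume r: "rdisc W (xs @ ys)"
  have "kim (ys @ xs) = kim (xs @ ys)" using kes_rotate False unfolding kim_def by auto
  then show ?thesis using r ring_rotate[of W xs ys] unfolding rdisc_def by simp
qed auto

lemma rdisc_rev: "rdisc W ks \<Longrightarrow> rdisc W (rev ks)"
proof -
  assume r: "rdisc W ks"
  then have ring: "ring W ks" unfolding rdisc_def by auto
  then have "ks \<noteq> []" unfolding ring_def by auto
  then have "kim (rev ks) = kim ks" unfolding kim_def kes_def by (simp add: hd_rev last_rev es_rev insert_commute)
  moreover have "ring W (rev ks)"
    using ring adj_sym \<open>ks \<noteq> []\<close> unfolding ring_def by (simp add: hd_rev last_rev)
  ultimately show ?thesis using r unfolding rdisc_def by simp
qed

lemma rdisc_rotate_to:
  assumes "rdisc W ks" "x \<in> set ks"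
  obtains ys where "rdisc W (x # ys)" "rdisc W (x # rev ys)" "set (x # ys) = set ks"
proof -
  obtain as bs where ks: "ks = as @ x # bs" using assms(2) split_list by metis
  then have 1: "rdisc W (x # bs @ as)" using rdisc_rotate[of W as "x # bs"] assms(1) by simp
  then have "rdisc W (rev (bs @ as) @ [x])" using rdisc_rev[OF 1] by simp
  then have "rdisc W (x # rev (bs @ as))" using rdisc_rotate[of W "rev (bs @ as)" "[x]"] by simp
  moreover have "set (x # bs @ as) = set ks" using ks by auto
  ultimately show ?thesis using that[of "bs @ as"] 1 by blast
qed

end

lemma list_split_two:
  assumes "i < j" "j < length ks"
  shows "ks = take i ks @ ks ! i # take (j - Suc i) (drop (Suc i) ks) @ ks ! j # drop (Suc j) ks"
proof -
  have "ks = take i ks @ ks ! i # drop (Suc i) ks" using assms by (simp add: id_take_nth_drop)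
  moreover have "drop (Suc i) ks = take (j - Suc i) (drop (Suc i) ks) @ drop (Suc i) ks ! (j - Suc i) # drop (Suc (j - Suc i)) (drop (Suc i) ks)"
    using assms by (intro id_take_nth_drop) simp
  moreover have "drop (Suc i) ks ! (j - Suc i) = ks ! j" "drop (Suc (j - Suc i)) (drop (Suc i) ks) = drop (Suc j) ks"
    using assms by simp_all
  ultimately show ?thesis by simp
qed

context triangle_free_drawing
begin

lemma subsceneI:
  assumes "gscene W P Q \<delta> S" "W' \<subseteq> W" "P \<subseteq> B W'" "Q \<subseteq> Q'" "Q' \<subseteq> B W'" "Q' \<inter> P = {}"
    and i: "\<And>x y. x \<in> Q' \<Longrightarrow> y \<in> Q' \<Longrightarrow> x \<notin> S \<Longrightarrow> y \<notin> S \<Longrightarrow> \<not> adj E x y"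
  shows "gscene W' P Q' \<delta> S"
proof -
  note g = gsceneD[OF assms(1)]
  show ?thesis
    unfolding gscene_def
  proof (intro conjI)
    show "W' \<subseteq> V" using g(1) assms(2) by simp
    show "\<forall>x\<in>P. \<forall>y\<in>P. x \<noteq> y \<longrightarrow> adj E x y" using g(4) by blast
    show "\<forall>x\<in>Q' - S. \<forall>y\<in>Q' - S. \<not> adj E x y" using i by blast
    show "\<forall>v\<in>P. \<delta> v = 1 \<or> \<delta> v = 2" using g(8) by blast
    show "S = {} \<or> (\<exists>p1 p2 q. P = {p1, p2} \<and> p1 \<noteq> p2 \<and> \<delta> p1 = 1 \<and> \<delta> p2 = 2 \<and> S = {q} \<and> q \<in> Q' \<and> adj E p2 q)"
      using g(13) assms(4) by blast
    show "Q' \<subseteq> B W' - P" using assms(5,6) by blast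
  qed (use assms g(3) in simp_all)
qed

text \<open>Positions 0 and 1 are held by the precoloured vertices, hence the lower bound 2.\<close>

definition free_index :: "complex set \<Rightarrow> complex set \<Rightarrow> (complex \<Rightarrow> nat) \<Rightarrow> complex list \<Rightarrow> nat \<Rightarrow> bool" where
  "free_index P Q \<delta> ks j \<longleftrightarrow> 2 \<le> j \<and> j < length ks \<and> ks ! j \<notin> Q \<and> (\<forall>p\<in>P. \<delta> p = 1 \<longrightarrow> \<not> adj E (ks ! j) p)"

end

section \<open>Deleting boundary vertices\<close>

text \<open>The induction step for two precoloured vertices, refuted as a counterexample that admits
  induction. Assumption \<open>ori\<close> merely fixes the direction of the outer cycle: the
  colours 2, 1 are excluded, so that \<open>p0\<close> has colour 1 whenever the colours
  differ.\<close>

locale pair_counterexample = triangle_free_drawing +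
  fixes W P Q \<delta> S ks p0 p1
  assumes IH: "\<And>W' P' Q' \<delta>' S'. W' \<subset> W \<Longrightarrow> gscene W' P' Q' \<delta>' S' \<Longrightarrow> solvable W' P' Q' \<delta>' S'"
    and gs: "gscene W P Q \<delta> S" and not: "\<not> solvable W P Q \<delta> S"
    and rd: "rdisc W ks" and P: "P = {p0, p1}" and k: "ks ! 0 = p0" "ks ! Suc 0 = p1"
    and ori: "\<delta> p0 = 1 \<or> \<delta> p1 = 2"
begin

lemma ks_ring: "length ks \<ge> 4" "distinct ks" "set ks \<subseteq> W" "B W = set ks" "W \<subseteq> V"
  "Suc i < length ks \<Longrightarrow> adj E (ks ! i) (ks ! Suc i)" "adj E (ks ! (length ks - 1)) p0"
proof -
  have r: "ring W ks" using rd unfolding rdisc_def by simp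
  then show d: "distinct ks" "set ks \<subseteq> W" unfolding ring_def by simp_all
  show "B W = set ks" by (rule B_rdisc[OF rd])
  show "W \<subseteq> V" using gsceneD(1)[OF gs] .
  show e: "Suc i < length ks \<Longrightarrow> adj E (ks ! i) (ks ! Suc i)" for i
    using r unfolding ring_def successively_conv_nth by simp
  have l: "length ks \<ge> 3" using r unfolding ring_def by simp
  then have "ks \<noteq> []" by auto
  then show last: "adj E (ks ! (length ks - 1)) p0"
    using r k(1) unfolding ring_def by (simp add: last_conv_nth hd_conv_nth)
  show "length ks \<ge> 4"
  proof (rule ccontr)
    assume "\<not> 4 \<le> length ks"
    then have "length ks = 3" using l by simp
    then show False using e[of 0] e[of 1] last k no_triangle[of "ks ! 1" "ks ! 2" p0] adj_sym
      by (simp add: numeral_2_eq_2)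
  qed
qed

lemma p_facts: "p0 \<in> set ks" "p1 \<in> set ks" "p0 \<noteq> p1" "adj E p0 p1" "\<delta> p0 = 1 \<or> \<delta> p0 = 2" "\<delta> p1 = 1 \<or> \<delta> p1 = 2"
proof -
  have l: "0 < length ks" "Suc 0 < length ks" using ks_ring(1) by linarith+
  show "p0 \<in> set ks" "p1 \<in> set ks" using nth_mem[OF l(1)] nth_mem[OF l(2)] k by simp_all
  show "adj E p0 p1" using ks_ring(6)[of 0] l k by simp
  then show "p0 \<noteq> p1" using adjD(3) by blast
  show "\<delta> p0 = 1 \<or> \<delta> p0 = 2" "\<delta> p1 = 1 \<or> \<delta> p1 = 2" using gsceneD(8)[OF gs] P by simp_all
qed

lemma exceptional: "S \<noteq> {} \<Longrightarrow> \<delta> p0 = 1 \<and> \<delta> p1 = 2 \<and> (\<exists>q. S = {q} \<and> q \<in> Q \<and> adj E p1 q)"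
proof -
  assume "S \<noteq> {}"
  then obtain x y q where s: "P = {x, y}" "\<delta> x = 1" "\<delta> y = 2" "S = {q}" "q \<in> Q" "adj E y q"
    using gsceneD(13)[OF gs] by blast
  have "x = p0 \<and> y = p1 \<or> x = p1 \<and> y = p0" using s(1) P by (auto simp: doubleton_eq_iff)
  then show ?thesis using s(2-6) ori by auto
qed

lemma boundary_index: "x \<in> set ks \<Longrightarrow> x \<notin> P \<Longrightarrow> \<exists>j. 2 \<le> j \<and> j < length ks \<and> x = ks ! j"
proof -
  assume a: "x \<in> set ks" "x \<notin> P"
  then obtain j where j: "j < length ks" "x = ks ! j" by (metis in_set_conv_nth)
  moreover have "j \<noteq> 0" "j \<noteq> Suc 0" using a(2) j(2) k P by auto
  ultimately show ?thesis by (intro exI[of _ j]) simp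
qed

lemma index_not_P: "2 \<le> j \<Longrightarrow> j < length ks \<Longrightarrow> ks ! j \<notin> P"
proof -
  assume j: "2 \<le> j" "j < length ks"
  have "0 < length ks" "Suc 0 < length ks" using ks_ring(1) by linarith+
  then have "ks ! j \<noteq> ks ! 0" "ks ! j \<noteq> ks ! Suc 0"
    using j nth_eq_iff_index_eq[OF ks_ring(2) j(2), of 0] nth_eq_iff_index_eq[OF ks_ring(2) j(2), of "Suc 0"] by simp_all
  then show ?thesis using k P by simp
qed

text \<open>Every other edge between boundary vertices is a chord that \<open>chord_solvable\<close>
  removes. The third alternative is what its hypothesis \<open>H\<close> leaves over: in an
  exceptional scene, a chord from \<open>p1\<close> to a vertex outside \<open>Q\<close>.\<close>

lemma adj_index:
  assumes "i < j" "j < length ks" "adj E (ks ! i) (ks ! j)"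
  shows "j = Suc i \<or> (i = 0 \<and> Suc j = length ks) \<or> (S \<noteq> {} \<and> i = 1 \<and> ks ! j \<notin> Q)"
proof (rule ccontr)
  assume n: "\<not> ?thesis"
  have "solvable W P Q \<delta> S"
  proof (rule chord_solvable[OF IH gs rd list_split_two[OF assms(1,2)] _ _ assms(3)])
    show "take (j - Suc i) (drop (Suc i) ks) \<noteq> []" using n assms by simp
    show "take i ks @ drop (Suc j) ks \<noteq> []" using n assms by auto
    fix p assume p: "P \<noteq> {ks ! i, ks ! j}" "S \<noteq> {}" "p \<in> P" "\<delta> p = 2" "p \<in> {ks ! i, ks ! j}"
    then have "p = p1" using exceptional P by auto
    moreover have "p1 \<noteq> ks ! j"
    proof
      assume "p1 = ks ! j"
      then have "j = Suc 0" using nth_eq_iff_index_eq[OF ks_ring(2), of j "Suc 0"] k ks_ring(1) assms by simp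
      then show False using n assms by simp
    qed
    ultimately have "p1 = ks ! i" using p(5) by simp
    then have "i = 1" using nth_eq_iff_index_eq[OF ks_ring(2), of i "Suc 0"] k ks_ring(1) assms by simp
    then have "ks ! j \<in> Q" using n p(2) by simp
    then show "{ks ! i, ks ! j} - {p} \<subseteq> Q" using \<open>p = p1\<close> \<open>p1 = ks ! i\<close> by auto
  qed
  then show False using not by simp
qed

lemma adj_index_P0: "2 \<le> j \<Longrightarrow> j < length ks \<Longrightarrow> adj E (ks ! j) p0 \<Longrightarrow> Suc j = length ks"
  using adj_index[of 0 j] k adj_sym by auto

lemma adj_index_P1: "2 \<le> j \<Longrightarrow> j < length ks \<Longrightarrow> adj E (ks ! j) p1 \<Longrightarrow> S = {} \<or> ks ! j \<in> Q \<Longrightarrow> j = 2"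
  using adj_index[of "Suc 0" j] k adj_sym by auto

lemma adj_index_rest:
  "2 \<le> i \<Longrightarrow> 2 \<le> j \<Longrightarrow> i < length ks \<Longrightarrow> j < length ks \<Longrightarrow> adj E (ks ! i) (ks ! j) \<Longrightarrow> j = Suc i \<or> i = Suc j"
  using adj_index[of i j] adj_index[of j i] adj_sym[of "ks ! i" "ks ! j"] adjD(3)[of "ks ! i" "ks ! j"] by (cases i j rule: linorder_cases) auto

lemma two_chord_impossible:
  assumes "d \<in> set ks" "d \<notin> P" "d \<notin> Q" "q \<in> Q" "q \<notin> S" "t \<in> W" "t \<notin> set ks" "adj E d t" "adj E t q"
  shows False
proof -
  have "q \<in> set ks" using gsceneD(5)[OF gs] assms(4) ks_ring(4) by auto
  then obtain i j where ij: "i < length ks" "j < length ks" "d = ks ! i" "q = ks ! j" using assms(1) by (metis in_set_conv_nth)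
  have "i \<noteq> j" using ij assms(3,4) by auto
  have ne: "P \<noteq> {}" using P by simp
  have "solvable W P Q \<delta> S"
  proof (cases "i < j")
    case True
    show ?thesis
      by (rule two_chord_solvable[OF IH gs ne rd list_split_two[OF True ij(2)] assms(6,7), where d = d and q = q])
        (use ij assms in simp_all)
  next
    case False
    then have "j < i" using \<open>i \<noteq> j\<close> by simp
    have e: "adj E q t" "adj E t d" using assms(8,9) adj_sym by simp_all
    show ?thesis
      by (rule two_chord_solvable[OF IH gs ne rd list_split_two[OF \<open>j < i\<close> ij(1)] assms(6,7), where d = d and q = q])
        (use ij assms e in auto)
  qed
  then show False using not by simp
qed

text \<open>Such a vertex is adjacent to a precoloured vertex of colour 1, and without chords this
  is its neighbour along the outer cycle. A chord at \<open>p1\<close> cannot interfere, since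
  \<open>p1\<close> has colour 2 in exceptional scenes.\<close>

lemma not_free_index:
  assumes "2 \<le> j" "j < length ks" "\<not> free_index P Q \<delta> ks j" "ks ! j \<notin> Q"
  shows "\<exists>p\<in>P. \<delta> p = 1 \<and> adj E (ks ! j) p"
    "Suc j = length ks \<and> \<delta> p0 = 1 \<or> j = 2 \<and> \<delta> p0 = 1 \<and> \<delta> p1 = 1"
proof -
  show "\<exists>p\<in>P. \<delta> p = 1 \<and> adj E (ks ! j) p" using assms unfolding free_index_def by auto
  then have "\<delta> p0 = 1 \<and> adj E (ks ! j) p0 \<or> \<delta> p1 = 1 \<and> adj E (ks ! j) p1" unfolding P by blast
  then show "Suc j = length ks \<and> \<delta> p0 = 1 \<or> j = 2 \<and> \<delta> p0 = 1 \<and> \<delta> p1 = 1"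
  proof
    assume a: "\<delta> p1 = 1 \<and> adj E (ks ! j) p1"
    then have "S = {}" using exceptional by auto
    then show ?thesis using adj_index_P1[OF assms(1,2)] a ori by auto
  qed (use adj_index_P0[OF assms(1,2)] in auto)
qed

text \<open>Independence of the new \<open>Q\<close> has three enemies. Two adjacent neighbours of
  \<open>d\<close> would form a triangle with it. An inner neighbour of \<open>d\<close> adjacent to
  \<open>Q\<close> would give a two-chord. A boundary neighbour of \<open>d\<close> outside
  \<open>Q\<close> with a neighbour in \<open>Q\<close> must, by minimality of \<open>i\<close>, be
  the free successor of \<open>d\<close>, followed by a vertex of \<open>Q\<close>; hypothesis
  \<open>c\<close> allows this only if that vertex is exceptional.\<close>

lemma delete_free_vertex:
  assumes i: "free_index P Q \<delta> ks i" "\<And>j. j < i \<Longrightarrow> \<not> free_index P Q \<delta> ks j"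
    and c: "Suc (Suc i) < length ks \<Longrightarrow> free_index P Q \<delta> ks (Suc i) \<Longrightarrow> ks ! Suc (Suc i) \<in> Q \<Longrightarrow> ks ! Suc (Suc i) \<in> S"
  shows False
proof -
  note g = gsceneD[OF gs]
  define d where "d = ks ! i"
  have il: "2 \<le> i" "i < length ks" using i(1) unfolding free_index_def by simp_all
  have d: "d \<in> set ks" "d \<in> W" "d \<in> B W" "d \<notin> P" "d \<notin> Q" "\<And>p. p \<in> P \<Longrightarrow> \<delta> p = 1 \<Longrightarrow> \<not> adj E d p"
    using il ks_ring(3,4) index_not_P[OF il] i(1) unfolding d_def free_index_def by auto
  let ?U = "W - {d}" and ?N = "{u \<in> W. adj E d u}"
  let ?Q = "Q \<union> (?N - P)"
  note del = B_deleted[OF ks_ring(5) d(3)]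
  have mixed: False if x: "x \<in> Q" "x \<notin> S" and y: "y \<in> ?N - P" "y \<notin> Q" and a: "adj E x y" for x y
  proof (cases "y \<in> set ks")
    case False
    then show False using two_chord_impossible[OF d(1,4,5) x, of y] y a adj_sym by simp
  next
    case True
    then obtain j where j: "2 \<le> j" "j < length ks" "y = ks ! j" using boundary_index y by blast
    have "x \<in> set ks" "x \<notin> P" using x(1) g(5,6) ks_ring(4) by auto
    then obtain k where k: "2 \<le> k" "k < length ks" "x = ks ! k" using boundary_index by blast
    have ij: "j = Suc i \<or> i = Suc j" using adj_index_rest[OF il(1) j(1) il(2) j(2)] y j(3) unfolding d_def by simp
    have kj: "j = Suc k \<or> k = Suc j" using adj_index_rest[OF k(1) j(1) k(2) j(2)] a j(3) k(3) by simp
    have ki: "k \<noteq> i" using x(1) d(5) k(3) unfolding d_def by auto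
    show False
    proof (cases "j = Suc i")
      case True
      then have "k = Suc (Suc i)" using kj ki by simp
      then have "\<not> free_index P Q \<delta> ks j" using c x k True by auto
      then show False using not_free_index(2)[OF j(1,2)] y(2) j(3) True il \<open>k = Suc (Suc i)\<close> k(2) by auto
    next
      case False
      then have "i = Suc j" "j = Suc k" using ij kj ki by auto
      then show False using not_free_index(2)[OF j(1,2)] i(2)[of j] y(2) j(3) il k(1) by auto
    qed
  qed
  have sc: "gscene ?U P ?Q \<delta> S"
  proof (rule subsceneI[OF gs])
    show "P \<subseteq> B ?U" using g(2) del(2) d(4) by blast
    show "?Q \<subseteq> B ?U" using g(5) del d(5) by blast
    show "?Q \<inter> P = {}" using g(6) by blast
    show "\<not> adj E x y" if q: "x \<in> ?Q" "y \<in> ?Q" "x \<notin> S" "y \<notin> S" for x y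
    proof
      assume a: "adj E x y"
      consider "x \<in> Q" "y \<in> Q" | "x \<in> Q" "y \<notin> Q" | "x \<notin> Q" "y \<in> Q" | "x \<notin> Q" "y \<notin> Q" by blast
      then show False
      proof cases
        case 1
        then show False using g(7)[of x y] q a by simp
      next
        case 2
        then show False using mixed[of x y] q a by simp
      next
        case 3
        then show False using mixed[of y x] q a adj_sym by simp
      next
        case 4
        then show False using no_triangle[of x d y] q a adj_sym by auto
      qed
    qed
  qed auto
  have "?U \<subset> W" using d(2) by blast
  then obtain \<phi> where \<phi>: "good ?U P ?Q \<delta> \<phi>" "S = {} \<Longrightarrow> linkfree ?U P ?Q \<delta> \<phi>"
    using IH[OF _ sc] unfolding solvable_def by blast
  note h = goodD[OF \<phi>(1)]
  \<comment> \<open>A precoloured neighbour of \<open>d\<close> has colour 2 because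
    \<open>d\<close> is free; every other neighbour is in the new \<open>Q\<close>.\<close>
  have n: "\<phi> u = 2" if "u \<in> W" "adj E d u" for u
  proof (cases "u \<in> P")
    case True
    then show ?thesis using h(2)[of u] d(6)[of u] g(8)[of u] that by auto
  qed (use h(3)[of u] that in simp)
  note r = recolour_isolated[OF d(2) n h(4,5)]
  let ?\<phi> = "\<phi>(d := 1)"
  have "good W P Q \<delta> ?\<phi>"
    unfolding good_def
  proof (intro conjI ballI impI)
    show "?\<phi> v = 1 \<or> ?\<phi> v = 2" if "v \<in> W" for v using h(1)[of v] that by auto
    show "?\<phi> v = \<delta> v" if "v \<in> P" for v using h(2)[of v] that d(4) by auto
    show "?\<phi> v = 2" if "v \<in> Q" for v using h(3)[of v] that d(5) by auto
    show "forest (cls W ?\<phi> 1)" "forest (cls W ?\<phi> 2)" using r(1,2) by simp_all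
    show "card (ones W ?\<phi> v) \<le> 3" if "v \<in> W" "?\<phi> v = 1" for v
      using that r(4) r(5)[of v] h(6)[of v] by (cases "v = d") auto
    show "card (ones W ?\<phi> v) \<le> 2" if "v \<in> B W - P" "?\<phi> v = 1" for v
      using that r(4) r(5)[of v] h(8)[of v] del(2)[of v] B_subset[of W] by (cases "v = d") auto
    show "?\<phi> u = 2" if "p \<in> P" "u \<in> W - P" "\<delta> p = 1" "adj E u p" for p u
      using h(7)[of p u] that d(6)[of p] by auto
  qed
  moreover have "linkfree W P Q \<delta> ?\<phi>" if "S = {}"
    unfolding linkfree_def
  proof (intro allI impI)
    fix v u w assume a: "{x \<in> P. \<delta> x = 1} = {v}" "u \<in> Q" "adj E u v" "w \<in> B W" "adj E w v" "w \<noteq> u"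
    then have "v \<in> P" "\<delta> v = 1" by blast+
    then have "w \<noteq> d" using d(6)[of v] a(5) by auto
    then have "\<not> conn (cls ?U \<phi> 2) u w"
      using \<phi>(2)[OF that, unfolded linkfree_def, rule_format, OF a(1) _ a(3) del(2)[OF a(4)] a(5,6)] a(2) by simp
    then show "\<not> conn (cls W ?\<phi> 2) u w" using r(3) by simp
  qed
  ultimately show False using not unfolding solvable_def by blast
qed

text \<open>Both deleted vertices return with colour 1. Of their neighbours put into
  \<open>Q\<close>, two can be adjacent only as the inner vertices \<open>s\<close>,
  \<open>t\<close> of a four-cycle with \<open>a\<close> and \<open>b\<close>. Such a four-cycle
  encloses no vertex by \<open>four_cycle_solvable\<close>, so it is unique by
  \<open>four_cycle_unique\<close>, and omitting its vertex \<open>t\<close> restores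
  independence.\<close>

lemma delete_free_pair:
  assumes i: "free_index P Q \<delta> ks i" "\<And>j. j < i \<Longrightarrow> \<not> free_index P Q \<delta> ks j"
    and c: "Suc (Suc i) < length ks" "free_index P Q \<delta> ks (Suc i)" "ks ! Suc (Suc i) \<in> Q"
  shows False
proof -
  note g = gsceneD[OF gs]
  define a b where "a = ks ! i" and "b = ks ! Suc i"
  have il: "2 \<le> i" "i < length ks" "2 \<le> Suc i" "Suc i < length ks" using i(1) c(1) unfolding free_index_def by simp_all
  have a: "a \<in> set ks" "a \<in> W" "a \<in> B W" "a \<notin> P" "a \<notin> Q" "\<And>p. p \<in> P \<Longrightarrow> \<delta> p = 1 \<Longrightarrow> \<not> adj E a p"
    using il ks_ring(3,4) index_not_P[OF il(1,2)] i(1) unfolding a_def free_index_def by auto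
  have b: "b \<in> set ks" "b \<in> W" "b \<in> B W" "b \<notin> P" "b \<notin> Q" "\<And>p. p \<in> P \<Longrightarrow> \<delta> p = 1 \<Longrightarrow> \<not> adj E b p"
    using il ks_ring(3,4) index_not_P[OF il(3,4)] c(2) unfolding b_def free_index_def by auto
  have ab: "adj E a b" "adj E b a" "a \<noteq> b" using ks_ring(6)[OF il(4)] adj_sym adjD(3) unfolding a_def b_def by auto
  define C where "C s t \<longleftrightarrow> s \<in> W \<and> t \<in> W \<and> s \<notin> set ks \<and> t \<notin> set ks \<and> adj E a s \<and> adj E s t \<and> adj E t b" for s t
  have "t = t'" if C: "C s t" "C s' t'" for s t s' t'
  proof -
    let ?us = "take i ks" and ?ws = "drop (Suc (Suc i)) ks"
    have ks: "ks = ?us @ a # b # ?ws" using list_split_two[of i "Suc i" ks] il unfolding a_def b_def by simp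
    then have rd': "rdisc W (?us @ a # b # ?ws)" using rd by simp
    have e: "W \<inter> inside (loop [a, b] [a, s, t, b]) = {}" if C: "C s t" for s t
    proof (rule ccontr)
      assume ne: "W \<inter> inside (loop [a, b] [a, s, t, b]) \<noteq> {}"
      have m: "s \<notin> set (?us @ a # b # ?ws)" "t \<notin> set (?us @ a # b # ?ws)" using C ks unfolding C_def by metis+
      have "solvable W P Q \<delta> S"
        by (rule four_cycle_solvable[OF IH gs _ rd' _ m(1) _ m(2) _ _ _ _ _ ne])
          (use C a b P in \<open>simp_all add: C_def\<close>)
      then show False using not by simp
    qed
    have m: "s \<notin> set (?us @ a # b # ?ws)" "t \<notin> set (?us @ a # b # ?ws)"
      "s' \<notin> set (?us @ a # b # ?ws)" "t' \<notin> set (?us @ a # b # ?ws)" using C ks unfolding C_def by metis+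
    have m': "s \<in> W" "t \<in> W" "adj E a s" "adj E s t" "adj E t b" "s' \<in> W" "t' \<in> W" "adj E a s'" "adj E s' t'" "adj E t' b"
      using C unfolding C_def by simp_all
    note f = four_cycle_setup[OF rd' m'(1) m(1) m'(2) m(2) m'(3-5)]
    note f' = four_cycle_setup[OF rd' m'(6) m(3) m'(7) m(4) m'(8-10)]
    show "t = t'"
      using four_cycle_unique[OF f(1,2,3) _ f'(2,3) _ e[OF C(1)] e[OF C(2)] f(4,5) f'(4,5)] m' by simp
  qed
  \<comment> \<open>Without such a four-cycle the dummy value \<open>a\<close> omits nothing, since
    \<open>a\<close> is deleted anyway.\<close>
  then obtain t0 where t0: "\<And>s t. C s t \<Longrightarrow> t = t0" "t0 = a \<or> (\<exists>s. C s t0)"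
    by (cases "\<exists>s t. C s t") metis+
  \<comment> \<open>So \<open>b\<close> is the only neighbour of \<open>a\<close> that may have
    colour 1, and a \<open>t0\<close> of colour 1 closes no cycle through \<open>a\<close> and
    \<open>b\<close>.\<close>
  have ta: "\<not> adj E a t0"
    using t0(2) adjD(3)[of a a] no_triangle[of a _ t0] unfolding C_def by blast
  \<comment> \<open>Neighbours of precoloured vertices of colour 1 can be left out of
    \<open>Q\<close>, because (G2) gives them colour 2. This takes care of the boundary vertex
    before \<open>a\<close>, which is not free.\<close>
  define F where "F = {u. \<exists>p\<in>P. \<delta> p = 1 \<and> adj E u p}"
  define M where "M = {u \<in> W. (adj E a u \<or> adj E b u) \<and> u \<noteq> a \<and> u \<noteq> b \<and> u \<notin> P \<and> u \<notin> F \<and> u \<noteq> t0}"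
  let ?U = "W - {a} - {b}"
  have bB: "b \<in> B (W - {a})" using B_deleted(2)[OF ks_ring(5) a(3) b(3)] ab(3) by blast
  note dela = B_deleted[OF ks_ring(5) a(3)]
  have WaV: "W - {a} \<subseteq> V" using ks_ring(5) by blast
  note delb = B_deleted[OF WaV bB]
  have keep: "x \<in> B ?U" if "x \<in> B W" "x \<noteq> a" "x \<noteq> b" for x using dela(2)[of x] delb(2)[of x] that by simp
  have nbrB: "x \<in> B ?U" if "x \<in> W" "adj E a x \<or> adj E b x" "x \<noteq> a" "x \<noteq> b" for x
    using that(2)
  proof
    assume "adj E a x"
    then show ?thesis using dela(1)[of x] delb(2)[of x] that by simp
  next
    assume "adj E b x"
    then show ?thesis using delb(1)[of x] that by simp
  qed
  \<comment> \<open>The only boundary candidates are the vertex before \<open>a\<close>, which by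
    minimality of \<open>i\<close> is in \<open>Q\<close> or in \<open>F\<close>, and the vertex
    after \<open>b\<close>, which is in \<open>Q\<close>.\<close>
  have MQ: "u \<in> Q" if u: "u \<in> M" "u \<in> set ks" for u
  proof (rule ccontr)
    assume uQ: "u \<notin> Q"
    obtain j where j: "2 \<le> j" "j < length ks" "u = ks ! j" using boundary_index u unfolding M_def by blast
    have jn: "j \<noteq> i" "j \<noteq> Suc i" using u(1) j(3) unfolding M_def a_def b_def by auto
    have "adj E (ks ! i) (ks ! j) \<or> adj E (ks ! Suc i) (ks ! j)" using u(1) j(3) unfolding M_def a_def b_def by simp
    then have "i = Suc j \<or> j = Suc (Suc i)"
      using adj_index_rest[OF il(1) j(1) il(2) j(2)] adj_index_rest[OF il(3) j(1) il(4) j(2)] jn by auto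
    then show False
    proof
      assume "i = Suc j"
      then show False using not_free_index(1)[OF j(1,2)] i(2)[of j] uQ j(3) u(1) unfolding M_def F_def by auto
    qed (use uQ c(3) j(3) in simp)
  qed
  have mixed: False if x: "x \<in> Q" "x \<notin> S" and y: "y \<in> M" "y \<notin> Q" and e: "adj E x y" for x y
  proof -
    have "y \<in> W" "y \<notin> set ks" "adj E a y \<or> adj E b y" using y MQ unfolding M_def by blast+
    moreover have "adj E y x" using e adj_sym by simp
    ultimately show False
      using two_chord_impossible[OF a(1,4,5) x, of y] two_chord_impossible[OF b(1,4,5) x, of y] by blast
  qed
  have conflict: False if "x \<in> M" "y \<in> M" "x \<notin> Q" "y \<notin> Q" "adj E a x" "adj E b y" "adj E x y" for x y
  proof -
    have "C x y" using that MQ[of x] MQ[of y] adj_sym unfolding C_def M_def by auto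
    then show False using t0(1) that(2) unfolding M_def by blast
  qed
  have sc: "gscene ?U P (Q \<union> M) \<delta> S"
  proof (rule subsceneI[OF gs])
    show "P \<subseteq> B ?U" using g(2) keep a(4) b(4) by blast
    show "Q \<union> M \<subseteq> B ?U" using g(5) keep nbrB a(5) b(5) unfolding M_def by blast
    show "(Q \<union> M) \<inter> P = {}" using g(6) unfolding M_def by blast
    show "\<not> adj E x y" if q: "x \<in> Q \<union> M" "y \<in> Q \<union> M" "x \<notin> S" "y \<notin> S" for x y
    proof
      assume e: "adj E x y"
      then have e': "adj E y x" using adj_sym by simp
      consider "x \<in> Q" "y \<in> Q" | "x \<in> Q" "y \<notin> Q" | "x \<notin> Q" "y \<in> Q" | "x \<notin> Q" "y \<notin> Q" by blast
      then show False
      proof cases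
        case 1
        then show False using g(7)[of x y] q e by simp
      next
        case 2
        then show False using mixed[of x y] q e by simp
      next
        case 3
        then show False using mixed[of y x] q e' by simp
      next
        case 4
        then have m: "x \<in> M" "y \<in> M" using q by simp_all
        then have "adj E a x \<or> adj E b x" "adj E a y \<or> adj E b y" unfolding M_def by simp_all
        then show False
          using conflict[OF m 4 _ _ e] conflict[OF m(2,1) 4(2,1) _ _ e'] no_triangle[of a x y] no_triangle[of b x y] e by meson
      qed
    qed
  qed auto
  have "?U \<subset> W" using a(2) by blast
  then obtain \<phi> where \<phi>: "good ?U P (Q \<union> M) \<delta> \<phi>" "S = {} \<Longrightarrow> linkfree ?U P (Q \<union> M) \<delta> \<phi>"
    using IH[OF _ sc] unfolding solvable_def by blast
  note h = goodD[OF \<phi>(1)]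
  have n: "\<phi> u = 2" if u: "u \<in> W" "adj E a u \<or> adj E b u" "u \<noteq> a" "u \<noteq> b" "u \<noteq> t0" for u
  proof -
    consider "u \<in> P" | "u \<notin> P" "u \<in> F" | "u \<in> M" using u unfolding M_def by blast
    then show ?thesis
    proof cases
      case 1
      then show ?thesis using h(2)[of u] a(6)[of u] b(6)[of u] g(8)[of u] u(2) by auto
    next
      case 2
      then show ?thesis using h(7)[of _ u] u unfolding F_def by blast
    qed (use h(3)[of u] in simp)
  qed
  let ?\<phi>1 = "\<phi>(b := 1)"
  let ?\<phi> = "?\<phi>1(a := 1)"
  have bU: "b \<in> W - {a}" using b(2) ab(3) by simp
  have nb: "\<forall>u\<in>W - {a}. adj E b u \<longrightarrow> u \<noteq> t0 \<longrightarrow> \<phi> u = 2"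
    using n adjD(3)[of b] by auto
  note r1 = recolour_leaf[OF bU nb h(4,5)]
  have na: "\<forall>u\<in>W. adj E a u \<longrightarrow> u \<noteq> b \<longrightarrow> ?\<phi>1 u = 2"
    using n adjD(3)[of a] ta by auto
  note r2 = recolour_leaf[OF a(2) na r1(1,2)]
  have c2: "cls W ?\<phi> 2 = cls ?U \<phi> 2" using r1(3) r2(3) by simp
  have fin: "finite A" if "A \<subseteq> W" for A using finite_subset[OF that finite_subset[OF ks_ring(5) finite_V]] .
  have onea: "card (ones W ?\<phi> a) \<le> 2" using card_mono[OF _ r2(4)] by simp
  \<comment> \<open>At most \<open>a\<close> and \<open>t0\<close> have colour 1 among the
    neighbours of \<open>b\<close>, just as many as (G4) allows.\<close>
  have oneb: "card (ones W ?\<phi> b) \<le> 2"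
  proof -
    have "ones W ?\<phi> b \<subseteq> {a, t0}" using r2(5) r1(4) by blast
    then show ?thesis using card_mono[of "{a, t0}"] card_doubleton_le[of a t0] by (meson finite.emptyI finite_insert le_trans)
  qed
  have oner: "ones W ?\<phi> v = ones ?U \<phi> v" if "v \<in> W" "v \<noteq> a" "v \<noteq> b" "v \<noteq> t0" "\<phi> v = 1" for v
    using r2(6)[of v] r1(6)[of v] that by simp
  \<comment> \<open>The deletion of \<open>b\<close> exposes \<open>t0\<close>, so (G4) allows it
    two neighbours of colour 1; with \<open>b\<close> there are three, which suffices as
    \<open>t0\<close> is an inner vertex of \<open>W\<close>.\<close>
  have onet: "card (ones W ?\<phi> t0) \<le> 3" if t: "t0 \<noteq> a" "\<phi> t0 = 1"
  proof -
    obtain s where C: "C s t0" using t0(2) t(1) by blast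
    then have ct: "t0 \<in> W" "t0 \<notin> set ks" "adj E t0 b" "t0 \<noteq> b" using b(1) unfolding C_def by auto
    then have "t0 \<in> B ?U" using nbrB[of t0] t(1) adj_sym by simp
    moreover have "t0 \<notin> P" using ct(2) p_facts(1,2) P by auto
    ultimately have "card (ones ?U \<phi> t0) \<le> 2" using h(8)[of t0] t(2) by simp
    moreover have "ones W ?\<phi> t0 \<subseteq> insert b (ones ?U \<phi> t0)" using r2(6)[of t0] r1(5) ct t by simp
    moreover have "finite (ones ?U \<phi> t0)" by (rule fin) (auto simp: ones_def)
    ultimately show ?thesis
      using card_mono[of "insert b (ones ?U \<phi> t0)" "ones W ?\<phi> t0"] card_insert_le_m1[of 3 "ones ?U \<phi> t0" b] by simp
  qed
  have "good W P Q \<delta> ?\<phi>"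
    unfolding good_def
  proof (intro conjI ballI impI)
    show "?\<phi> v = 1 \<or> ?\<phi> v = 2" if "v \<in> W" for v using h(1)[of v] that by auto
    show "?\<phi> v = \<delta> v" if "v \<in> P" for v using h(2)[of v] that a(4) b(4) by auto
    show "?\<phi> v = 2" if "v \<in> Q" for v using h(3)[of v] that a(5) b(5) by auto
    show "forest (cls W ?\<phi> 1)" "forest (cls W ?\<phi> 2)" using r2(1,2) by simp_all
    show "card (ones W ?\<phi> v) \<le> 3" if v: "v \<in> W" "?\<phi> v = 1" for v
    proof (cases "v = a \<or> v = b")
      case True
      then show ?thesis using onea oneb by auto
    next
      case False
      then show ?thesis using v onet oner[of v] h(6)[of v] by (cases "v = t0") auto
    qed
    show "card (ones W ?\<phi> v) \<le> 2" if v: "v \<in> B W - P" "?\<phi> v = 1" for v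
    proof (cases "v = a \<or> v = b")
      case True
      then show ?thesis using onea oneb by auto
    next
      case False
      have "v \<noteq> t0" using t0(2) False v(1) ks_ring(4) unfolding C_def by blast
      then show ?thesis using v oner[of v] h(8)[of v] False keep[of v] B_subset[of W] by auto
    qed
    show "?\<phi> u = 2" if "p \<in> P" "u \<in> W - P" "\<delta> p = 1" "adj E u p" for p u
      using h(7)[of p u] that a(6)[of p] b(6)[of p] by auto
  qed
  moreover have "linkfree W P Q \<delta> ?\<phi>" if "S = {}"
    unfolding linkfree_def
  proof (intro allI impI)
    fix v u w assume l: "{x \<in> P. \<delta> x = 1} = {v}" "u \<in> Q" "adj E u v" "w \<in> B W" "adj E w v" "w \<noteq> u"
    then have "v \<in> P" "\<delta> v = 1" by blast+
    then have "w \<noteq> a" "w \<noteq> b" using a(6)[of v] b(6)[of v] l(5) by auto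
    then have "\<not> conn (cls ?U \<phi> 2) u w"
      using \<phi>(2)[OF that, unfolded linkfree_def, rule_format, OF l(1) _ l(3) keep[OF l(4)] l(5,6)] l(2) by simp
    then show "\<not> conn (cls W ?\<phi> 2) u w" using c2 by simp
  qed
  ultimately show False using not unfolding solvable_def by blast
qed

lemma no_free_index: "\<not> free_index P Q \<delta> ks j"
proof
  assume "free_index P Q \<delta> ks j"
  then obtain i where i: "free_index P Q \<delta> ks i" "\<And>j. j < i \<Longrightarrow> \<not> free_index P Q \<delta> ks j"
    by (metis exists_least_iff)
  show False using delete_free_vertex[OF i] delete_free_pair[OF i] by blast
qed

text \<open>\<open>d\<close> returns as a leaf attached to \<open>e\<close>. The smaller scene may
  precolour further vertices with 2; together with (G2) this leaves \<open>e\<close> without any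
  other neighbour of colour 1. With two precoloured vertices of colour 1, (G3) demands
  nothing.\<close>

lemma delete_first_of_two:
  assumes "P = {d, e}" "d \<noteq> e" "\<delta> d = 1" "\<delta> e = 1" "S = {}"
    and h0: "good (W - {d}) P' Q' \<delta>' \<phi>" and P': "e \<in> P'" "\<delta>' e = 1" "\<And>v. v \<in> P' - {e} \<Longrightarrow> \<delta>' v = 2"
    and Q': "{u \<in> W. adj E d u} - {e} \<subseteq> Q'" "Q \<subseteq> Q'"
  shows False
proof -
  note g = gsceneD[OF gs] and h = goodD[OF h0]
  have d: "d \<in> W" "d \<in> B W" using g(2,10) assms(1) by auto
  have n: "\<forall>u\<in>W. adj E d u \<longrightarrow> u \<noteq> e \<longrightarrow> \<phi> u = 2" using h(3) Q'(1) by auto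
  note r = recolour_leaf[OF d(1) n h(4,5)]
  let ?\<phi> = "\<phi>(d := 1)"
  have e1: "\<phi> e = 1" using h(2)[OF P'(1)] P'(2) by simp
  have nbr: "\<phi> u = 2" if "u \<in> W - {d}" "adj E u e" for u
  proof (cases "u \<in> P'")
    case True
    then have "u \<in> P' - {e}" using adjD(3)[OF that(2)] by simp
    then show ?thesis using h(2)[of u] P'(3)[of u] by simp
  qed (use h(7)[OF P'(1,2), of u] that in simp)
  have oned: "card (ones W ?\<phi> d) \<le> 2" using card_mono[OF _ r(4)] by simp
  have onee: "card (ones W ?\<phi> e) \<le> 2"
  proof -
    have "ones (W - {d}) \<phi> e = {}" using nbr unfolding ones_def by auto
    then show ?thesis using card_mono[OF _ r(5)] by simp
  qed
  have oner: "ones W ?\<phi> v = ones (W - {d}) \<phi> v" if "v \<in> W" "v \<noteq> d" "v \<noteq> e" "?\<phi> v = 1" for v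
    using r(6)[of v] that by simp
  have "good W P Q \<delta> ?\<phi>"
    unfolding good_def
  proof (intro conjI ballI impI)
    show "?\<phi> v = 1 \<or> ?\<phi> v = 2" if "v \<in> W" for v using h(1)[of v] that by auto
    show "?\<phi> v = \<delta> v" if "v \<in> P" for v using that assms(1-4) e1 by auto
    show "?\<phi> v = 2" if "v \<in> Q" for v using h(3)[of v] that Q'(2) g(6) assms(1) by auto
    show "forest (cls W ?\<phi> 1)" "forest (cls W ?\<phi> 2)" using r(1,2) by simp_all
    show "card (ones W ?\<phi> v) \<le> 3" if "v \<in> W" "?\<phi> v = 1" for v
    proof (cases "v = d \<or> v = e")
      case True
      then show ?thesis using oned onee by auto
    next
      case False
      then show ?thesis using oner[of v] h(6)[of v] that by simp
    qed
    show "card (ones W ?\<phi> v) \<le> 2" if v: "v \<in> B W - P" "?\<phi> v = 1" for v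
    proof -
      have v': "v \<in> W" "v \<noteq> d" "v \<noteq> e" "\<phi> v = 1" using v assms(1) B_subset[of W] by auto
      then have "v \<notin> P'" using h(2)[of v] P'(3)[of v] by auto
      moreover have "v \<in> B (W - {d})" using B_deleted(2)[OF g(1) d(2), of v] v v'(2) by simp
      ultimately show ?thesis using h(8)[of v] oner[of v] v v' by simp
    qed
    show "?\<phi> u = 2" if p: "p \<in> P" "u \<in> W - P" "\<delta> p = 1" "adj E u p" for p u
    proof -
      have u: "u \<in> W" "u \<noteq> d" "u \<noteq> e" using p(2) assms(1) by auto
      have "p = d \<or> p = e" using p(1) assms(1) by simp
      then have "\<phi> u = 2" using n nbr[of u] u p(4) adj_sym by auto
      then show ?thesis using u by simp
    qed
  qed
  moreover have "linkfree W P Q \<delta> ?\<phi>"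
  proof -
    have "{x \<in> P. \<delta> x = 1} \<noteq> {v}" for v
    proof
      assume "{x \<in> P. \<delta> x = 1} = {v}"
      moreover have "{x \<in> P. \<delta> x = 1} = {d, e}" using assms(1-4) by auto
      ultimately show False using assms(2) by (metis insertCI singletonD)
    qed
    then show ?thesis unfolding linkfree_def by blast
  qed
  ultimately show False using not unfolding solvable_def by blast
qed

lemma neighbours_scene:
  assumes "d \<in> B W" "card P' \<le> 2" "P' \<subseteq> B W - {d}" "\<And>x y. x \<in> P' \<Longrightarrow> y \<in> P' \<Longrightarrow> x \<noteq> y \<Longrightarrow> adj E x y"
    and "\<And>v. v \<in> P' \<Longrightarrow> \<delta>' v = 1 \<or> \<delta>' v = 2"
  obtains \<phi> where "good (W - {d}) P' ({u \<in> W. adj E d u} - P') \<delta>' \<phi>"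
proof -
  have "gscene (W - {d}) P' ({u \<in> W. adj E d u} - P') \<delta>' {}"
  proof (rule normal_sceneI)
    show "W - {d} \<subseteq> V" using ks_ring(5) by blast
    show "P' \<subseteq> B (W - {d})" using B_deleted(2)[OF ks_ring(5) assms(1)] assms(3) by blast
    show "{u \<in> W. adj E d u} - P' \<subseteq> B (W - {d})" using B_deleted(1)[OF ks_ring(5) assms(1)] by blast
    show "\<not> adj E x y" if "x \<in> {u \<in> W. adj E d u} - P'" "y \<in> {u \<in> W. adj E d u} - P'" for x y
      using that no_triangle[of x d y] adj_sym by auto
  qed (use assms in auto)
  moreover have "W - {d} \<subset> W" using assms(1) B_subset[of W] by blast
  ultimately have "solvable (W - {d}) P' ({u \<in> W. adj E d u} - P') \<delta>' {}" using IH by blast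
  then show ?thesis using that unfolding solvable_def by blast
qed

lemma forced_index: "2 \<le> j \<Longrightarrow> j < length ks \<Longrightarrow> ks ! j \<notin> Q \<Longrightarrow>
    Suc j = length ks \<and> \<delta> p0 = 1 \<or> j = 2 \<and> \<delta> p0 = 1 \<and> \<delta> p1 = 1"
  by (rule not_free_index(2)[OF _ _ no_free_index])

lemma Q_consecutive: "Suc j < length ks \<Longrightarrow> ks ! j \<in> Q \<Longrightarrow> ks ! Suc j \<in> Q \<Longrightarrow> ks ! j \<in> S \<or> ks ! Suc j \<in> S"
  using gsceneD(7)[OF gs, of "ks ! j" "ks ! Suc j"] ks_ring(6)[of j] by blast

text \<open>If both precoloured vertices had colour 2, all other boundary vertices would be in
  \<open>Q\<close>, among them two consecutive ones.\<close>

lemma first_colour_one: "\<delta> p0 = 1"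
proof (rule ccontr)
  assume n: "\<delta> p0 \<noteq> 1"
  then have "S = {}" using exceptional by blast
  moreover have "Suc (Suc 0) < length ks" "Suc 2 < length ks" using ks_ring(1) by linarith+
  ultimately show False using Q_consecutive[of 2] forced_index[of 2] forced_index[of "Suc 2"] n by auto
qed

text \<open>With colours 1, 2 every position from 2 to the last but one is in \<open>Q\<close>, so
  the outer cycle is short. Then \<open>p0\<close> is deleted and the rest is coloured so that all
  remaining boundary vertices have colour 2: (G4) holds trivially, and \<open>p0\<close> can return
  with colour 1.\<close>

lemma second_colour_not_two: "\<delta> p1 \<noteq> 2"
proof
  assume d1: "\<delta> p1 = 2"
  note g = gsceneD[OF gs]
  let ?n = "length ks"
  have inQ: "ks ! j \<in> Q" if "2 \<le> j" "j \<le> ?n - 2" for j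
  proof (rule ccontr)
    have "j < ?n" "Suc j \<noteq> ?n" using that(2) ks_ring(1) by linarith+
    moreover assume "ks ! j \<notin> Q"
    ultimately show False using forced_index[of j] that(1) d1 by simp
  qed
  \<comment> \<open>The exceptional vertex is in \<open>Q\<close> and adjacent to \<open>p1\<close>,
    so it can only be at position 2. From position 3 on \<open>Q\<close> is independent.\<close>
  have S: "ks ! j \<notin> S" if "2 < j" "j < ?n" for j
  proof
    assume s: "ks ! j \<in> S"
    then have "adj E p1 (ks ! j)" "ks ! j \<in> Q" using exceptional by auto
    then show False using adj_index_P1[of j] that adj_sym by auto
  qed
  have n: "?n \<le> 5"
  proof (rule ccontr)
    assume "\<not> ?n \<le> 5"
    then show False using Q_consecutive[of 3] inQ[of 3] inQ[of "Suc 3"] S[of 3] S[of "Suc 3"] by simp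
  qed
  have p0: "p0 \<in> B W" "p0 \<in> W" "p1 \<in> W" using p_facts ks_ring(3,4) by auto
  \<comment> \<open>Counted from the end, these are \<open>p1\<close> and the next vertex in a
    quadrangle, and the positions 2 and 3 in a pentagon. The boundary vertices other than
    \<open>a\<close>, \<open>b\<close> and \<open>p0\<close> are neighbours of
    \<open>p0\<close>.\<close>
  define a b where "a = ks ! (?n - 3)" and "b = ks ! (?n - 2)"
  have l: "?n - 3 < ?n" "?n - 2 < ?n" "?n - 3 \<noteq> 0" "?n - 2 \<noteq> 0" "?n - 2 = Suc (?n - 3)" "0 < ?n" using ks_ring(1) by linarith+
  have ab: "a \<in> set ks" "b \<in> set ks" "a \<noteq> p0" "b \<noteq> p0" "adj E a b"
    using l nth_eq_iff_index_eq[OF ks_ring(2) l(1,6)] nth_eq_iff_index_eq[OF ks_ring(2) l(2,6)] k ks_ring(6)[of "?n - 3"]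
    unfolding a_def b_def by simp_all
  obtain \<phi> where h0: "good (W - {p0}) {a, b} ({u \<in> W. adj E p0 u} - {a, b}) (\<lambda>_. 2) \<phi>"
  proof (rule neighbours_scene[OF p0(1), of "{a, b}" "\<lambda>_. 2"])
    show "card {a, b} \<le> 2" by (rule card_doubleton_le)
    show "{a, b} \<subseteq> B W - {p0}" using ab ks_ring(4) by simp
    show "adj E x y" if "x \<in> {a, b}" "y \<in> {a, b}" "x \<noteq> y" for x y using that ab(5) adj_sym by auto
  qed auto
  note h = goodD[OF h0]
  have nb: "\<phi> u = 2" if "u \<in> W" "adj E p0 u" for u using h(2)[of u] h(3)[of u] that by blast
  have bd: "\<phi> u = 2" if u: "u \<in> set ks" "u \<noteq> p0" for u
  proof -
    obtain j where j: "j < ?n" "u = ks ! j" using u(1) by (metis in_set_conv_nth)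
    have "j \<noteq> 0" using u(2) j(2) k(1) by (cases "j = 0") simp_all
    then have "j = Suc 0 \<or> j = ?n - 3 \<or> j = ?n - 2 \<or> j = ?n - 1" using n ks_ring(1) j(1) by linarith
    then consider "u = p1" | "u = a" | "u = b" | "u = ks ! (?n - 1)" using j(2) k a_def b_def by auto
    then show ?thesis
    proof cases
      case 1
      then show ?thesis using nb[of p1] p0 p_facts by simp
    next
      case 4
      then show ?thesis using nb[of u] ks_ring(3,7) u(1) adj_sym by auto
    qed (use h(2) in auto)
  qed
  note r = recolour_isolated[OF p0(2) nb h(4,5)]
  let ?\<phi> = "\<phi>(p0 := 1)"
  have "good W P Q \<delta> ?\<phi>"
    unfolding good_def
  proof (intro conjI ballI impI)
    show "?\<phi> v = 1 \<or> ?\<phi> v = 2" if "v \<in> W" for v using h(1)[of v] that by auto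
    show "?\<phi> v = \<delta> v" if "v \<in> P" for v using that bd[of p1] p_facts(2,3) first_colour_one d1 P by auto
    show "?\<phi> v = 2" if "v \<in> Q" for v using bd[of v] that g(5,6) ks_ring(4) P by auto
    show "forest (cls W ?\<phi> 1)" "forest (cls W ?\<phi> 2)" using r(1,2) by simp_all
    show "card (ones W ?\<phi> v) \<le> 3" if "v \<in> W" "?\<phi> v = 1" for v
      using that r(4) r(5)[of v] h(6)[of v] by (cases "v = p0") auto
    show "card (ones W ?\<phi> v) \<le> 2" if "v \<in> B W - P" "?\<phi> v = 1" for v
      using that bd[of v] P ks_ring(4) by auto
    show "?\<phi> u = 2" if "p \<in> P" "u \<in> W - P" "\<delta> p = 1" "adj E u p" for p u
      using that nb[of u] d1 P adj_sym by auto
  qed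
  moreover have "linkfree W P Q \<delta> ?\<phi>" if Se: "S = {}"
    unfolding linkfree_def
  proof (intro allI impI)
    fix v u w assume a: "{x \<in> P. \<delta> x = 1} = {v}" "u \<in> Q" "adj E u v"
    have "{x \<in> P. \<delta> x = 1} = {p0}" using P first_colour_one d1 by auto
    then have v: "v = p0" using a(1) by simp
    \<comment> \<open>(G3) has nothing to exclude: a vertex of \<open>Q\<close> adjacent to
      \<open>p0\<close> would be the last one of the list, and its predecessor is in
      \<open>Q\<close> too.\<close>
    obtain j where j: "2 \<le> j" "j < ?n" "u = ks ! j" using boundary_index[of u] a(2) g(5,6) ks_ring(4) by blast
    then have "Suc j = ?n" using adj_index_P0[of j] a(3) v by simp
    then have "j = Suc (?n - 2)" "2 \<le> ?n - 2" using ks_ring(1) by linarith+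
    then have False using Q_consecutive[of "?n - 2"] inQ[of "?n - 2"] a(2) j Se by auto
    then show "\<not> conn (cls W ?\<phi> 2) u w" ..
  qed
  ultimately show False using not unfolding solvable_def by blast
qed

text \<open>The colours 1, 1 are left. The positions from 3 to the last but one are in
  \<open>Q\<close>, which bounds the length by five. In a quadrangle \<open>Q\<close> has at most
  one vertex, since its two candidates are adjacent, and the precoloured vertex next to it is
  deleted, so that it is among the neighbours that get colour 2.\<close>

lemma impossible: False
proof -
  note g = gsceneD[OF gs]
  let ?n = "length ks"
  have d: "\<delta> p0 = 1" "\<delta> p1 = 1" "S = {}" using first_colour_one second_colour_not_two p_facts(6) exceptional by auto
  have inQ: "ks ! j \<in> Q" if "3 \<le> j" "Suc j < ?n" for j using forced_index[of j] that by auto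
  have "?n \<le> 5"
  proof (rule ccontr)
    assume "\<not> ?n \<le> 5"
    then show False using Q_consecutive[of 3] inQ[of 3] inQ[of "Suc 3"] d(3) by simp
  qed
  then consider "?n = 4" | "?n = 5" using ks_ring(1) by linarith
  then show False
  proof cases
    case 1
    have B: "p0 \<in> B W" "p1 \<in> B W" using p_facts(1,2) ks_ring(4) by simp_all
    have Q: "Q \<subseteq> {ks ! 2, ks ! 3}"
    proof
      fix q assume "q \<in> Q"
      then obtain j where j: "2 \<le> j" "j < ?n" "q = ks ! j" using boundary_index[of q] g(5,6) ks_ring(4) by blast
      then have "j = 2 \<or> j = 3" using 1 by linarith
      then show "q \<in> {ks ! 2, ks ! 3}" using j(3) by auto
    qed
    have n: "adj E p1 (ks ! 2)" "adj E p0 (ks ! 3)"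
      using ks_ring(6)[of "Suc 0"] ks_ring(7) k 1 adj_sym by (simp_all add: numeral_2_eq_2)
    have W: "ks ! 2 \<in> W" "ks ! 3 \<in> W" using ks_ring(3) 1 by (auto simp: subset_iff)
    have del: False if de: "P = {x, e}" "x \<noteq> e" "x \<in> B W" "e \<in> B W" "\<delta> x = 1" "\<delta> e = 1" "Q \<subseteq> {u \<in> W. adj E x u} - {e}" for x e
    proof -
      obtain \<phi> where "good (W - {x}) {e} ({u \<in> W. adj E x u} - {e}) \<delta> \<phi>"
        by (rule neighbours_scene[of x "{e}" \<delta>]) (use de in auto)
      then show False by (rule delete_first_of_two[OF de(1,2,5,6) d(3)]) (use de in auto)
    qed
    show False
    proof (cases "ks ! 3 \<in> Q")
      case True
      then have "ks ! 2 \<notin> Q" using Q_consecutive[of 2] 1 d(3) by (auto simp: numeral_3_eq_3 numeral_2_eq_2)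
      then have "Q \<subseteq> {ks ! 3}" using Q by blast
      then have "Q \<subseteq> {u \<in> W. adj E p0 u} - {p1}" using n W g(6) P by auto
      then show False using del[of p0 p1] P p_facts(3) B d by simp
    next
      case False
      then have "Q \<subseteq> {ks ! 2}" using Q by blast
      then have "Q \<subseteq> {u \<in> W. adj E p1 u} - {p0}" using n W g(6) P by auto
      moreover have "P = {p1, p0}" using P by auto
      ultimately show False using del[of p1 p0] p_facts(3) B d by simp
    qed
  next
    case 2
    \<comment> \<open>In a pentagon \<open>Q\<close> consists of \<open>?q\<close>, the vertex
      opposite to the precoloured edge. It is no neighbour of \<open>p0\<close> and has to be added
      to the new \<open>Q\<close>, where the last vertex of the pentagon, a neighbour of both
      \<open>p0\<close> and \<open>?q\<close>, is adjacent to it. So \<open>?q\<close> becomes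
      exceptional.\<close>
    let ?q = "ks ! 3" and ?c = "ks ! 2"
    have l: "2 < ?n" "3 < ?n" using 2 by linarith+
    have q: "?q \<in> Q" using inQ[of 3] 2 by simp
    have e: "adj E p1 ?c" "adj E ?c ?q"
      using ks_ring(6)[of "Suc 0"] ks_ring(6)[of 2] k 2 by (simp_all add: numeral_2_eq_2 numeral_3_eq_3)
    have c: "?c \<notin> Q" using g(7)[of ?c ?q] e(2) q d(3) by auto
    have Q: "Q \<subseteq> {?q}"
    proof
      fix x assume x: "x \<in> Q"
      then obtain j where j: "2 \<le> j" "j < ?n" "x = ks ! j" using boundary_index[of x] g(5,6) ks_ring(4) by blast
      then have "j = 2 \<or> j = 3 \<or> j = Suc 3" using 2 by linarith
      moreover have "j \<noteq> 2" using c x j(3) by auto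
      moreover have "j \<noteq> Suc 3" using Q_consecutive[of 3] q x j 2 d(3) by auto
      ultimately show "x \<in> {?q}" using j(3) by auto
    qed
    have mem: "?q \<in> B W" "?c \<in> B W" "p1 \<in> B W" "p0 \<in> B W" using l p_facts(1,2) ks_ring(4) by simp_all
    have nP: "?q \<notin> P" "?c \<notin> P" using index_not_P[of 2] index_not_P[of 3] l by simp_all
    have c0: "\<not> adj E p0 ?c" using adj_index_P0[of 2] l adj_sym 2 by auto
    have ne: "p1 \<noteq> ?c" "?q \<noteq> ?c" "?q \<noteq> p1" "?q \<noteq> p0" "?c \<noteq> p0" "p1 \<noteq> p0" using adjD(3)[OF e(1)] adjD(3)[OF e(2)] nP P p_facts(3) by auto
    let ?N = "{u \<in> W. adj E p0 u} - {p1}"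
    let ?\<delta> = "(\<lambda>_. 2)(p1 := 1)"
    note del = B_deleted[OF ks_ring(5) mem(4)]
    \<comment> \<open>Colour 2 on \<open>?c\<close> is what (G2) at \<open>p1\<close> would force
      anyway; precoloured, \<open>?c\<close> is the neighbour of colour 2 that an exceptional vertex
      must have.\<close>
    have "gscene (W - {p0}) {p1, ?c} (insert ?q ?N) ?\<delta> {?q}"
      unfolding gscene_def
    proof (intro conjI)
      show "W - {p0} \<subseteq> V" using ks_ring(5) by blast
      show "{p1, ?c} \<subseteq> B (W - {p0})" using del(2) mem ne by simp
      show "card {p1, ?c} \<le> 2" by (rule card_doubleton_le)
      show "\<forall>x\<in>{p1, ?c}. \<forall>y\<in>{p1, ?c}. x \<noteq> y \<longrightarrow> adj E x y" using e(1) adj_sym by auto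
      show "insert ?q ?N \<subseteq> B (W - {p0}) - {p1, ?c}" using del mem ne c0 by auto
      show "\<forall>x\<in>insert ?q ?N - {?q}. \<forall>y\<in>insert ?q ?N - {?q}. \<not> adj E x y"
        using no_triangle[of _ p0] adj_sym by auto
      show "\<forall>v\<in>{p1, ?c}. ?\<delta> v = 1 \<or> ?\<delta> v = 2" by simp
      have "{p1, ?c} = {p1, ?c} \<and> p1 \<noteq> ?c \<and> ?\<delta> p1 = 1 \<and> ?\<delta> ?c = 2 \<and> {?q} = {?q} \<and> ?q \<in> insert ?q ?N \<and> adj E ?c ?q"
        using ne e(2) by simp
      then show "{?q} = {} \<or> (\<exists>x y q. {p1, ?c} = {x, y} \<and> x \<noteq> y \<and> ?\<delta> x = 1 \<and> ?\<delta> y = 2 \<and> {?q} = {q} \<and> q \<in> insert ?q ?N \<and> adj E y q)"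
        by blast
    qed
    moreover have "W - {p0} \<subset> W" using mem(4) B_subset[of W] by blast
    ultimately have "solvable (W - {p0}) {p1, ?c} (insert ?q ?N) ?\<delta> {?q}" using IH by blast
    then obtain \<phi> where h0: "good (W - {p0}) {p1, ?c} (insert ?q ?N) ?\<delta> \<phi>" unfolding solvable_def by blast
    show False
      by (rule delete_first_of_two[OF P _ d(1,2,3) h0]) (use ne Q in auto)
  qed
qed

end

context triangle_free_drawing
begin

section \<open>The induction\<close>

lemma outer_cycle_or_solvable:
  assumes IH: "\<And>W' P' Q' \<delta>' S'. W' \<subset> W \<Longrightarrow> gscene W' P' Q' \<delta>' S' \<Longrightarrow> solvable W' P' Q' \<delta>' S'"
    and gs: "gscene W P Q \<delta> S" and "P \<noteq> {}" and not: "\<not> solvable W P Q \<delta> S"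
  obtains ks where "rdisc W ks"
proof -
  have "card W \<ge> 3" using small_solvable[OF gs] not by linarith
  then have "\<exists>ks. rdisc W ks"
    using outer_cycle_exists[of W] biconnected_or_solvable[OF IH gs assms(3) not] gsceneD(1)[OF gs] by blast
  then show ?thesis using that by blast
qed

lemma rdisc_last:
  assumes "rdisc W (x # ys)"
  shows "length ys \<ge> 2" "adj E x (last ys)" "adj E x (hd ys)" "hd ys \<noteq> last ys"
proof -
  have r: "ring W (x # ys)" using assms unfolding rdisc_def by simp
  then show l: "length ys \<ge> 2" unfolding ring_def by simp
  then obtain a b zs where ys: "ys = a # b # zs" by (cases ys; cases "tl ys") auto
  then show "adj E x (last ys)" "adj E x (hd ys)" using r adj_sym unfolding ring_def by auto
  have "a \<notin> set (b # zs)" using r ys unfolding ring_def by simp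
  then show "hd ys \<noteq> last ys" using last_in_set[of "b # zs"] ys by auto
qed

lemma pair_solvable:
  assumes IH: "\<And>W' P' Q' \<delta>' S'. W' \<subset> W \<Longrightarrow> gscene W' P' Q' \<delta>' S' \<Longrightarrow> solvable W' P' Q' \<delta>' S'"
    and gs: "gscene W P Q \<delta> S" and P: "card P = 2"
  shows "solvable W P Q \<delta> S"
proof (rule ccontr)
  assume not: "\<not> solvable W P Q \<delta> S"
  note g = gsceneD[OF gs]
  obtain x y where xy: "P = {x, y}" "x \<noteq> y" "\<delta> x = 1 \<or> \<delta> y = 2"
  proof -
    obtain x y where xy: "P = {x, y}" "x \<noteq> y" using P by (auto simp: card_2_iff)
    then have "\<delta> x = 1 \<or> \<delta> x = 2" "P = {y, x}" using g(8)[of x] by auto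
    then show ?thesis using that[of x y] that[of y x] xy by metis
  qed
  have ne: "P \<noteq> {}" using xy by simp
  have e: "adj E x y" using g(4) xy by simp
  obtain ks where ks: "rdisc W ks" by (rule outer_cycle_or_solvable[OF IH gs ne not])
  have "x \<in> set ks" using g(2) xy(1) B_rdisc[OF ks] by auto
  then obtain ys where ys: "rdisc W (x # ys)" "rdisc W (x # rev ys)" "set (x # ys) = set ks"
    by (rule rdisc_rotate_to[OF ks])
  have "y \<in> set ys" using g(2) xy B_rdisc[OF ks] ys(3) by auto
  then obtain vs ws where s: "ys = vs @ y # ws" using split_list by metis
  \<comment> \<open>Otherwise the precoloured edge would itself be a chord of the outer
    cycle.\<close>
  have "vs = [] \<or> ws = []"
  proof (rule ccontr)
    assume "\<not> ?thesis"
    then have "solvable W P Q \<delta> S"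
      by (intro chord_solvable[OF IH gs ys(1), of "[]" x vs y ws]) (use s e xy(1) in auto)
    then show False using not by simp
  qed
  then obtain zs where zs: "rdisc W (x # y # zs)" using ys(1,2) s by auto
  interpret c: pair_counterexample V E curve W P Q \<delta> S "x # y # zs" x y
    by unfold_locales (use IH gs not zs xy in auto)
  show False by (rule c.impossible)
qed

lemma single_solvable:
  assumes IH: "\<And>W' P' Q' \<delta>' S'. W' \<subset> W \<Longrightarrow> gscene W' P' Q' \<delta>' S' \<Longrightarrow> solvable W' P' Q' \<delta>' S'"
    and gs: "gscene W {v} Q \<delta> {}"
  shows "solvable W {v} Q \<delta> {}"
proof (rule ccontr)
  assume not: "\<not> solvable W {v} Q \<delta> {}"
  note g = gsceneD[OF gs]
  obtain ks where ks: "rdisc W ks" by (rule outer_cycle_or_solvable[OF IH gs _ not]) auto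
  have "v \<in> set ks" using g(2) B_rdisc[OF ks] by auto
  then obtain ys where ys: "rdisc W (v # ys)" "set (v # ys) = set ks" by (rule rdisc_rotate_to[OF ks])
  note l = rdisc_last[OF ys(1)]
  have BW: "B W = insert v (set ys)" using B_rdisc[OF ys(1)] by simp
  have dist: "distinct (v # ys)" using ys(1) unfolding rdisc_def ring_def by simp
  have ends: "w = hd ys \<or> w = last ys" if w: "w \<in> B W" "adj E w v" for w
  proof (rule ccontr)
    assume n: "\<not> ?thesis"
    have "w \<in> set ys" using w BW adjD(3)[OF w(2)] by simp
    then obtain vs ws where s: "ys = vs @ w # ws" using split_list by metis
    have "solvable W {v} Q \<delta> {}"
      by (rule chord_solvable[OF IH gs ys(1), of "[]" v vs w ws]) (use s n w adj_sym in auto)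
    then show False using not by simp
  qed
  \<comment> \<open>\<open>x\<close> is the neighbour of \<open>v\<close> to be precoloured,
    \<open>x'\<close> the other one on the outer cycle. The choice ensures that \<open>x'\<close> is
    in \<open>Q\<close> whenever one of them is, as (G3) for the pair needs its vertex of
    \<open>Q\<close> to be different from \<open>x\<close>.\<close>
  define x x' where "x = (if hd ys \<in> Q then last ys else hd ys)" and "x' = (if hd ys \<in> Q then hd ys else last ys)"
  have x: "adj E v x" "x \<noteq> x'" "\<And>w. w \<in> B W \<Longrightarrow> adj E w v \<Longrightarrow> w = x \<or> w = x'" "x \<in> Q \<Longrightarrow> x' \<in> Q"
    using l(2-4) ends unfolding x_def x'_def by auto
  have "ys \<noteq> []" using l(1) by auto
  then have xB: "x \<in> B W" using BW unfolding x_def by simp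
  have xv: "x \<noteq> v" using adjD(3)[OF x(1)] by simp
  let ?\<delta> = "\<delta>(x := 2)"
  have "gscene W {v, x} (Q - {x}) ?\<delta> {}"
  proof (rule normal_sceneI)
    show "card {v, x} \<le> 2" by (rule card_doubleton_le)
    show "adj E y z" if "y \<in> {v, x}" "z \<in> {v, x}" "y \<noteq> z" for y z using that x(1) adj_sym by auto
  qed (use g xB in auto)
  moreover have "card {v, x} = 2" using xv by simp
  ultimately obtain \<phi> where \<phi>: "good W {v, x} (Q - {x}) ?\<delta> \<phi>" "linkfree W {v, x} (Q - {x}) ?\<delta> \<phi>"
    using pair_solvable[OF IH] unfolding solvable_def by blast
  note h = goodD[OF \<phi>(1)]
  have x2: "\<phi> x = 2" using h(2)[of x] by simp
  have "good W {v} Q \<delta> \<phi>"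
    unfolding good_def
  proof (intro conjI ballI impI)
    show "\<phi> u = 1 \<or> \<phi> u = 2" if "u \<in> W" for u using h(1) that by simp
    show "\<phi> u = \<delta> u" if "u \<in> {v}" for u using h(2)[of v] that xv by simp
    show "\<phi> q = 2" if "q \<in> Q" for q using h(3)[of q] that x2 by (cases "q = x") auto
    show "forest (cls W \<phi> 1)" "forest (cls W \<phi> 2)" using h(4,5) by simp_all
    show "card (ones W \<phi> u) \<le> 3" if "u \<in> W" "\<phi> u = 1" for u using h(6) that by simp
    show "\<phi> u = 2" if "p \<in> {v}" "u \<in> W - {v}" "\<delta> p = 1" "adj E u p" for p u
      using h(7)[of v u] that x2 xv by (cases "u = x") auto
    show "card (ones W \<phi> u) \<le> 2" if "u \<in> B W - {v}" "\<phi> u = 1" for u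
      using h(8)[of u] that x2 by (cases "u = x") auto
  qed
  moreover have "linkfree W {v} Q \<delta> \<phi>"
    unfolding linkfree_def
  proof (intro allI impI)
    fix v' u w assume a: "{y \<in> {v}. \<delta> y = 1} = {v'}" "u \<in> Q" "adj E u v'" "w \<in> B W" "adj E w v'" "w \<noteq> u"
    have "v' \<in> {y \<in> {v}. \<delta> y = 1}" unfolding a(1) by simp
    then have v': "v' = v" "\<delta> v = 1" by blast+
    have o: "{y \<in> {v, x}. ?\<delta> y = 1} = {v}" using v' xv by auto
    have nc: "\<not> conn (cls W \<phi> 2) x' x" if "x' \<in> Q" "adj E x' v"
      using \<phi>(2)[unfolded linkfree_def, rule_format, OF o _ that(2) xB] that(1) x(1,2) adj_sym by auto
    have "u \<in> B W" using a(2) g(5) by auto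
    then have "u = x \<or> u = x'" "w = x \<or> w = x'" using x(3) a v' by auto
    \<comment> \<open>Without chords \<open>v\<close> has only the boundary neighbours
      \<open>x\<close> and \<open>x'\<close>, so (G3) concerns just this pair, and connection in
      colour 2 is symmetric.\<close>
    then have "u = x' \<and> w = x \<or> u = x \<and> w = x'" using a(6) by auto
    then show "\<not> conn (cls W \<phi> 2) u w"
      using nc x(4) a(2,3,5) v' conn_sym[of "cls W \<phi> 2" x x'] by auto
  qed
  ultimately show False using not unfolding solvable_def by blast
qed

lemma empty_solvable:
  assumes IH: "\<And>W' P' Q' \<delta>' S'. W' \<subset> W \<Longrightarrow> gscene W' P' Q' \<delta>' S' \<Longrightarrow> solvable W' P' Q' \<delta>' S'"
    and gs: "gscene W {} Q \<delta> {}"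
  shows "solvable W {} Q \<delta> {}"
proof (cases "W = {}")
  case True
  then show ?thesis using small_solvable[OF gs] by simp
next
  case False
  note g = gsceneD[OF gs]
  obtain b where b: "b \<in> B W" using B_nonempty[OF g(1) False] by auto
  have "gscene W {b} (Q - {b}) (\<lambda>_. 2) {}"
    by (rule normal_sceneI) (use g b in auto)
  then obtain \<phi> where \<phi>: "good W {b} (Q - {b}) (\<lambda>_. 2) \<phi>"
    using single_solvable[OF IH] unfolding solvable_def by blast
  note h = goodD[OF \<phi>]
  have b2: "\<phi> b = 2" using h(2)[of b] by simp
  have "good W {} Q \<delta> \<phi>"
    unfolding good_def
  proof (intro conjI ballI impI)
    show "\<phi> u = 1 \<or> \<phi> u = 2" if "u \<in> W" for u using h(1) that by simp
    show "\<phi> q = 2" if "q \<in> Q" for q using h(3)[of q] that b2 by (cases "q = b") auto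
    show "forest (cls W \<phi> 1)" "forest (cls W \<phi> 2)" using h(4,5) by simp_all
    show "card (ones W \<phi> u) \<le> 3" if "u \<in> W" "\<phi> u = 1" for u using h(6) that by simp
    show "card (ones W \<phi> u) \<le> 2" if "u \<in> B W - {}" "\<phi> u = 1" for u
      using h(8)[of u] that b2 by (cases "u = b") auto
  qed auto
  moreover have "linkfree W {} Q \<delta> \<phi>" unfolding linkfree_def by simp
  ultimately show ?thesis unfolding solvable_def by blast
qed

theorem gscene_solvable: "gscene W P Q \<delta> S \<Longrightarrow> solvable W P Q \<delta> S"
proof (induction "card W" arbitrary: W P Q \<delta> S rule: less_induct)
  case less
  note g = gsceneD[OF less.prems]
  have IH: "solvable W' P' Q' \<delta>' S'" if "W' \<subset> W" "gscene W' P' Q' \<delta>' S'" for W' P' Q' \<delta>' S'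
    using less.hyps[OF psubset_card_mono[OF finite_subset[OF g(1) finite_V] that(1)] that(2)] .
  have S: "card P = 2" if "S \<noteq> {}" using g(13)[OF that] by auto
  consider "card P = 0" | "card P = 1" | "card P = 2" using g(3) by linarith
  then show ?case
  proof cases
    case 1
    then have "P = {}" "S = {}" using g(12) S by auto
    then show ?thesis using empty_solvable[OF IH] less.prems by simp
  next
    case 2
    then obtain v where "P = {v}" by (rule card_1_singletonE)
    moreover have "S = {}" using S 2 by auto
    ultimately have "P = {v}" "S = {}" .
    then show ?thesis using single_solvable[OF IH] less.prems by simp
  next
    case 3
    then show ?thesis using pair_solvable[OF IH less.prems] by simp
  qed
qed

section \<open>Back to scenes and valid colourings of the given drawing\<close>

lemma boundary_vertices_B: "boundary_vertices V E curve = B V"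
proof -
  have "D V = drawing V E curve"
    unfolding D_def drawing_def using edgeE by (auto; blast)
  moreover have "v \<notin> outside (D V)" if "v \<in> V" for v
    using that outside_no_overlap[of "D V"] unfolding D_def by blast
  moreover have "open (Out V)" by (rule open_outside[OF closed_D]) simp
  ultimately show ?thesis
    unfolding boundary_vertices_def outer_face_def B_def frontier_def by (auto simp: interior_open)
qed

lemma mono_path_conn:
  assumes "mono_path V E \<phi> u w" "\<phi> u = c"
  shows "conn (cls V \<phi> c) u w"
proof -
  obtain ps where ps: "ps \<noteq> []" "hd ps = u" "last ps = w" "set ps \<subseteq> V"
      "\<forall>i. Suc i < length ps \<longrightarrow> adj E (ps ! i) (ps ! Suc i)" "\<forall>x\<in>set ps. \<phi> x = \<phi> u"
    using assms(1) unfolding mono_path_def by (elim exE conjE)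
  have "conn (cls V \<phi> c) (ps ! 0) (ps ! i)" if "i < length ps" for i
    using that
  proof (induction i)
    case (Suc i)
    have "ps ! i \<in> set ps" "ps ! Suc i \<in> set ps" using Suc.prems by simp_all
    then have "conn (cls V \<phi> c) (ps ! i) (ps ! Suc i)"
      using ps(4,5,6) assms(2) Suc.prems by (intro cls_edge) auto
    then show ?case using conn_trans[of _ _ "ps ! i"] Suc by simp
  qed (rule conn_refl)
  from this[of "length ps - 1"] show ?thesis using ps(1-3) by (simp add: hd_conv_nth last_conv_nth)
qed

lemma valid_coloringI:
  assumes "good V P Q \<delta> \<phi>" "linkfree V P Q \<delta> \<phi>" "Q \<subseteq> V"
  shows "valid_coloring V E curve P Q \<delta> \<phi>"
proof -
  note h = goodD[OF assms(1)]
  have cl: "{v \<in> V. \<phi> v = c} = cls V \<phi> c" for c unfolding cls_def ..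
  show ?thesis
    unfolding valid_coloring_def cl boundary_vertices_B
  proof (intro conjI ballI impI)
    show "\<phi> v \<in> {1, 2}" if "v \<in> V" for v using h(1)[OF that] by simp
    show "max_degree_le E (cls V \<phi> 1) 3"
      unfolding max_degree_le_def
    proof
      fix v assume "v \<in> cls V \<phi> 1"
      moreover have "{u \<in> cls V \<phi> 1. adj E u v} = ones V \<phi> v" unfolding cls_def ones_def by auto
      ultimately show "card {u \<in> cls V \<phi> 1. adj E u v} \<le> 3" using h(6)[of v] unfolding cls_def by simp
    qed
    show "\<phi> u \<noteq> 1" if "v \<in> P" "u \<in> V - P" "\<delta> v = 1 \<and> adj E u v" for v u using h(7)[of v u] that by simp
    show "\<not> mono_path V E \<phi> u w"
      if a: "v \<in> P" "u \<in> Q" "{x \<in> P. \<delta> x = 1} = {v} \<and> adj E u v" "w \<in> N_K V E curve v - {u}" for v u w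
    proof
      assume m: "mono_path V E \<phi> u w"
      have wv: "{w, v} \<in> E" "PI {w, v} \<subseteq> frontier (outer_face V E curve)" using a(4) unfolding N_K_def boundary_edges_def by auto
      then have e: "adj E w v" unfolding adj_def by simp
      \<comment> \<open>The edge lies on the frontier of the outer face, hence so does its end
        \<open>w\<close>: a neighbour along the outer boundary is among the vertices that
        \<open>linkfree\<close> covers.\<close>
      have "w \<in> PI {w, v}" using PI_Int_V[OF wv(1)] by auto
      then have "w \<in> B V" using wv(2) adjD(1)[OF e] unfolding boundary_vertices_B[symmetric] boundary_vertices_def by auto
      moreover have "conn (cls V \<phi> 2) u w" by (rule mono_path_conn[OF m h(3)[OF a(2)]])
      ultimately show False
        using assms(2)[unfolded linkfree_def, rule_format, of v u w] a e by auto
    qed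
    show "card {u \<in> V. \<phi> u = 1 \<and> adj E u v} \<le> 2" if "v \<in> B V - P" "\<phi> v = 1" for v
      using h(8)[of v] that unfolding ones_def by simp
  qed (use h in auto)
qed

end

theorem theorem2:
  fixes V :: "complex set" and E :: "complex set set"
    and curve :: "complex set \<Rightarrow> real \<Rightarrow> complex"
    and P Q :: "complex set" and \<delta> :: "complex \<Rightarrow> nat"
  assumes "scene V E curve P Q \<delta>"
    and "card P \<le> 2"
  shows "\<exists>\<phi>. valid_coloring V E curve P Q \<delta> \<phi>"
proof -
  interpret triangle_free_drawing V E curve
    by unfold_locales (use assms(1) in \<open>simp_all add: scene_def\<close>)
  have s: "P \<subseteq> V" "consecutive_on_K V E curve P" "Q \<subseteq> B V - P" "\<forall>u\<in>Q. \<forall>v\<in>Q. \<not> adj E u v" "\<forall>v\<in>P. \<delta> v \<in> {1, 2}"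
    using assms(1) unfolding scene_def boundary_vertices_B by simp_all
  have "gscene V P Q \<delta> {}"
  proof (rule normal_sceneI)
    show "P \<subseteq> B V" using s(2) unfolding consecutive_on_K_def boundary_vertices_B by simp
    show "adj E x y" if xy: "x \<in> P" "y \<in> P" "x \<noteq> y" for x y
    proof -
      have fin: "finite P" using s(1) finite_V finite_subset by blast
      have sub: "{x, y} \<subseteq> P" using xy by simp
      then have "card P \<ge> 2" using card_mono[OF fin sub] xy(3) by simp
      then have "card P = 2" "P \<in> E" using s(2) unfolding consecutive_on_K_def boundary_edges_def by auto
      then have "P = {x, y}" using card_subset_eq[OF fin sub] xy(3) by simp
      then show ?thesis using \<open>P \<in> E\<close> unfolding adj_def by simp
    qed
  qed (use s assms(2) in auto)
  then have "solvable V P Q \<delta> {}" by (rule gscene_solvable)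
  then obtain \<phi> where "good V P Q \<delta> \<phi>" "linkfree V P Q \<delta> \<phi>" unfolding solvable_def by blast
  moreover have "Q \<subseteq> V" using s(3) B_subset[of V] by auto
  ultimately show ?thesis using valid_coloringI by blast
qed

end
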